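(* Every isometric automorphism $\Phi$ of the Banach algebra $A_{ph}^{\mathbb{R}^+}$ is of the form $$\Phi(M_\lambda)=M_{k_1\lambda},\qquad \Phi(D_\mu)=D_{k_2\mu},\qquad \Phi(V_t)=c(t)V_t\qquad (\lambda,\mu, t\ge 0),$$ where $k_1,k_2>0$ satisfy $k_1k_2=1$ and $c:[0,\infty)\to\mathbb{C}$, $t\mapsto c(t)$, is multiplicative, i.e. $c(s+t)=c(s)c(t)$ for all $s,t\ge 0$. Furthermore, the algebra $A_{ph}^{\mathbb{R}^+}$ is chiral, i.e. there is no isometric algebra isomorphism from $A_{ph}^{\mathbb{R}^+}$ onto its adjoint algebra $(A_{ph}^{\mathbb{R}^+})^\ast=\{X^\ast: X\in A_{ph}^{\mathbb{R}^+}\}$.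
   Context: On $L^2(\mathbb{R})$ define the unitary operators $(M_\lambda f)(x)=e^{i\lambda x}f(x)$, $(D_\mu f)(x)=f(x-\mu)$, $(V_tf)(x)=e^{t/2}f(e^tx)$ for $\lambda,\mu,t\in\mathbb{R}$. The algebra $A_{ph}^{\mathbb{R}^+}$ is the operator-norm closed (non-selfadjoint) subalgebra of $B(L^2(\mathbb{R}))$ generated by $\{M_\lambda, D_\mu, V_t : \lambda,\mu,t\in[0,\infty)\}$. An isometric automorphism is a bijective algebra homomorphism of the algebra onto itself that is isometric for the operator norm; an isometric isomorphism between two such algebras is a bijective isometric (complex linear) algebra homomorphism. The map $c$ is not assumed to be continuous. *)

theory Defs
  imports "HOL-Analysis.Analysis"
begin

section \<open>The Hilbert space of square-integrable functions on the real line\<close>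

definition square_integrable :: "(real \<Rightarrow> complex) \<Rightarrow> bool" where
  "square_integrable f \<longleftrightarrow>
     f \<in> borel_measurable lborel \<and> integrable lborel (\<lambda>x. (cmod (f x))\<^sup>2)"

definition L2_eq :: "(real \<Rightarrow> complex) \<Rightarrow> (real \<Rightarrow> complex) \<Rightarrow> bool" where
  "L2_eq f g \<longleftrightarrow> square_integrable f \<and> square_integrable g \<and> (AE x in lborel. f x = g x)"

lemma square_integrable_zero: "square_integrable (\<lambda>x. 0)"
  by (simp add: square_integrable_def)

lemma square_integrable_measurable [measurable_dest]:
  "square_integrable f \<Longrightarrow> f \<in> borel_measurable borel"
  by (simp add: square_integrable_def)

lemma square_integrable_dominated:
  assumes "f \<in> borel_measurable borel" "integrable lborel h"
    and "\<And>x. (cmod (f x))\<^sup>2 \<le> h x"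
  shows "square_integrable f"
  unfolding square_integrable_def
proof
  show "integrable lborel (\<lambda>x. (cmod (f x))\<^sup>2)"
  proof (rule Bochner_Integration.integrable_bound[OF assms(2)])
    show "AE x in lborel. norm ((cmod (f x))\<^sup>2) \<le> norm (h x)"
      using assms(3) by (intro AE_I2) (auto intro: order_trans[OF _ abs_ge_self])
  qed (use assms(1) in measurable)
qed (use assms(1) in simp)

lemma square_integrable_add:
  assumes "square_integrable f" "square_integrable g"
  shows "square_integrable (\<lambda>x. f x + g x)"
proof (rule square_integrable_dominated)
  show "(\<lambda>x. f x + g x) \<in> borel_measurable borel"
    using assms by measurable
  show "integrable lborel (\<lambda>x. 2 * (cmod (f x))\<^sup>2 + 2 * (cmod (g x))\<^sup>2)"
    using assms by (auto simp: square_integrable_def)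
  show "(cmod (f x + g x))\<^sup>2 \<le> 2 * (cmod (f x))\<^sup>2 + 2 * (cmod (g x))\<^sup>2" for x
  proof -
    have "(cmod (f x + g x))\<^sup>2 \<le> (cmod (f x) + cmod (g x))\<^sup>2"
      by (intro power_mono norm_triangle_ineq) auto
    also have "\<dots> \<le> 2 * (cmod (f x))\<^sup>2 + 2 * (cmod (g x))\<^sup>2"
      using sum_squares_bound[of "cmod (f x)" "cmod (g x)"] by (simp add: power2_sum)
    finally show ?thesis .
  qed
qed

lemma square_integrable_cmult:
  "square_integrable f \<Longrightarrow> square_integrable (\<lambda>x. c * f x)"
  by (auto simp: square_integrable_def norm_mult power_mult_distrib)

lemma square_integrable_scaleR:
  "square_integrable f \<Longrightarrow> square_integrable (\<lambda>x. r *\<^sub>R f x)"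
  using square_integrable_cmult[of f "of_real r"] by (simp add: scaleR_conv_of_real)

lemma square_integrable_uminus:
  "square_integrable f \<Longrightarrow> square_integrable (\<lambda>x. - f x)"
  using square_integrable_cmult[of f "-1"] by simp

lemma square_integrable_diff:
  "square_integrable f \<Longrightarrow> square_integrable g \<Longrightarrow> square_integrable (\<lambda>x. f x - g x)"
  using square_integrable_add[OF _ square_integrable_uminus, of f g] by simp

lemma square_integrable_product:
  assumes "square_integrable f" "square_integrable g"
  shows "integrable lborel (\<lambda>x. f x * cnj (g x))"
proof (rule Bochner_Integration.integrable_bound)
  show "integrable lborel (\<lambda>x. (cmod (f x))\<^sup>2 + (cmod (g x))\<^sup>2)"
    using assms by (auto simp: square_integrable_def)
  have [measurable]: "f \<in> borel_measurable borel" "g \<in> borel_measurable borel"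
    using assms by (auto dest: square_integrable_measurable)
  have [measurable]: "(\<lambda>x. cnj (g x)) \<in> borel_measurable borel"
    by (rule borel_measurable_continuous_on[of cnj]) (auto intro: continuous_intros)
  show "(\<lambda>x. f x * cnj (g x)) \<in> borel_measurable lborel"
    by measurable
  have "cmod (f x) * cmod (g x) \<le> (cmod (f x))\<^sup>2 + (cmod (g x))\<^sup>2" for x
    using sum_squares_bound[of "cmod (f x)" "cmod (g x)"]
      mult_nonneg_nonneg[OF norm_ge_zero norm_ge_zero, of "f x" "g x"] by linarith
  then show "AE x in lborel. norm (f x * cnj (g x)) \<le> norm ((cmod (f x))\<^sup>2 + (cmod (g x))\<^sup>2)"
    by (simp add: norm_mult)
qed

lemma square_integrable_affine:
  assumes f: "square_integrable f" and c: "c \<noteq> (0::real)"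
  shows "square_integrable (\<lambda>x. f (t + c * x))"
proof -
  have [measurable]: "f \<in> borel_measurable borel"
    using f by (rule square_integrable_measurable)
  have "integrable lborel (\<lambda>x. (cmod (f x))\<^sup>2)"
    using f by (simp add: square_integrable_def)
  from lborel_integrable_real_affine[OF this c, of t]
  show ?thesis by (simp add: square_integrable_def)
qed

lemma L2_eq_affine:
  assumes "L2_eq f g" and c: "c \<noteq> (0::real)"
  shows "L2_eq (\<lambda>x. f (t + c * x)) (\<lambda>x. g (t + c * x))"
proof -
  have [measurable]: "f \<in> borel_measurable borel" "g \<in> borel_measurable borel"
    using assms by (auto simp: L2_eq_def dest: square_integrable_measurable)
  have "AE x in lborel. f (t + c * x) = g (t + c * x)"
    by (rule AE_borel_affine[OF c]) (use assms in \<open>auto simp: L2_eq_def\<close>)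
  then show ?thesis
    using assms by (auto simp: L2_eq_def intro: square_integrable_affine)
qed

lemma part_equivp_L2_eq: "part_equivp L2_eq"
proof (rule part_equivpI)
  show "\<exists>f. L2_eq f f"
    by (rule exI[of _ "\<lambda>x. 0"]) (simp add: L2_eq_def square_integrable_zero)
  show "symp L2_eq"
    by (auto simp: symp_def L2_eq_def)
  show "transp L2_eq"
    unfolding transp_def L2_eq_def by fastforce
qed

quotient_type L2R = "real \<Rightarrow> complex" / partial: L2_eq
  by (rule part_equivp_L2_eq)

lift_definition cinner_L2R :: "L2R \<Rightarrow> L2R \<Rightarrow> complex" is
  "\<lambda>f g. LINT x|lborel. f x * cnj (g x)"
proof -
  fix f f' g g' assume *: "L2_eq f f'" "L2_eq g g'"
  then have [measurable]:
      "(\<lambda>x. f x * cnj (g x)) \<in> borel_measurable lborel"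
      "(\<lambda>x. f' x * cnj (g' x)) \<in> borel_measurable lborel"
    using square_integrable_product[THEN borel_measurable_integrable] by (auto simp: L2_eq_def)
  show "(LINT x|lborel. f x * cnj (g x)) = (LINT x|lborel. f' x * cnj (g' x))"
    by (rule integral_cong_AE) (use * in \<open>auto simp: L2_eq_def\<close>)
qed

lift_definition cscale_L2R :: "complex \<Rightarrow> L2R \<Rightarrow> L2R" is "\<lambda>c f x. c * f x"
  by (auto simp: L2_eq_def intro: square_integrable_cmult)

instantiation L2R :: real_inner
begin

lift_definition zero_L2R :: L2R is "\<lambda>x. 0"
  by (simp add: L2_eq_def square_integrable_zero)

lift_definition plus_L2R :: "L2R \<Rightarrow> L2R \<Rightarrow> L2R" is "\<lambda>f g x. f x + g x"
  by (auto simp: L2_eq_def intro: square_integrable_add)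

lift_definition minus_L2R :: "L2R \<Rightarrow> L2R \<Rightarrow> L2R" is "\<lambda>f g x. f x - g x"
  by (auto simp: L2_eq_def intro: square_integrable_diff)

lift_definition uminus_L2R :: "L2R \<Rightarrow> L2R" is "\<lambda>f x. - f x"
  by (auto simp: L2_eq_def intro: square_integrable_uminus)

lift_definition scaleR_L2R :: "real \<Rightarrow> L2R \<Rightarrow> L2R" is "\<lambda>r f x. r *\<^sub>R f x"
  by (auto simp: L2_eq_def intro: square_integrable_scaleR)

definition inner_L2R :: "L2R \<Rightarrow> L2R \<Rightarrow> real" where
  "inner_L2R f g = Re (cinner_L2R f g)"

lift_definition norm_L2R :: "L2R \<Rightarrow> real" is
  "\<lambda>f. sqrt (LINT x|lborel. (cmod (f x))\<^sup>2)"
proof -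
  fix f g assume *: "L2_eq f g"
  then have "f \<in> borel_measurable borel" "g \<in> borel_measurable borel"
    by (auto simp: L2_eq_def dest: square_integrable_measurable)
  then have "(LINT x|lborel. (cmod (f x))\<^sup>2) = (LINT x|lborel. (cmod (g x))\<^sup>2)"
    using * by (intro integral_cong_AE) (auto simp: L2_eq_def)
  then show "sqrt (LINT x|lborel. (cmod (f x))\<^sup>2) = sqrt (LINT x|lborel. (cmod (g x))\<^sup>2)"
    by simp
qed

definition dist_L2R :: "L2R \<Rightarrow> L2R \<Rightarrow> real" where
  "dist_L2R f g = norm (f - g)"

definition sgn_L2R :: "L2R \<Rightarrow> L2R" where
  "sgn_L2R f = scaleR (inverse (norm f)) f"

definition uniformity_L2R :: "(L2R \<times> L2R) filter" where
  "uniformity_L2R = (INF e\<in>{0<..}. principal {(x, y). dist x y < e})"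

definition open_L2R :: "L2R set \<Rightarrow> bool" where
  "open_L2R U \<longleftrightarrow> (\<forall>x\<in>U. eventually (\<lambda>(x', y). x' = x \<longrightarrow> y \<in> U) uniformity)"

instance
proof
  fix f g h :: L2R and a b r :: real
  show "f + g + h = f + (g + h)"
    by transfer (auto simp: L2_eq_def add.assoc intro!: square_integrable_add)
  show "f + g = g + f"
    by transfer (auto simp: L2_eq_def add.commute intro!: square_integrable_add)
  show "0 + f = f"
    by transfer (auto simp: L2_eq_def)
  show "- f + f = 0"
    by transfer (auto simp: L2_eq_def square_integrable_zero)
  show "f - g = f + - g"
    by transfer (auto simp: L2_eq_def intro: square_integrable_diff)
  show "a *\<^sub>R (f + g) = a *\<^sub>R f + a *\<^sub>R g"
    by transfer (auto simp: L2_eq_def scaleR_add_right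
        intro!: square_integrable_add square_integrable_scaleR)
  show "(a + b) *\<^sub>R f = a *\<^sub>R f + b *\<^sub>R f"
    by transfer (auto simp: L2_eq_def scaleR_add_left
        intro!: square_integrable_add square_integrable_scaleR)
  show "a *\<^sub>R b *\<^sub>R f = (a * b) *\<^sub>R f"
    by transfer (auto simp: L2_eq_def mult.assoc
        intro!: square_integrable_scaleR)
  show "1 *\<^sub>R f = f"
    by transfer (auto simp: L2_eq_def)
  show "sgn f = inverse (norm f) *\<^sub>R f"
    by (simp add: sgn_L2R_def)
  show "dist f g = norm (f - g)"
    by (rule dist_L2R_def)
  show "uniformity = (INF e\<in>{0<..}. principal {(x, y :: L2R). dist x y < e})"
    by (rule uniformity_L2R_def)
  show "open U \<longleftrightarrow> (\<forall>x\<in>U. eventually (\<lambda>(x', y). x' = x \<longrightarrow> y \<in> U) uniformity)"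
    for U :: "L2R set"
    by (rule open_L2R_def)
  have cinner_commute: "cinner_L2R f g = cnj (cinner_L2R g f)"
    by transfer (simp add: mult.commute flip: Bochner_Integration.integral_cnj)
  then show "inner f g = inner g f"
    unfolding inner_L2R_def by simp
  have "cinner_L2R (f + g) h = cinner_L2R f h + cinner_L2R g h"
    by transfer (auto simp: L2_eq_def distrib_right square_integrable_product)
  then show "inner (f + g) h = inner f h + inner g h"
    by (simp add: inner_L2R_def)
  have "cinner_L2R (r *\<^sub>R f) g = r *\<^sub>R cinner_L2R f g"
    by transfer simp
  then show "inner (r *\<^sub>R f) g = r * inner f g"
    by (simp add: inner_L2R_def)
  have inner_self: "inner f f = (norm f)\<^sup>2"
    unfolding inner_L2R_def
    by transfer (simp add: complex_norm_square[symmetric] flip: of_real_power)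
  then show "0 \<le> inner f f"
    by simp
  have "0 \<le> norm f"
    by transfer simp
  then show "norm f = sqrt (inner f f)"
    by (simp add: inner_self)
  have "norm f = 0 \<longleftrightarrow> f = 0"
  proof transfer
    fix f assume f: "L2_eq f f"
    then have "integrable lborel (\<lambda>x. (cmod (f x))\<^sup>2)"
      by (simp add: L2_eq_def square_integrable_def)
    from integral_nonneg_eq_0_iff_AE[OF this]
    show "(sqrt (LINT x|lborel. (cmod (f x))\<^sup>2) = 0) = L2_eq f (\<lambda>x. 0)"
      using f by (simp add: L2_eq_def square_integrable_zero)
  qed
  then show "inner f f = 0 \<longleftrightarrow> f = 0"
    by (simp add: inner_self)
qed

end

lemma norm_cscale_L2R: "norm (cscale_L2R c f) = cmod c * norm f"
  by transfer (simp add: norm_mult power_mult_distrib real_sqrt_mult)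

lemma bounded_linear_cscale_L2R: "bounded_linear (cscale_L2R c)"
proof (rule bounded_linear_intro)
  fix f g :: L2R and r :: real
  show "cscale_L2R c (f + g) = cscale_L2R c f + cscale_L2R c g"
    by transfer (auto simp: L2_eq_def distrib_left
        intro!: square_integrable_add square_integrable_cmult)
  show "cscale_L2R c (r *\<^sub>R f) = r *\<^sub>R cscale_L2R c f"
    by transfer (auto simp: L2_eq_def intro!: square_integrable_scaleR square_integrable_cmult)
  show "norm (cscale_L2R c f) \<le> norm f * cmod c"
    by (simp add: norm_cscale_L2R)
qed

section \<open>Bounded operators\<close>

text \<open>
  The library type \<^typ>\<open>L2R \<Rightarrow>\<^sub>L L2R\<close>, normed by the operator norm, consists of the bounded
  real-linear maps; \<open>B_L2R\<close> is its complex-linear part, the usual $B(L^2(\mathbb{R}))$.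
\<close>

definition B_L2R :: "(L2R \<Rightarrow>\<^sub>L L2R) set" where
  "B_L2R = {T. \<forall>c f. blinfun_apply T (cscale_L2R c f) = cscale_L2R c (blinfun_apply T f)}"

definition cscale_op :: "complex \<Rightarrow> (L2R \<Rightarrow>\<^sub>L L2R) \<Rightarrow> (L2R \<Rightarrow>\<^sub>L L2R)" where
  "cscale_op c T = Blinfun (\<lambda>f. cscale_L2R c (blinfun_apply T f))"

lemma cscale_op_apply [simp]:
  "blinfun_apply (cscale_op c T) f = cscale_L2R c (blinfun_apply T f)"
  unfolding cscale_op_def
  by (simp add: bounded_linear_Blinfun_apply
      bounded_linear_compose[OF bounded_linear_cscale_L2R blinfun.bounded_linear_right])

text \<open>
  By the Riesz theorem each \<open>X \<in> B_L2R\<close> has exactly one \<open>Y\<close> with \<open>is_adjoint X Y\<close>, so that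
  \<open>adjoint_algebra A\<close> is the set of all $X^*$ with $X$ in \<open>A\<close>.
\<close>

definition is_adjoint :: "(L2R \<Rightarrow>\<^sub>L L2R) \<Rightarrow> (L2R \<Rightarrow>\<^sub>L L2R) \<Rightarrow> bool" where
  "is_adjoint X Y \<longleftrightarrow>
     (\<forall>f g. cinner_L2R (blinfun_apply X f) g = cinner_L2R f (blinfun_apply Y g))"

definition adjoint_algebra :: "(L2R \<Rightarrow>\<^sub>L L2R) set \<Rightarrow> (L2R \<Rightarrow>\<^sub>L L2R) set" where
  "adjoint_algebra A = {Y \<in> B_L2R. \<exists>X\<in>A. is_adjoint X Y}"

definition closed_subalgebra :: "(L2R \<Rightarrow>\<^sub>L L2R) set \<Rightarrow> bool" where
  "closed_subalgebra S \<longleftrightarrow> S \<subseteq> B_L2R \<and> closed S \<and> 0 \<in> S \<and>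
     (\<forall>X\<in>S. \<forall>Y\<in>S. X + Y \<in> S) \<and> (\<forall>c. \<forall>X\<in>S. cscale_op c X \<in> S) \<and>
     (\<forall>X\<in>S. \<forall>Y\<in>S. X o\<^sub>L Y \<in> S)"

definition generated_algebra :: "(L2R \<Rightarrow>\<^sub>L L2R) set \<Rightarrow> (L2R \<Rightarrow>\<^sub>L L2R) set" where
  "generated_algebra G = \<Inter>{S. closed_subalgebra S \<and> G \<subseteq> S}"

text \<open>
  Maps between operator algebras are total functions on the type of operators; only their
  values on the domain \<open>A\<close> are constrained.
\<close>

definition isometric_isomorphism ::
  "(L2R \<Rightarrow>\<^sub>L L2R) set \<Rightarrow> (L2R \<Rightarrow>\<^sub>L L2R) set \<Rightarrow> ((L2R \<Rightarrow>\<^sub>L L2R) \<Rightarrow> (L2R \<Rightarrow>\<^sub>L L2R)) \<Rightarrow> bool" where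
  "isometric_isomorphism A B \<Phi> \<longleftrightarrow> bij_betw \<Phi> A B \<and>
     (\<forall>X\<in>A. \<forall>Y\<in>A. \<Phi> (X + Y) = \<Phi> X + \<Phi> Y) \<and>
     (\<forall>c. \<forall>X\<in>A. \<Phi> (cscale_op c X) = cscale_op c (\<Phi> X)) \<and>
     (\<forall>X\<in>A. \<forall>Y\<in>A. \<Phi> (X o\<^sub>L Y) = \<Phi> X o\<^sub>L \<Phi> Y) \<and>
     (\<forall>X\<in>A. norm (\<Phi> X) = norm X)"

abbreviation isometric_automorphism ::
  "(L2R \<Rightarrow>\<^sub>L L2R) set \<Rightarrow> ((L2R \<Rightarrow>\<^sub>L L2R) \<Rightarrow> (L2R \<Rightarrow>\<^sub>L L2R)) \<Rightarrow> bool" where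
  "isometric_automorphism A \<equiv> isometric_isomorphism A A"

definition chiral :: "(L2R \<Rightarrow>\<^sub>L L2R) set \<Rightarrow> bool" where
  "chiral A \<longleftrightarrow> \<not> (\<exists>\<Psi>. isometric_isomorphism A (adjoint_algebra A) \<Psi>)"

section \<open>Multiplication, translation and dilation\<close>

lemma square_integrable_character:
  assumes "square_integrable f"
  shows "square_integrable (\<lambda>x. exp (\<i> * complex_of_real (l * x)) * f x)"
proof -
  have [measurable]: "f \<in> borel_measurable borel"
    using assms by (rule square_integrable_measurable)
  have [measurable]: "(\<lambda>x. exp (\<i> * complex_of_real (l * x))) \<in> borel_measurable borel"
    by (intro borel_measurable_continuous_onI continuous_intros)
  have "(\<lambda>x. exp (\<i> * complex_of_real (l * x)) * f x) \<in> borel_measurable lborel"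
    by measurable
  then show ?thesis
    using assms by (simp add: square_integrable_def norm_mult)
qed

lemma square_integrable_translate:
  "square_integrable f \<Longrightarrow> square_integrable (\<lambda>x. f (x - m))"
  using square_integrable_affine[of f 1 "- m"] by simp

lemma square_integrable_dilate:
  "square_integrable f \<Longrightarrow> square_integrable (\<lambda>x. c * f (exp t * x))"
  using square_integrable_cmult[OF square_integrable_affine[of f "exp t" 0]] by simp

lift_definition mult_fun :: "real \<Rightarrow> L2R \<Rightarrow> L2R" is
  "\<lambda>l f x. exp (\<i> * complex_of_real (l * x)) * f x"
  unfolding L2_eq_def by (auto intro!: square_integrable_character simp del: of_real_mult)

lift_definition transl_fun :: "real \<Rightarrow> L2R \<Rightarrow> L2R" is "\<lambda>m f x. f (x - m)"
  using L2_eq_affine[where c=1 and t="- m" for m] by simp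

lift_definition dil_fun :: "real \<Rightarrow> L2R \<Rightarrow> L2R" is
  "\<lambda>t f x. complex_of_real (exp (t / 2)) * f (exp t * x)"
proof -
  fix t :: real and f g assume "L2_eq f g"
  from L2_eq_affine[OF this, of "exp t" 0]
  show "L2_eq (\<lambda>x. complex_of_real (exp (t / 2)) * f (exp t * x))
     (\<lambda>x. complex_of_real (exp (t / 2)) * g (exp t * x))"
    by (auto simp: L2_eq_def simp del: of_real_exp intro: square_integrable_cmult)
qed

lemma norm_mult_fun: "norm (mult_fun l f) = norm f"
  by transfer (simp add: norm_mult)

lemma norm_transl_fun: "norm (transl_fun m f) = norm f"
proof transfer
  fix m :: real and f :: "real \<Rightarrow> complex"
  show "sqrt (LINT x|lborel. (cmod (f (x - m)))\<^sup>2) = sqrt (LINT x|lborel. (cmod (f x))\<^sup>2)"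
    using lborel_integral_real_affine[of 1 "\<lambda>x. (cmod (f x))\<^sup>2" "- m"] by simp
qed

lemma norm_dil_fun: "norm (dil_fun t f) = norm f"
proof transfer
  fix t :: real and f :: "real \<Rightarrow> complex"
  have "(exp (t / 2))\<^sup>2 = exp t"
    by (simp add: power2_eq_square flip: exp_add)
  then show "sqrt (LINT x|lborel. (cmod (complex_of_real (exp (t / 2)) * f (exp t * x)))\<^sup>2)
     = sqrt (LINT x|lborel. (cmod (f x))\<^sup>2)"
    using lborel_integral_real_affine[of "exp t" "\<lambda>x. (cmod (f x))\<^sup>2" 0]
    by (simp add: norm_mult power_mult_distrib del: of_real_exp)
qed

lemma bounded_linear_mult_fun: "bounded_linear (mult_fun l)"
proof (rule bounded_linear_intro)
  fix r :: real and f g :: L2R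
  show "mult_fun l (f + g) = mult_fun l f + mult_fun l g"
    by transfer (auto simp: L2_eq_def distrib_left simp del: of_real_mult of_real_exp
        intro!: square_integrable_add square_integrable_character)
  show "mult_fun l (r *\<^sub>R f) = r *\<^sub>R mult_fun l f"
    by transfer (auto simp: L2_eq_def simp del: of_real_mult of_real_exp
        intro!: square_integrable_scaleR square_integrable_character)
  show "norm (mult_fun l f) \<le> norm f * 1"
    by (simp add: norm_mult_fun)
qed

lemma bounded_linear_transl_fun: "bounded_linear (transl_fun m)"
proof (rule bounded_linear_intro)
  fix r :: real and f g :: L2R
  show "transl_fun m (f + g) = transl_fun m f + transl_fun m g"
    by transfer (auto simp: L2_eq_def distrib_left simp del: of_real_mult of_real_exp
        intro!: square_integrable_add square_integrable_translate)
  show "transl_fun m (r *\<^sub>R f) = r *\<^sub>R transl_fun m f"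
    by transfer (auto simp: L2_eq_def simp del: of_real_mult of_real_exp
        intro!: square_integrable_scaleR square_integrable_translate)
  show "norm (transl_fun m f) \<le> norm f * 1"
    by (simp add: norm_transl_fun)
qed

lemma bounded_linear_dil_fun: "bounded_linear (dil_fun t)"
proof (rule bounded_linear_intro)
  fix r :: real and f g :: L2R
  show "dil_fun t (f + g) = dil_fun t f + dil_fun t g"
    by transfer (auto simp: L2_eq_def distrib_left simp del: of_real_mult of_real_exp
        intro!: square_integrable_add square_integrable_dilate)
  show "dil_fun t (r *\<^sub>R f) = r *\<^sub>R dil_fun t f"
    by transfer (auto simp: L2_eq_def simp del: of_real_mult of_real_exp
        intro!: square_integrable_scaleR square_integrable_dilate)
  show "norm (dil_fun t f) \<le> norm f * 1"
    by (simp add: norm_dil_fun)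
qed

definition mult_op :: "real \<Rightarrow> L2R \<Rightarrow>\<^sub>L L2R" where
  "mult_op l = Blinfun (mult_fun l)"

definition transl_op :: "real \<Rightarrow> L2R \<Rightarrow>\<^sub>L L2R" where
  "transl_op m = Blinfun (transl_fun m)"

definition dil_op :: "real \<Rightarrow> L2R \<Rightarrow>\<^sub>L L2R" where
  "dil_op t = Blinfun (dil_fun t)"

lemma mult_op_apply [simp]: "blinfun_apply (mult_op l) f = mult_fun l f"
  by (simp add: mult_op_def bounded_linear_Blinfun_apply bounded_linear_mult_fun)

lemma transl_op_apply [simp]: "blinfun_apply (transl_op m) f = transl_fun m f"
  by (simp add: transl_op_def bounded_linear_Blinfun_apply bounded_linear_transl_fun)

lemma dil_op_apply [simp]: "blinfun_apply (dil_op t) f = dil_fun t f"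
  by (simp add: dil_op_def bounded_linear_Blinfun_apply bounded_linear_dil_fun)

definition A_ph :: "(L2R \<Rightarrow>\<^sub>L L2R) set" where
  "A_ph = generated_algebra (mult_op ` {0..} \<union> transl_op ` {0..} \<union> dil_op ` {0..})"

lemma closed_subalgebra_B_L2R: "closed_subalgebra B_L2R"
  unfolding closed_subalgebra_def
proof (intro conjI ballI allI)
  have cont: "continuous_on UNIV (cscale_L2R c)" for c
    by (rule linear_continuous_on[OF bounded_linear_cscale_L2R])
  have eq: "B_L2R = (\<Inter>c. \<Inter>f. {T. blinfun_apply T (cscale_L2R c f) = cscale_L2R c (blinfun_apply T f)})"
    by (auto simp: B_L2R_def)
  have cl: "closed {T. blinfun_apply T (cscale_L2R c f) = cscale_L2R c (blinfun_apply T f)}" for c f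
    by (intro closed_Collect_eq continuous_on_compose2[OF cont] continuous_intros) auto
  show "closed B_L2R"
    unfolding eq by (intro closed_INT ballI cl)
  have comm: "cscale_L2R c (cscale_L2R d f) = cscale_L2R d (cscale_L2R c f)" for c d f
    by transfer (auto simp: L2_eq_def mult.left_commute intro!: square_integrable_cmult)
  show "0 \<in> B_L2R"
    using bounded_linear.linear[OF bounded_linear_cscale_L2R, THEN linear_0] by (simp add: B_L2R_def)
  show "X + Y \<in> B_L2R" if "X \<in> B_L2R" "Y \<in> B_L2R" for X Y
    using that bounded_linear.linear[OF bounded_linear_cscale_L2R, THEN linear_add]
    by (simp add: B_L2R_def blinfun.add_left)
  show "cscale_op c X \<in> B_L2R" if "X \<in> B_L2R" for c X
    using that comm by (simp add: B_L2R_def)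
  show "X o\<^sub>L Y \<in> B_L2R" if "X \<in> B_L2R" "Y \<in> B_L2R" for X Y
    using that by (simp add: B_L2R_def)
qed simp

lemma generators_in_B_L2R:
  "mult_op l \<in> B_L2R" "transl_op m \<in> B_L2R" "dil_op t \<in> B_L2R"
proof -
  have "mult_fun l (cscale_L2R c f) = cscale_L2R c (mult_fun l f)" for c f
    by transfer (auto simp: L2_eq_def mult.left_commute simp del: of_real_mult
        intro!: square_integrable_character square_integrable_cmult)
  then show "mult_op l \<in> B_L2R"
    by (simp add: B_L2R_def)
  have "transl_fun m (cscale_L2R c f) = cscale_L2R c (transl_fun m f)" for c f
    by transfer (auto simp: L2_eq_def intro!: square_integrable_translate square_integrable_cmult)
  then show "transl_op m \<in> B_L2R"
    by (simp add: B_L2R_def)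
  have "dil_fun t (cscale_L2R c f) = cscale_L2R c (dil_fun t f)" for c f
    by transfer (auto simp: L2_eq_def mult.left_commute simp del: of_real_exp
        intro!: square_integrable_dilate square_integrable_dilate[where c=1, simplified]
          square_integrable_cmult)
  then show "dil_op t \<in> B_L2R"
    by (simp add: B_L2R_def)
qed

lemma A_ph_subset_B_L2R: "A_ph \<subseteq> B_L2R"
  unfolding A_ph_def generated_algebra_def
  using closed_subalgebra_B_L2R generators_in_B_L2R by (intro Inter_lower) auto

end

theory Submission
  imports Defs
begin

text \<open>
  Write $W(l,m,t) = M_l D_m V_t$. Up to phases these unitaries multiply like the elements of a
  group with underlying set $\mathbb{R}^3$, and \<open>A_ph\<close> is the closed span of the $W(p)$ with $p$ in
  the positive octant $P$. Three inclusions tell the generators apart: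
  $D_m A \subseteq A D_m$, $A M_l \subseteq M_l A$ and $V_t A = A V_t$. The proof rests on the
  converse (\<open>right_normal_classification\<close>, \<open>left_normal_classification\<close>): an element $U$ of $A$ such
  that multiplication by $U$ is isometric and $UA \subseteq AU$ is a scalar multiple of some
  $D_m V_t$, and with $AU \subseteq UA$ it is a multiple of some $M_l V_t$. Both conditions on $U$
  pass through an isometric automorphism $\Phi$, so that $\Phi(M_l)$, $\Phi(D_m)$ and $\Phi(V_t)$ are
  multiples of single unitaries $M_k V_r$, $D_h V_u$ and $V_s$. The relation
  $V_t M_l = M_{e^t l} V_t$ with $e^t = 2$, compared with $M_{2l} = M_l M_l$, removes $r$ and the
  scalar, and likewise for $D_m$; the relation
  $M_l D_m = e^{ilm} D_m M_l$ then forces $k_1 k_2 = 1$.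

  An isometric isomorphism $\Psi$ of $A$ onto its adjoint algebra gives the conjugate-linear
  anti-multiplicative isometry $\Theta(X) = \Psi(X)^*$ of $A$. Being anti-multiplicative it exchanges
  the two classes, so that $\Theta(M_l) = D_{k_1 l}$ and $\Theta(D_m) = M_{k_2 m}$ with
  $k_1, k_2 \ge 0$. The commutation relation of $M_l$ and $D_m$ now gives $k_1 k_2 = -1$. This is the
  chirality.

  The classification is a computation with Fourier coefficients. On the closed span of all $W(g)$
  there is an inner product for which the $W(g)$ are orthonormal, obtained as the limit of
  $\langle X \psi_n, Y \psi_n \rangle$ along explicit unit vectors $\psi_n$; it is invariant under
  right multiplication by $W(g)$, and an operator all of whose coefficients vanish is $0$
  (\<open>weyl_alg_uniqueness\<close>, where amenability of the group enters through Foelner sets). If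
  $U W(q) = X U$ with $X \in A$, then the coefficients of $X$ live on $P$, which says that
  $W(p_1)^* U$ is orthogonal to $W(q) W(p_2)^* U W(q)^*$ as soon as $p_1 q p_2^{-1} \notin P$. With
  $q = V_n$ and $n \to \infty$ this kills every coefficient of $U$ with $l > 0$. Averaging over
  $q = M_s$ then shows that of two different coefficients one vanishes.
\<close>

type_synonym oper = "L2R \<Rightarrow>\<^sub>L L2R"

section \<open>The complex inner product and adjoints\<close>

lemma cinner_commute: "cinner_L2R f g = cnj (cinner_L2R g f)"
  by transfer (simp add: mult.commute flip: Bochner_Integration.integral_cnj)

lemma cinner_add_left: "cinner_L2R (f + g) h = cinner_L2R f h + cinner_L2R g h"
  by transfer (auto simp: L2_eq_def distrib_right square_integrable_product)

lemma cinner_add_right: "cinner_L2R h (f + g) = cinner_L2R h f + cinner_L2R h g"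
  by (simp add: cinner_commute[of h] cinner_add_left)

lemma cinner_cscale_left: "cinner_L2R (cscale_L2R c f) g = c * cinner_L2R f g"
  by transfer (simp add: mult.assoc)

lemma cinner_cscale_right: "cinner_L2R g (cscale_L2R c f) = cnj c * cinner_L2R g f"
  by (simp add: cinner_commute[of g] cinner_cscale_left)

lemma cscale_minus_one: "cscale_L2R (- 1) f = - f"
  by transfer (auto simp: L2_eq_def intro: square_integrable_uminus)

lemma cscale_one: "cscale_L2R 1 f = f"
  by transfer (auto simp: L2_eq_def)

lemma cscale_cscale: "cscale_L2R a (cscale_L2R b f) = cscale_L2R (a * b) f"
  by transfer (auto simp: L2_eq_def mult.assoc intro!: square_integrable_cmult)

lemma cscale_add_right: "cscale_L2R a (f + g) = cscale_L2R a f + cscale_L2R a g"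
  by (rule linear_add[OF bounded_linear.linear[OF bounded_linear_cscale_L2R]])

lemma cscale_of_real: "cscale_L2R (complex_of_real r) f = r *\<^sub>R f"
  by transfer (auto simp: L2_eq_def scaleR_conv_of_real intro!: square_integrable_cmult)

lemma cinner_minus_left: "cinner_L2R (- f) g = - cinner_L2R f g"
  using cinner_cscale_left[of "-1" f g] by (simp add: cscale_minus_one)

lemma cinner_minus_right: "cinner_L2R g (- f) = - cinner_L2R g f"
  using cinner_cscale_right[of g "-1" f] by (simp add: cscale_minus_one)

lemma cinner_diff_left: "cinner_L2R (f - g) h = cinner_L2R f h - cinner_L2R g h"
  using cinner_add_left[of f "- g" h] by (simp add: cinner_minus_left)

lemma cinner_diff_right: "cinner_L2R h (f - g) = cinner_L2R h f - cinner_L2R h g"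
  using cinner_add_right[of h f "- g"] by (simp add: cinner_minus_right)

lemma cinner_zero_left: "cinner_L2R 0 g = 0"
  using cinner_diff_left[of g g g] by simp

lemma Re_cinner: "Re (cinner_L2R f g) = inner f g"
  by (simp add: inner_L2R_def)

lemma cinner_self: "cinner_L2R f f = complex_of_real ((norm f)\<^sup>2)"
proof (rule complex_eqI)
  show "Re (cinner_L2R f f) = Re (complex_of_real ((norm f)\<^sup>2))"
    by (simp add: Re_cinner power2_norm_eq_inner)
  have "Im (cinner_L2R f f) = Im (cnj (cinner_L2R f f))"
    using cinner_commute[of f f] by simp
  then show "Im (cinner_L2R f f) = Im (complex_of_real ((norm f)\<^sup>2))"
    by simp
qed

lemma cinner_Cauchy_Schwarz: "cmod (cinner_L2R f g) \<le> norm f * norm g"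
proof (cases "cinner_L2R f g = 0")
  case False
  define z where "z = cinner_L2R f g"
  have z: "z \<noteq> 0" using False by (simp add: z_def)
  \<comment> \<open>A unimodular factor makes the inner product real and nonnegative, which reduces the claim to the real inequality.\<close>
  define c where "c = cnj z / complex_of_real (cmod z)"
  have c: "cmod c = 1" using z by (simp add: c_def norm_divide)
  have "c * z = complex_of_real (cmod z)"
    using z by (simp add: c_def complex_norm_square[symmetric] power2_eq_square mult.commute)
  then have "cmod z = Re (cinner_L2R (cscale_L2R c f) g)"
    by (simp add: cinner_cscale_left z_def)
  also have "\<dots> \<le> norm (cscale_L2R c f) * norm g"
    by (simp add: Re_cinner norm_cauchy_schwarz)
  finally show ?thesis
    by (simp add: norm_cscale_L2R c z_def)
qed simp

lemma is_adjoint_inner: "is_adjoint X Y \<Longrightarrow> inner (X f) g = inner f (Y g)"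
  by (simp add: is_adjoint_def inner_L2R_def)

lemma is_adjoint_sym: "is_adjoint X Y \<Longrightarrow> is_adjoint Y X"
  unfolding is_adjoint_def
proof (intro allI)
  fix f g
  assume *: "\<forall>f g. cinner_L2R (X f) g = cinner_L2R f (Y g)"
  have "cinner_L2R (Y f) g = cnj (cinner_L2R g (Y f))"
    by (rule cinner_commute)
  also have "\<dots> = cnj (cinner_L2R (X g) f)"
    using * by simp
  also have "\<dots> = cinner_L2R f (X g)"
    by (rule cinner_commute[symmetric])
  finally show "cinner_L2R (Y f) g = cinner_L2R f (X g)" .
qed

lemma is_adjoint_norm_le:
  assumes "is_adjoint X Y" shows "norm Y \<le> norm X"
proof (rule norm_blinfun_bound)
  fix f
  have "norm (Y f) * norm (Y f) = inner (X (Y f)) f"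
    unfolding is_adjoint_inner[OF assms] power2_norm_eq_inner[symmetric] power2_eq_square ..
  also have "\<dots> \<le> norm (X (Y f)) * norm f"
    by (rule norm_cauchy_schwarz)
  also have "\<dots> \<le> norm X * norm (Y f) * norm f"
    by (intro mult_right_mono norm_blinfun) auto
  finally have "norm (Y f) * norm (Y f) \<le>
      norm (Y f) * (norm X * norm f)" by (simp add: mult.commute mult.left_commute)
  then show "norm (Y f) \<le> norm X * norm f"
    by (cases "norm (Y f) = 0") (auto simp: mult_le_cancel_left)
qed simp

lemma is_adjoint_norm: "is_adjoint X Y \<Longrightarrow> norm Y = norm X"
  using is_adjoint_norm_le[of X Y] is_adjoint_norm_le[OF is_adjoint_sym, of X Y] by simp

lemma is_adjoint_add: "is_adjoint X X' \<Longrightarrow> is_adjoint Y Y' \<Longrightarrow> is_adjoint (X + Y) (X' + Y')"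
  by (simp add: is_adjoint_def blinfun.add_left cinner_add_left cinner_add_right)

lemma is_adjoint_cscale: "is_adjoint X X' \<Longrightarrow> is_adjoint (cscale_op c X) (cscale_op (cnj c) X')"
  by (simp add: is_adjoint_def cinner_cscale_left cinner_cscale_right)

lemma is_adjoint_compose: "is_adjoint X X' \<Longrightarrow> is_adjoint Y Y' \<Longrightarrow> is_adjoint (X o\<^sub>L Y) (Y' o\<^sub>L X')"
  by (simp add: is_adjoint_def)

lemma is_adjoint_unique:
  assumes "is_adjoint X Y" "is_adjoint X' Y" shows "X = X'"
proof (rule blinfun_eqI)
  fix f
  have "cinner_L2R (X f - X' f) g = 0" for g
    using assms by (simp add: cinner_diff_left is_adjoint_def)
  from this[of "X f - X' f"] show "X f = X' f"
    by (simp add: cinner_self)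
qed

lemma cscale_op_one [simp]: "cscale_op 1 X = X"
  by (rule blinfun_eqI) (simp add: cscale_one)

lemma cscale_op_cscale_op: "cscale_op a (cscale_op b X) = cscale_op (a * b) X"
  by (rule blinfun_eqI) (simp add: cscale_cscale)

lemma cscale_op_add: "cscale_op a (X + Y) = cscale_op a X + cscale_op a Y"
  by (rule blinfun_eqI) (simp add: cscale_add_right blinfun.add_left)

lemma cscale_op_of_real: "cscale_op (complex_of_real r) X = r *\<^sub>R X"
  by (rule blinfun_eqI) (simp add: cscale_of_real blinfun.scaleR_left)

lemma cscale_op_minus_one: "cscale_op (-1) X = - X"
  by (rule blinfun_eqI) (simp add: cscale_minus_one blinfun.minus_left)

lemma cscale_op_compose_left: "cscale_op a X o\<^sub>L Y = cscale_op a (X o\<^sub>L Y)"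
  by (rule blinfun_eqI) simp

lemma cscale_op_compose_right: "X \<in> B_L2R \<Longrightarrow> X o\<^sub>L cscale_op a Y = cscale_op a (X o\<^sub>L Y)"
  by (rule blinfun_eqI) (simp add: B_L2R_def)

lemma norm_cscale_op: "norm (cscale_op a X) = cmod a * norm X"
proof (cases "a = 0")
  case True
  have "cscale_op 0 X = 0" using cscale_op_of_real[of 0 X] by simp
  then show ?thesis using True by simp
next
  case False
  have le: "norm (cscale_op b Y) \<le> cmod b * norm Y" for b Y
    by (rule norm_blinfun_bound) (auto simp: norm_cscale_L2R mult.assoc intro: mult_left_mono norm_blinfun)
  have "cmod a * norm X = cmod a * norm (cscale_op (inverse a) (cscale_op a X))"
    using False by (simp add: cscale_op_cscale_op)
  also have "\<dots> \<le> cmod a * (cmod (inverse a) * norm (cscale_op a X))"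
    by (intro mult_left_mono le) simp
  also have "\<dots> = norm (cscale_op a X)" using False by (simp add: norm_inverse)
  finally show ?thesis using le[of a X] by simp
qed

section \<open>The unitaries $M_l D_m V_t$ and their group\<close>

lemma L2_eqI: "square_integrable f \<Longrightarrow> f = g \<Longrightarrow> L2_eq f g"
  by (simp add: L2_eq_def)

lemma mult_fun_mult_fun: "mult_fun l (mult_fun l' f) = mult_fun (l + l') f"
proof transfer
  fix l l' :: real and f assume "L2_eq f f"
  then have "square_integrable f" by (simp add: L2_eq_def)
  then show "L2_eq (\<lambda>x. exp (\<i> * complex_of_real (l * x)) * (exp (\<i> * complex_of_real (l' * x)) * f x))
      (\<lambda>x. exp (\<i> * complex_of_real ((l + l') * x)) * f x)"
    by (intro L2_eqI square_integrable_character) (simp_all add: algebra_simps exp_add)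
qed

lemma transl_fun_transl_fun: "transl_fun m (transl_fun m' f) = transl_fun (m + m') f"
proof transfer
  fix m m' :: real and f assume "L2_eq f f"
  then have "square_integrable (\<lambda>x. f (x - m'))"
    by (simp add: L2_eq_def square_integrable_translate)
  from square_integrable_translate[OF this, of m]
  show "L2_eq (\<lambda>x. f (x - m - m')) (\<lambda>x. f (x - (m + m')))"
    by (intro L2_eqI) (simp_all add: algebra_simps)
qed

lemma dil_fun_dil_fun: "dil_fun t (dil_fun t' f) = dil_fun (t + t') f"
proof transfer
  fix t t' :: real and f assume "L2_eq f f"
  then have "square_integrable (\<lambda>x. complex_of_real (exp (t' / 2)) * f (exp t' * x))"
    by (intro square_integrable_dilate) (simp add: L2_eq_def)
  from square_integrable_dilate[OF this, of "complex_of_real (exp (t / 2))" t]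
  show "L2_eq (\<lambda>x. complex_of_real (exp (t / 2)) * (complex_of_real (exp (t' / 2)) * f (exp t' * (exp t * x))))
      (\<lambda>x. complex_of_real (exp ((t + t') / 2)) * f (exp (t + t') * x))"
    by (intro L2_eqI) (simp_all add: exp_add add_divide_distrib mult_ac)
qed

lemma transl_fun_mult_fun:
  "transl_fun m (mult_fun l f) = cscale_L2R (cis (- (m * l))) (mult_fun l (transl_fun m f))"
proof transfer
  fix m l :: real and f assume "L2_eq f f"
  then have "square_integrable (\<lambda>x. exp (\<i> * complex_of_real (l * x)) * f x)"
    by (intro square_integrable_character) (simp add: L2_eq_def)
  from square_integrable_translate[OF this, of m]
  show "L2_eq (\<lambda>x. exp (\<i> * complex_of_real (l * (x - m))) * f (x - m))
     (\<lambda>x. cis (- (m * l)) * (exp (\<i> * complex_of_real (l * x)) * f (x - m)))"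
    by (intro L2_eqI) (simp_all add: cis_conv_exp algebra_simps flip: exp_add)
qed

lemma dil_fun_mult_fun: "dil_fun t (mult_fun l f) = mult_fun (exp t * l) (dil_fun t f)"
proof transfer
  fix t l :: real and f assume "L2_eq f f"
  then have "square_integrable (\<lambda>x. exp (\<i> * complex_of_real (l * x)) * f x)"
    by (intro square_integrable_character) (simp add: L2_eq_def)
  from square_integrable_dilate[OF this, of "complex_of_real (exp (t / 2))" t]
  show "L2_eq (\<lambda>x. complex_of_real (exp (t / 2)) *
            (exp (\<i> * complex_of_real (l * (exp t * x))) * f (exp t * x)))
     (\<lambda>x. exp (\<i> * complex_of_real (exp t * l * x)) *
            (complex_of_real (exp (t / 2)) * f (exp t * x)))"
    by (intro L2_eqI) (simp_all add: mult_ac)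
qed

lemma dil_fun_transl_fun: "dil_fun t (transl_fun m f) = transl_fun (exp (- t) * m) (dil_fun t f)"
proof transfer
  fix t m :: real and f assume "L2_eq f f"
  then have "square_integrable (\<lambda>x. f (x - m))"
    by (intro square_integrable_translate) (simp add: L2_eq_def)
  from square_integrable_dilate[OF this, of "complex_of_real (exp (t / 2))" t]
  show "L2_eq (\<lambda>x. complex_of_real (exp (t / 2)) * f (exp t * x - m))
          (\<lambda>x. complex_of_real (exp (t / 2)) * f (exp t * (x - exp (- t) * m)))"
    by (intro L2_eqI) (simp_all add: right_diff_distrib flip: mult.assoc exp_add)
qed

type_synonym grp = "real \<times> real \<times> real"

text \<open>
  The parameter $(l, m, t)$ stands for $M_l D_m V_t$; the operations \<open>gmul\<close>, \<open>ginv\<close> and the cocycle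
  \<open>phase\<close> record how these unitaries multiply.
\<close>

definition W :: "grp \<Rightarrow> oper" where
  "W = (\<lambda>(l, m, t). mult_op l o\<^sub>L transl_op m o\<^sub>L dil_op t)"

definition gmul :: "grp \<Rightarrow> grp \<Rightarrow> grp" where
  "gmul = (\<lambda>(l, m, t) (l', m', t'). (l + exp t * l', m + exp (- t) * m', t + t'))"

definition ginv :: "grp \<Rightarrow> grp" where
  "ginv = (\<lambda>(l, m, t). (- (exp (- t) * l), - (exp t * m), - t))"

definition phase :: "grp \<Rightarrow> grp \<Rightarrow> complex" where
  "phase = (\<lambda>(l, m, t) (l', m', t'). cis (- (m * (exp t * l'))))"

lemma W_apply: "(W (l, m, t)) f = mult_fun l (transl_fun m (dil_fun t f))"
  by (simp add: W_def)

lemma gmul_simp [simp]: "gmul (l, m, t) (l', m', t') = (l + exp t * l', m + exp (- t) * m', t + t')"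
  by (simp add: gmul_def)

lemma ginv_simp [simp]: "ginv (l, m, t) = (- (exp (- t) * l), - (exp t * m), - t)"
  by (simp add: ginv_def)

lemma phase_simp [simp]: "phase (l, m, t) (l', m', t') = cis (- (m * (exp t * l')))"
  by (simp add: phase_def)

lemma cmod_phase [simp]: "cmod (phase g h) = 1"
  by (cases g; cases h) simp

lemma gmul_assoc: "gmul (gmul g h) k = gmul g (gmul h k)"
  by (cases g; cases h; cases k) (simp add: algebra_simps flip: exp_add)

lemma gmul_one [simp]: "gmul (0, 0, 0) g = g" "gmul g (0, 0, 0) = g"
  by (cases g; simp)+

lemma gmul_ginv [simp]: "gmul (ginv g) g = (0, 0, 0)" "gmul g (ginv g) = (0, 0, 0)"
  by (cases g; simp add: exp_minus)+

lemma gmul_left_cancel [simp]: "gmul g h = gmul g k \<longleftrightarrow> h = k"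
  by (metis gmul_assoc gmul_ginv(1) gmul_one(1))

lemma gmul_right_cancel [simp]: "gmul h g = gmul k g \<longleftrightarrow> h = k"
  by (metis gmul_assoc gmul_ginv(2) gmul_one(2))

lemma W_in_B [simp]: "W g \<in> B_L2R"
proof (cases g)
  case (fields l m t)
  have "mult_op l o\<^sub>L transl_op m o\<^sub>L dil_op t \<in> B_L2R"
    using closed_subalgebra_B_L2R generators_in_B_L2R by (simp add: closed_subalgebra_def)
  then show ?thesis by (simp add: fields W_def)
qed

lemma cscale_mult_fun: "mult_fun l (cscale_L2R c f) = cscale_L2R c (mult_fun l f)"
  using generators_in_B_L2R(1)[of l] by (simp add: B_L2R_def)

lemma W_compose: "W g o\<^sub>L W h = cscale_op (phase g h) (W (gmul g h))"
proof (cases g; cases h)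
  fix l m t l' m' t' assume g: "g = (l, m, t)" and h: "h = (l', m', t')"
  show ?thesis
  proof (rule blinfun_eqI)
    fix f
    have "(W g o\<^sub>L W h) f
        = mult_fun l (transl_fun m (dil_fun t (mult_fun l' (transl_fun m' (dil_fun t' f)))))"
      by (simp add: g h W_apply)
    also have "\<dots> = cscale_L2R (phase g h) ((W (gmul g h)) f)"
      by (simp add: g h W_apply dil_fun_mult_fun dil_fun_transl_fun dil_fun_dil_fun
          transl_fun_mult_fun transl_fun_transl_fun cscale_mult_fun mult_fun_mult_fun)
    finally show "(W g o\<^sub>L W h) f = (cscale_op (phase g h) (W (gmul g h))) f"
      by simp
  qed
qed

lemma mult_fun_0: "mult_fun 0 f = f"
  by transfer (simp add: L2_eq_def)

lemma transl_fun_0: "transl_fun 0 f = f"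
  by transfer (simp add: L2_eq_def)

lemma dil_fun_0: "dil_fun 0 f = f"
  by transfer (simp add: L2_eq_def)

lemma W_one: "W (0, 0, 0) = id_blinfun"
  by (rule blinfun_eqI) (simp add: W_apply mult_fun_0 transl_fun_0 dil_fun_0)

lemma mult_op_W: "mult_op l = W (l, 0, 0)"
  by (rule blinfun_eqI) (simp add: W_apply transl_fun_0 dil_fun_0)

lemma transl_op_W: "transl_op m = W (0, m, 0)"
  by (rule blinfun_eqI) (simp add: W_apply mult_fun_0 dil_fun_0)

lemma dil_op_W: "dil_op t = W (0, 0, t)"
  by (rule blinfun_eqI) (simp add: W_apply mult_fun_0 transl_fun_0)

lemma norm_W_apply [simp]: "norm (W g f) = norm f"
  by (cases g) (simp add: W_apply norm_mult_fun norm_transl_fun norm_dil_fun)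

text \<open>
  The inverse, which is also the adjoint, is kept inside the span of the $W(g)$ by correcting
  $W(g^{-1})$ with a phase.
\<close>

definition W_inv :: "grp \<Rightarrow> oper" where
  "W_inv g = cscale_op (cnj (phase g (ginv g))) (W (ginv g))"

lemma norm_W_inv_apply [simp]: "norm (W_inv g f) = norm f"
  by (simp add: W_inv_def norm_cscale_L2R)

lemma W_inv_in_B [simp]: "W_inv g \<in> B_L2R"
  using closed_subalgebra_B_L2R by (simp add: W_inv_def closed_subalgebra_def)

lemma cmod1_mult_cnj: "cmod z = 1 \<Longrightarrow> z * cnj z = 1"
  by (metis complex_norm_square of_real_1 power_one)

lemma phase_ginv: "phase (ginv g) g = phase g (ginv g)"
  by (cases g) (simp add: exp_minus mult_ac)

lemma W_W_inv [simp]: "W g o\<^sub>L W_inv g = id_blinfun"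
  by (simp add: W_inv_def cscale_op_compose_right W_compose cscale_op_cscale_op W_one
      cmod1_mult_cnj mult.commute[of "cnj _"])

lemma W_inv_W [simp]: "W_inv g o\<^sub>L W g = id_blinfun"
  by (simp add: W_inv_def cscale_op_compose_left W_compose cscale_op_cscale_op W_one phase_ginv
      cmod1_mult_cnj mult.commute[of "cnj _"])

lemma W_W_inv_apply [simp]: "(W g) (W_inv g f) = f"
  by (metis W_W_inv blinfun_apply_blinfun_compose blinfun_apply_id_blinfun)

lemma W_inv_W_apply [simp]: "(W_inv g) (W g f) = f"
  by (metis W_inv_W blinfun_apply_blinfun_compose blinfun_apply_id_blinfun)

lemma isometry_cinner:
  assumes X: "X \<in> B_L2R" and iso: "\<And>f. norm (X f) = norm f"
  shows "cinner_L2R (X f) (X g) = cinner_L2R f g"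
proof -
  have re: "inner (X f) (X g) = inner f g" for f g
    using iso[of "f + g"] iso[of f] iso[of g]
    by (simp add: norm_eq_sqrt_inner inner_add inner_commute blinfun.add_right)
  \<comment> \<open>Only complex linearity transfers the real polarization identity to the imaginary part.\<close>
  have im: "Im (cinner_L2R f g) = - inner (cscale_L2R \<i> f) g" for f g
    by (simp add: cinner_cscale_left flip: Re_cinner)
  have "X (cscale_L2R \<i> f) = cscale_L2R \<i> (X f)"
    using X by (simp add: B_L2R_def)
  then have "inner (cscale_L2R \<i> (X f)) (X g) = inner (cscale_L2R \<i> f) g"
    using re[of "cscale_L2R \<i> f" g] by simp
  then show ?thesis
    by (intro complex_eqI) (simp_all add: Re_cinner re im)
qed

lemma is_adjoint_W: "is_adjoint (W g) (W_inv g)"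
  unfolding is_adjoint_def
  using isometry_cinner[OF W_in_B norm_W_apply, of g _ "(W_inv g) _"] by simp

lemma is_adjoint_W_inv: "is_adjoint (W_inv g) (W g)"
  by (rule is_adjoint_sym[OF is_adjoint_W])

lemma norm_isometric_compose:
  fixes U X :: oper
  assumes "\<And>f. norm (U f) = norm f"
  shows "norm (U o\<^sub>L X) = norm X"
  by (simp add: norm_blinfun.rep_eq onorm_def assms)

lemma norm_compose_W [simp]:
  "norm (W g o\<^sub>L X) = norm X" "norm (W_inv g o\<^sub>L X) = norm X"
  "norm (X o\<^sub>L W g) = norm X" "norm (X o\<^sub>L W_inv g) = norm X"
proof -
  show "norm (W g o\<^sub>L X) = norm X" "norm (W_inv g o\<^sub>L X) = norm X"
    by (rule norm_isometric_compose, simp)+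
  have le: "norm (W g) \<le> 1" "norm (W_inv g) \<le> 1"
    by (auto intro: norm_blinfun_bound)
  have 1: "norm (X o\<^sub>L W g) \<le> norm X" "norm (X o\<^sub>L W_inv g) \<le> norm X" for X
    using norm_blinfun_compose[of X "W g"] norm_blinfun_compose[of X "W_inv g"]
      mult_left_mono[OF le(1), of "norm X"] mult_left_mono[OF le(2), of "norm X"] by auto
  have 2: "X o\<^sub>L W g o\<^sub>L W_inv g = X" "X o\<^sub>L W_inv g o\<^sub>L W g = X" for X :: oper
    by (rule blinfun_eqI, simp)+
  show "norm (X o\<^sub>L W g) = norm X" "norm (X o\<^sub>L W_inv g) = norm X"
    using 1(1)[of X] 1(2)[of "X o\<^sub>L W g"] 1(2)[of X] 1(1)[of "X o\<^sub>L W_inv g"] by (auto simp: 2)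
qed

section \<open>Asymptotically tracial vectors\<close>

lemma norm_integral_cis_le:
  assumes c: "c \<noteq> 0"
  shows "cmod (LINT x|lborel. indicator {a..b} x *\<^sub>R cis (c * x + d)) \<le> 2 / \<bar>c\<bar>"
proof (cases "a \<le> b")
  case True
  define F where "F x = cis (c * x + d) / (\<i> * complex_of_real c)" for x
  have "(LINT x|lborel. indicator {a..b} x *\<^sub>R cis (c * x + d)) = F b - F a"
  proof (rule integral_FTC_atLeastAtMost[OF True])
    show "(F has_vector_derivative cis (c * x + d)) (at x within {a..b})" for x
    proof -
      have "((\<lambda>z. exp (\<i> * (complex_of_real c * z + complex_of_real d)) / (\<i> * complex_of_real c))
          has_field_derivative cis (c * x + d)) (at (complex_of_real x))"
        using c by (auto intro!: derivative_eq_intros simp: cis_conv_exp mult.left_commute[of \<i>] simp flip: mult.assoc)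
      from has_vector_derivative_real_field[OF this, of "{a..b}"] show ?thesis
        by (simp add: F_def[abs_def] cis_conv_exp)
    qed
    show "continuous_on {a..b} (\<lambda>x. cis (c * x + d))"
      unfolding cis_conv_exp by (intro continuous_intros)
  qed
  also have "cmod (F b - F a) \<le> cmod (F b) + cmod (F a)"
    by (rule norm_triangle_ineq4)
  also have "\<dots> = 2 / \<bar>c\<bar>"
    by (simp add: F_def norm_divide norm_mult)
  finally show ?thesis .
qed simp

text \<open>
  The $n$-th vector is the chirp $e^{inx^2}$ cut off to $[n^2, n^2 + n]$. A translation or a
  modulation multiplies the chirp by a character whose frequency stays away from $0$, and a dilation
  moves the window $[n^2, n^2 + n]$ off itself. Either way the overlap with the original vector tends
  to $0$.
\<close>

lift_definition chirp :: "nat \<Rightarrow> L2R" is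
  "\<lambda>n x. indicator {real n ^ 2..real n ^ 2 + real n} x *\<^sub>R
     (complex_of_real (1 / sqrt (real n)) * cis (real n * x\<^sup>2))"
proof -
  fix n :: nat
  let ?f = "\<lambda>x. indicator {real n ^ 2..real n ^ 2 + real n} x *\<^sub>R
     (complex_of_real (1 / sqrt (real n)) * cis (real n * x\<^sup>2))"
  have "square_integrable ?f"
  proof (rule square_integrable_dominated)
    have [measurable]: "(\<lambda>x. cis (real n * x\<^sup>2)) \<in> borel_measurable borel"
      unfolding cis_conv_exp by (intro borel_measurable_continuous_onI continuous_intros)
    show "?f \<in> borel_measurable borel"
      by measurable
    show "integrable lborel (\<lambda>x. indicator {real n ^ 2..real n ^ 2 + real n} x * (1 / real n))"
      by simp
    show "(cmod (?f x))\<^sup>2 \<le> indicator {real n ^ 2..real n ^ 2 + real n} x * (1 / real n)" for x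
      by (auto simp: indicator_def norm_mult norm_divide power_divide)
  qed
  then show "L2_eq ?f ?f"
    by (rule L2_eqI) simp
qed

lemma norm_chirp:
  assumes "n > 0"
  shows "norm (chirp n) = 1"
  using assms
proof transfer
  fix n :: nat assume n: "n > 0"
  have "(LINT x|lborel. (cmod (indicator {(real n)\<^sup>2..(real n)\<^sup>2 + real n} x *\<^sub>R
      (complex_of_real (1 / sqrt (real n)) * cis (real n * x\<^sup>2))))\<^sup>2)
     = (LINT x|lborel. indicator {(real n)\<^sup>2..(real n)\<^sup>2 + real n} x *\<^sub>R (1 / real n))"
    by (intro Bochner_Integration.integral_cong)
      (auto simp: indicator_def norm_mult norm_divide power_divide)
  also have "\<dots> = 1" using n by simp
  finally show "sqrt (LINT x|lborel. (cmod (indicator {(real n)\<^sup>2..(real n)\<^sup>2 + real n} x *\<^sub>R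
      (complex_of_real (1 / sqrt (real n)) * cis (real n * x\<^sup>2))))\<^sup>2) = 1" by simp
qed

lemma cinner_W_chirp:
  "cinner_L2R ((W (l, m, t)) (chirp n)) (chirp n) =
    (LINT x|lborel. exp (\<i> * complex_of_real (l * x)) *
      (complex_of_real (exp (t / 2)) *
        (indicator {(real n)\<^sup>2..(real n)\<^sup>2 + real n} (exp t * (x - m)) *\<^sub>R
          (complex_of_real (1 / sqrt (real n)) * cis (real n * (exp t * (x - m))\<^sup>2)))) *
      cnj (indicator {(real n)\<^sup>2..(real n)\<^sup>2 + real n} x *\<^sub>R
          (complex_of_real (1 / sqrt (real n)) * cis (real n * x\<^sup>2))))"
  unfolding W_apply by transfer simp

lemma eventually_dilation_disjoint:
  fixes t m :: real
  assumes "t \<noteq> 0"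
  shows "eventually (\<lambda>n. \<forall>x. x \<in> {(real n)\<^sup>2..(real n)\<^sup>2 + real n} \<longrightarrow>
    exp t * (x - m) \<notin> {(real n)\<^sup>2..(real n)\<^sup>2 + real n}) sequentially"
proof -
  define c where "c = exp t"
  \<comment> \<open>The window has left end $n^2$ and length $n$, so the factor $c \<noteq> 1$ moves it by the order $n^2$, more than its length and the shift by $m$.\<close>
  define K where "K = (2 + c * \<bar>m\<bar>) / \<bar>c - 1\<bar>"
  have c: "c > 0" "c \<noteq> 1" using assms by (auto simp: c_def)
  have "eventually (\<lambda>n. K \<le> real n) sequentially"
    using filterlim_real_sequentially by (simp add: filterlim_at_top)
  then show ?thesis
    using eventually_gt_at_top[of 1]
  proof eventually_elim
    fix n :: nat assume K: "K \<le> real n" and "1 < n"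
    then have n: "real n \<ge> 1" by simp
    have "2 + c * \<bar>m\<bar> \<le> \<bar>c - 1\<bar> * real n"
      using K c by (simp add: K_def field_simps)
    then have "(2 + c * \<bar>m\<bar>) * real n \<le> \<bar>c - 1\<bar> * real n * real n"
      by (intro mult_right_mono) auto
    moreover have "c * \<bar>m\<bar> * 1 \<le> c * \<bar>m\<bar> * real n"
      using n c mult_left_mono[OF n, of "c * \<bar>m\<bar>"] by simp_all
    moreover have "c * m \<le> c * \<bar>m\<bar>" "c * (- m) \<le> c * \<bar>m\<bar>"
      using c by (intro mult_left_mono; simp)+
    ultimately have *: "2 * real n + c * \<bar>m\<bar> \<le> \<bar>c - 1\<bar> * (real n)\<^sup>2"
      by (simp add: power2_eq_square algebra_simps)
    show "\<forall>x. x \<in> {(real n)\<^sup>2..(real n)\<^sup>2 + real n} \<longrightarrow>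
        exp t * (x - m) \<notin> {(real n)\<^sup>2..(real n)\<^sup>2 + real n}"
    proof (cases "c > 1")
      case True
      have "(real n)\<^sup>2 + real n < c * (x - m)" if "(real n)\<^sup>2 \<le> x" for x
      proof -
        have "c * (real n)\<^sup>2 \<le> c * x" using that c by simp
        moreover have "\<bar>c - 1\<bar> * (real n)\<^sup>2 = c * (real n)\<^sup>2 - (real n)\<^sup>2" "c * (x - m) = c * x - c * m"
          using True by (simp_all add: algebra_simps)
        ultimately show ?thesis using * n \<open>c * m \<le> c * \<bar>m\<bar>\<close> by linarith
      qed
      then show ?thesis by (fastforce simp: c_def)
    next
      case False
      have "c * (x - m) < (real n)\<^sup>2" if "x \<le> (real n)\<^sup>2 + real n" for x
      proof -
        have "c * x \<le> c * ((real n)\<^sup>2 + real n)" using that c by simp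
        moreover have "c * real n \<le> 1 * real n" using False by (intro mult_right_mono) auto
        moreover have "c * (x - m) = c * x + c * (- m)"
          "c * ((real n)\<^sup>2 + real n) = c * (real n)\<^sup>2 + c * real n"
          by (simp_all add: algebra_simps)
        moreover have "2 * real n + c * \<bar>m\<bar> \<le> (real n)\<^sup>2 - c * (real n)\<^sup>2"
        proof -
          have "\<bar>c - 1\<bar> * (real n)\<^sup>2 = (real n)\<^sup>2 - c * (real n)\<^sup>2"
            using False by (simp add: algebra_simps)
          then show ?thesis using * by simp
        qed
        ultimately show ?thesis
          using n \<open>c * (- m) \<le> c * \<bar>m\<bar>\<close> by linarith
      qed
      then show ?thesis by (fastforce simp: c_def)
    qed
  qed
qed

text \<open>
  The quadratic phases of the chirp and of its translate cancel, leaving the integral of a character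
  of frequency $l - 2nm$ over an interval.
\<close>

lemma cinner_W_chirp_le:
  assumes n: "n > 0" and c: "l - 2 * real n * m \<noteq> 0"
  shows "cmod (cinner_L2R ((W (l, m, 0)) (chirp n)) (chirp n))
     \<le> (1 / real n) * (2 / \<bar>l - 2 * real n * m\<bar>)"
proof -
  define N where "N = (real n)\<^sup>2"
  have sq: "complex_of_real (sqrt (real n)) * complex_of_real (sqrt (real n)) = of_nat n"
    by (metis abs_of_nat of_real_mult of_real_of_nat_eq real_sqrt_mult_self)
  have "cinner_L2R ((W (l, m, 0)) (chirp n)) (chirp n) =
     (LINT x|lborel. complex_of_real (1 / real n) *
       (indicator {max N (N + m)..min (N + real n) (N + real n + m)} x *\<^sub>R
         cis ((l - 2 * real n * m) * x + real n * m\<^sup>2)))"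
    unfolding cinner_W_chirp
  proof (intro Bochner_Integration.integral_cong refl)
    fix x
    have *: "exp (\<i> * complex_of_real (l * x)) * cis (real n * (x - m)\<^sup>2) * cnj (cis (real n * x\<^sup>2))
        = cis ((l - 2 * real n * m) * x + real n * m\<^sup>2)"
      by (simp add: cis_cnj cis_mult flip: cis_conv_exp of_real_mult)
        (simp add: power2_eq_square algebra_simps)
    have **: "exp (\<i> * complex_of_real (l * x)) *
        (complex_of_real (1 / sqrt (real n)) * cis (real n * (x - m)\<^sup>2)) *
        cnj (complex_of_real (1 / sqrt (real n)) * cis (real n * x\<^sup>2)) =
        complex_of_real (1 / real n) * cis ((l - 2 * real n * m) * x + real n * m\<^sup>2)"
      unfolding *[symmetric] by (simp add: sq mult_ac)
    show "exp (\<i> * complex_of_real (l * x)) *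
      (complex_of_real (exp (0 / 2)) *
        (indicator {(real n)\<^sup>2..(real n)\<^sup>2 + real n} (exp 0 * (x - m)) *\<^sub>R
          (complex_of_real (1 / sqrt (real n)) * cis (real n * (exp 0 * (x - m))\<^sup>2)))) *
      cnj (indicator {(real n)\<^sup>2..(real n)\<^sup>2 + real n} x *\<^sub>R
          (complex_of_real (1 / sqrt (real n)) * cis (real n * x\<^sup>2))) =
      complex_of_real (1 / real n) *
       (indicator {max N (N + m)..min (N + real n) (N + real n + m)} x *\<^sub>R
         cis ((l - 2 * real n * m) * x + real n * m\<^sup>2))"
      using ** by (auto simp: indicator_def N_def)
  qed
  also have "cmod \<dots> \<le> (1 / real n) * (2 / \<bar>l - 2 * real n * m\<bar>)"
    unfolding Bochner_Integration.integral_mult_right_zero norm_mult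
    using norm_integral_cis_le[OF c] by (intro mult_mono) (auto simp: norm_divide)
  finally show ?thesis .
qed

lemma cinner_W_chirp_tendsto:
  assumes "g \<noteq> (0, 0, 0)"
  shows "(\<lambda>n. cinner_L2R (W g (chirp n)) (chirp n)) \<longlonglongrightarrow> 0"
proof -
  obtain l m t where g: "g = (l, m, t)" by (cases g)
  show ?thesis
  proof (cases "t = 0")
    case False
    have "eventually (\<lambda>n. cinner_L2R (W g (chirp n)) (chirp n) = 0) sequentially"
      using eventually_dilation_disjoint[OF False, of m]
    proof eventually_elim
      case (elim n)
      show ?case
        unfolding g cinner_W_chirp
        by (rule integral_eq_zero_AE, rule AE_I2) (use elim in \<open>auto simp: indicator_def\<close>)
    qed
    then show ?thesis by (rule tendsto_eventually)
  next
    case True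
    have lm: "l \<noteq> 0 \<or> m \<noteq> 0" using assms True g by auto
    define K where "K = (if m = 0 then \<bar>l\<bar> else 1)"
    have K: "K > 0" using lm by (auto simp: K_def)
    have ev: "eventually (\<lambda>n. K \<le> \<bar>l - 2 * real n * m\<bar>) sequentially"
    proof (cases "m = 0")
      case False
      have "eventually (\<lambda>n. (1 + \<bar>l\<bar>) / (2 * \<bar>m\<bar>) \<le> real n) sequentially"
        using filterlim_real_sequentially by (simp add: filterlim_at_top)
      then show ?thesis
      proof eventually_elim
        case (elim n)
        then have "1 + \<bar>l\<bar> \<le> \<bar>2 * real n * m\<bar>"
          using False by (simp add: field_simps abs_mult)
        then show ?case using False by (simp add: K_def)
      qed
    qed (simp add: K_def)
    have "eventually (\<lambda>n. cmod (cinner_L2R (W g (chirp n)) (chirp n)) \<le> (2 / K) * (1 / real n)) sequentially"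
      using ev eventually_gt_at_top[of 0]
    proof eventually_elim
      case (elim n)
      have "cmod (cinner_L2R (W g (chirp n)) (chirp n))
          \<le> (1 / real n) * (2 / \<bar>l - 2 * real n * m\<bar>)"
        unfolding g True using elim K by (intro cinner_W_chirp_le) auto
      also have "\<dots> \<le> (1 / real n) * (2 / K)"
        using elim K by (intro mult_left_mono divide_left_mono) auto
      finally show ?case by (simp add: mult.commute)
    qed
    moreover have "(\<lambda>n. (2 / K) * (1 / real n)) \<longlonglongrightarrow> 0"
      using tendsto_mult_right_zero[OF lim_1_over_n, of "2 / K"] by simp
    ultimately show ?thesis
      by (rule Lim_null_comparison)
  qed
qed

section \<open>The closed span of the unitaries and its trace inner product\<close>

text \<open>
  Finite linear combinations are generated inductively, so that statements about them are proved by
  rule induction instead of by manipulating finite sums.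
\<close>

inductive_set weyl_span :: "grp set \<Rightarrow> oper set" for Q where
  W: "g \<in> Q \<Longrightarrow> W g \<in> weyl_span Q"
| add: "X \<in> weyl_span Q \<Longrightarrow> Y \<in> weyl_span Q \<Longrightarrow> X + Y \<in> weyl_span Q"
| cscale: "X \<in> weyl_span Q \<Longrightarrow> cscale_op c X \<in> weyl_span Q"

lemma weyl_span_mono: "Q \<subseteq> R \<Longrightarrow> weyl_span Q \<subseteq> weyl_span R"
proof
  fix X assume "X \<in> weyl_span Q" and "Q \<subseteq> R"
  then show "X \<in> weyl_span R"
    by induction (auto intro: weyl_span.intros)
qed

lemma weyl_span_B: "X \<in> weyl_span Q \<Longrightarrow> X \<in> B_L2R"
proof (induction rule: weyl_span.induct)
  case (add X Y) then show ?case using closed_subalgebra_B_L2R by (simp add: closed_subalgebra_def)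
next
  case (cscale X c) then show ?case using closed_subalgebra_B_L2R by (simp add: closed_subalgebra_def)
qed simp

lemmas compose_add_left = bounded_bilinear.add_left[OF bounded_bilinear_blinfun_compose]
  and compose_add_right = bounded_bilinear.add_right[OF bounded_bilinear_blinfun_compose]
  and compose_diff_left = bounded_bilinear.diff_left[OF bounded_bilinear_blinfun_compose]
  and compose_diff_right = bounded_bilinear.diff_right[OF bounded_bilinear_blinfun_compose]

lemma weyl_span_compose:
  assumes "\<And>g h. g \<in> Q \<Longrightarrow> h \<in> Q \<Longrightarrow> gmul g h \<in> Q"
    and X: "X \<in> weyl_span Q" and Y: "Y \<in> weyl_span Q"
  shows "X o\<^sub>L Y \<in> weyl_span Q"
  using X
proof (induction)
  case (W g)
  show ?case using Y
  proof induction
    case (W h)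
    then show ?case using \<open>g \<in> Q\<close> assms(1) by (simp add: W_compose weyl_span.intros)
  next
    case (add X Y)
    then show ?case by (simp add: compose_add_right weyl_span.intros)
  next
    case (cscale X c)
    then show ?case by (simp add: cscale_op_compose_right weyl_span.intros)
  qed
next
  case (add X Y)
  then show ?case by (simp add: compose_add_left weyl_span.intros)
next
  case (cscale X c)
  then show ?case by (simp add: cscale_op_compose_left weyl_span.intros)
qed

lemma W_inv_span: "ginv g \<in> Q \<Longrightarrow> W_inv g \<in> weyl_span Q"
  by (simp add: W_inv_def weyl_span.intros)

lemma bounded_linear_cscale_op: "bounded_linear (cscale_op c)"
proof (rule bounded_linear_intro)
  fix X Y :: oper and r :: real
  show "cscale_op c (X + Y) = cscale_op c X + cscale_op c Y" by (rule cscale_op_add)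
  show "cscale_op c (r *\<^sub>R X) = r *\<^sub>R cscale_op c X"
    by (simp add: cscale_op_cscale_op mult.commute flip: cscale_op_of_real)
  show "norm (cscale_op c X) \<le> norm X * cmod c" by (simp add: norm_cscale_op)
qed

lemma closure_closed_under:
  assumes f: "\<And>X. X \<in> S \<Longrightarrow> f X \<in> S" "continuous_on UNIV f" and X: "X \<in> closure S"
  shows "f X \<in> closure S"
  using image_closure_subset[of S f "closure S"] assms closure_subset[of S]
  by (auto intro: continuous_on_subset)

lemma closure_closed_under2:
  assumes f: "\<And>X Y. X \<in> S \<Longrightarrow> Y \<in> S \<Longrightarrow> f X Y \<in> S"
    and c1: "\<And>X. continuous_on UNIV (f X)" and c2: "\<And>Y. continuous_on UNIV (\<lambda>X. f X Y)"
    and X: "X \<in> closure S" and Y: "Y \<in> closure S"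
  shows "f X Y \<in> closure S"
proof -
  have *: "f X Y \<in> closure S" if "X \<in> S" for X
    using image_closure_subset[of S "f X" "closure S"] f[OF that] c1[of X] Y closure_subset[of S]
    by (auto intro: continuous_on_subset)
  show ?thesis
    using image_closure_subset[of S "\<lambda>X. f X Y" "closure S"] * c2[of Y] X
    by (auto intro: continuous_on_subset)
qed

lemma closed_subalgebra_closure_weyl_span:
  assumes ne: "Q \<noteq> {}" and Q: "\<And>g h. g \<in> Q \<Longrightarrow> h \<in> Q \<Longrightarrow> gmul g h \<in> Q"
  shows "closed_subalgebra (closure (weyl_span Q))"
  unfolding closed_subalgebra_def
proof (intro conjI ballI allI)
  show "closure (weyl_span Q) \<subseteq> B_L2R"
    using closed_subalgebra_B_L2R weyl_span_B by (intro closure_minimal) (auto simp: closed_subalgebra_def)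
  obtain g where "g \<in> Q" using ne by auto
  then have "cscale_op 0 (W g) \<in> weyl_span Q" by (intro weyl_span.intros)
  then show "0 \<in> closure (weyl_span Q)"
    using cscale_op_of_real[of 0 "W g"] closure_subset by force
  show "X + Y \<in> closure (weyl_span Q)" if "X \<in> closure (weyl_span Q)" "Y \<in> closure (weyl_span Q)" for X Y
    by (rule closure_closed_under2[of _ "(+)", OF _ _ _ that])
      (auto intro: weyl_span.intros continuous_intros)
  show "cscale_op c X \<in> closure (weyl_span Q)" if "X \<in> closure (weyl_span Q)" for c X
    by (rule closure_closed_under[OF _ _ that])
      (auto intro: weyl_span.intros linear_continuous_on bounded_linear_cscale_op)
  show "X o\<^sub>L Y \<in> closure (weyl_span Q)" if "X \<in> closure (weyl_span Q)" "Y \<in> closure (weyl_span Q)" for X Y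
    by (rule closure_closed_under2[of _ "(o\<^sub>L)", OF _ _ _ that])
      (auto intro: weyl_span_compose[OF Q] continuous_intros)
qed simp

definition weyl_alg :: "oper set" where
  "weyl_alg = closure (weyl_span UNIV)"

lemma closed_subalgebra_weyl_alg: "closed_subalgebra weyl_alg"
  unfolding weyl_alg_def by (rule closed_subalgebra_closure_weyl_span) auto

lemma weyl_span_subset: "weyl_span Q \<subseteq> weyl_alg"
  using weyl_span_mono[of Q UNIV] closure_subset by (auto simp: weyl_alg_def)

lemma weyl_alg_add [simp]: "X \<in> weyl_alg \<Longrightarrow> Y \<in> weyl_alg \<Longrightarrow> X + Y \<in> weyl_alg"
  and weyl_alg_cscale [simp]: "X \<in> weyl_alg \<Longrightarrow> cscale_op c X \<in> weyl_alg"
  and weyl_alg_compose [simp]: "X \<in> weyl_alg \<Longrightarrow> Y \<in> weyl_alg \<Longrightarrow> X o\<^sub>L Y \<in> weyl_alg"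
  and weyl_alg_B: "X \<in> weyl_alg \<Longrightarrow> X \<in> B_L2R"
  using closed_subalgebra_weyl_alg by (auto simp: closed_subalgebra_def)

lemma weyl_alg_W [simp]: "W g \<in> weyl_alg"
  using weyl_span_subset[of UNIV] by (auto intro: weyl_span.intros)

lemma weyl_alg_W_inv [simp]: "W_inv g \<in> weyl_alg"
  by (simp add: W_inv_def)

lemma weyl_alg_diff [simp]: "X \<in> weyl_alg \<Longrightarrow> Y \<in> weyl_alg \<Longrightarrow> X - Y \<in> weyl_alg"
  using weyl_alg_add[of X "cscale_op (-1) Y"] weyl_alg_cscale[of Y "-1"] by (simp add: cscale_op_minus_one)

lemma weyl_alg_id [simp]: "id_blinfun \<in> weyl_alg"
  using weyl_alg_W[of "(0, 0, 0)"] by (simp add: W_one)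

lemma weyl_alg_approx:
  assumes "X \<in> weyl_alg" "e > 0"
  obtains Y where "Y \<in> weyl_span UNIV" "norm (X - Y) < e"
  using assms by (auto simp: weyl_alg_def closure_approachable dist_norm norm_minus_commute)

text \<open>
  A property of all of \<open>weyl_alg\<close> only has to be checked on the unitaries, provided that it is linear
  and survives norm approximation.
\<close>

lemma weyl_alg_induct [consumes 1, case_names W add cscale approx]:
  assumes X: "X \<in> weyl_alg" and W: "\<And>g. P (W g)"
    and add: "\<And>X Y. X \<in> weyl_alg \<Longrightarrow> Y \<in> weyl_alg \<Longrightarrow> P X \<Longrightarrow> P Y \<Longrightarrow> P (X + Y)"
    and cscale: "\<And>c X. X \<in> weyl_alg \<Longrightarrow> P X \<Longrightarrow> P (cscale_op c X)"
    and approx: "\<And>X. X \<in> weyl_alg \<Longrightarrow> (\<And>e. e > 0 \<Longrightarrow> \<exists>Y\<in>weyl_alg. P Y \<and> norm (X - Y) < e) \<Longrightarrow> P X"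
  shows "P X"
proof (rule approx[OF X])
  fix e :: real assume "e > 0"
  then obtain Y where Y: "Y \<in> weyl_span UNIV" and e: "norm (X - Y) < e"
    using weyl_alg_approx[OF X] by blast
  have "Y \<in> weyl_alg" using Y weyl_span_subset by auto
  have "P Y" using Y
    by (induction) (use W add cscale weyl_span_subset in blast)+
  then show "\<exists>Y\<in>weyl_alg. P Y \<and> norm (X - Y) < e"
    using e \<open>Y \<in> weyl_alg\<close> by blast
qed

lemma tendsto_approx:
  fixes a :: "nat \<Rightarrow> 'a :: real_normed_vector"
  assumes "\<And>e. e > 0 \<Longrightarrow> \<exists>b L'. b \<longlonglongrightarrow> L' \<and> (\<forall>n. norm (a n - b n) \<le> e) \<and> norm (L - L') \<le> e"
  shows "a \<longlonglongrightarrow> L"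
proof (rule LIMSEQ_I)
  fix r :: real assume "r > 0"
  with assms[of "r / 4"] obtain b L' where b: "b \<longlonglongrightarrow> L'" "\<And>n. norm (a n - b n) \<le> r / 4" "norm (L - L') \<le> r / 4"
    by auto
  from LIMSEQ_D[OF b(1), of "r / 4"] \<open>r > 0\<close> obtain N where N: "\<And>n. n \<ge> N \<Longrightarrow> norm (b n - L') < r / 4" by auto
  have "norm (a n - L) < r" if "n \<ge> N" for n
  proof -
    have "a n - L = (a n - b n) + (b n - L') - (L - L')" by simp
    then have "norm (a n - L) \<le> norm (a n - b n) + norm (b n - L') + norm (L - L')"
      using norm_triangle_ineq4[of "(a n - b n) + (b n - L')" "L - L'"]
        norm_triangle_ineq[of "a n - b n" "b n - L'"] by simp
    then show ?thesis using N[OF that] b(2)[of n] b(3) \<open>r > 0\<close> by linarith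
  qed
  then show "\<exists>no. \<forall>n\<ge>no. norm (a n - L) < r" by blast
qed

lemma convergent_approx:
  fixes a :: "nat \<Rightarrow> 'a :: banach"
  assumes "\<And>e. e > 0 \<Longrightarrow> \<exists>b. convergent b \<and> (\<forall>n. norm (a n - b n) \<le> e)"
  shows "convergent a"
proof (rule Cauchy_convergent, rule CauchyI)
  fix r :: real assume "r > 0"
  with assms[of "r / 4"] obtain b where b: "convergent b" "\<And>n. norm (a n - b n) \<le> r / 4" by auto
  from CauchyD[OF convergent_Cauchy[OF b(1)], of "r / 4"] \<open>r > 0\<close>
  obtain N where N: "\<And>m n. m \<ge> N \<Longrightarrow> n \<ge> N \<Longrightarrow> norm (b m - b n) < r / 4" by auto
  have "norm (a m - a n) < r" if "m \<ge> N" "n \<ge> N" for m n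
  proof -
    have "a m - a n = (a m - b m) + (b m - b n) - (a n - b n)" by simp
    then have "norm (a m - a n) \<le> norm (a m - b m) + norm (b m - b n) + norm (a n - b n)"
      using norm_triangle_ineq4[of "(a m - b m) + (b m - b n)" "a n - b n"]
        norm_triangle_ineq[of "a m - b m" "b m - b n"] by simp
    then show ?thesis using N[OF that] b(2)[of n] b(2)[of m] \<open>r > 0\<close> by linarith
  qed
  then show "\<exists>M. \<forall>m\<ge>M. \<forall>n\<ge>M. norm (a m - a n) < r" by blast
qed

lemma additive_diff:
  fixes \<phi> :: "oper \<Rightarrow> complex"
  assumes "\<And>X Y. X \<in> weyl_alg \<Longrightarrow> Y \<in> weyl_alg \<Longrightarrow> \<phi> (X + Y) = \<phi> X + \<phi> Y"
    and "X \<in> weyl_alg" "Y \<in> weyl_alg"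
  shows "\<phi> (X - Y) = \<phi> X - \<phi> Y"
  using assms(1)[of "X - Y" Y] assms(2,3) by simp

lemma small_multiple:
  fixes K r :: real
  assumes "r < e / (\<bar>K\<bar> + 1)" "0 \<le> r" shows "K * r \<le> e"
proof -
  have "K * r \<le> (\<bar>K\<bar> + 1) * r" using assms by (intro mult_right_mono) auto
  also have "\<dots> \<le> e"
    using assms(1) pos_less_divide_eq[of "\<bar>K\<bar> + 1" r e] by (simp add: add_nonneg_pos mult.commute)
  finally show ?thesis .
qed

lemma weyl_alg_convergent:
  fixes \<phi> :: "nat \<Rightarrow> oper \<Rightarrow> complex"
  assumes add: "\<And>n X Y. X \<in> weyl_alg \<Longrightarrow> Y \<in> weyl_alg \<Longrightarrow> \<phi> n (X + Y) = \<phi> n X + \<phi> n Y"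
    and scale: "\<And>n c X. X \<in> weyl_alg \<Longrightarrow> \<phi> n (cscale_op c X) = \<sigma> c * \<phi> n X"
    and bound: "\<And>n X. X \<in> weyl_alg \<Longrightarrow> cmod (\<phi> n X) \<le> K * norm X"
    and W: "\<And>g. convergent (\<lambda>n. \<phi> n (W g))" and X: "X \<in> weyl_alg"
  shows "convergent (\<lambda>n. \<phi> n X)"
  using X
proof (induction rule: weyl_alg_induct)
  case (approx X)
  show ?case
  proof (rule convergent_approx)
    fix e :: real assume "e > 0"
    then obtain Y where Y: "Y \<in> weyl_alg" "convergent (\<lambda>n. \<phi> n Y)" "norm (X - Y) < e / (\<bar>K\<bar> + 1)"
      using approx(2)[of "e / (\<bar>K\<bar> + 1)"] by (auto simp: add_nonneg_pos)
    have "cmod (\<phi> n X - \<phi> n Y) \<le> e" for n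
      using bound[of "X - Y" n] small_multiple[OF Y(3)] additive_diff[of "\<phi> n", OF add approx(1) Y(1)] approx(1) Y(1)
      by auto
    then show "\<exists>b. convergent b \<and> (\<forall>n. cmod (\<phi> n X - b n) \<le> e)" using Y(2) by blast
  qed
qed (simp_all add: W add scale convergent_add convergent_mult[OF convergent_const])

text \<open>
  Here $\sigma$ is the identity for linear and conjugation for conjugate-linear functionals. With a
  constant sequence the statement says that two functionals agree once they agree on the unitaries.
\<close>

lemma weyl_alg_tendsto:
  fixes \<phi> :: "nat \<Rightarrow> oper \<Rightarrow> complex"
  assumes add: "\<And>n X Y. X \<in> weyl_alg \<Longrightarrow> Y \<in> weyl_alg \<Longrightarrow> \<phi> n (X + Y) = \<phi> n X + \<phi> n Y"
      "\<And>X Y. X \<in> weyl_alg \<Longrightarrow> Y \<in> weyl_alg \<Longrightarrow> L (X + Y) = L X + L Y"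
    and scale: "\<And>n c X. X \<in> weyl_alg \<Longrightarrow> \<phi> n (cscale_op c X) = \<sigma> c * \<phi> n X"
      "\<And>c X. X \<in> weyl_alg \<Longrightarrow> L (cscale_op c X) = \<sigma> c * L X"
    and bound: "\<And>n X. X \<in> weyl_alg \<Longrightarrow> cmod (\<phi> n X) \<le> K * norm X" "\<And>X. X \<in> weyl_alg \<Longrightarrow> cmod (L X) \<le> K' * norm X"
    and W: "\<And>g. (\<lambda>n. \<phi> n (W g)) \<longlonglongrightarrow> L (W g)" and X: "X \<in> weyl_alg"
  shows "(\<lambda>n. \<phi> n X) \<longlonglongrightarrow> L X"
  using X
proof (induction rule: weyl_alg_induct)
  case (approx X)
  show ?case
  proof (rule tendsto_approx)
    fix e :: real assume "e > 0"
    define k where "k = \<bar>K\<bar> + \<bar>K'\<bar>"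
    obtain Y where Y: "Y \<in> weyl_alg" "(\<lambda>n. \<phi> n Y) \<longlonglongrightarrow> L Y" "norm (X - Y) < e / (\<bar>k\<bar> + 1)"
      using approx(2)[of "e / (\<bar>k\<bar> + 1)"] \<open>e > 0\<close> by (auto simp: add_nonneg_pos)
    have "k * norm (X - Y) \<le> e" "K \<le> k" "K' \<le> k"
      using small_multiple[OF Y(3)] by (auto simp: k_def)
    then have le: "K * norm (X - Y) \<le> e" "K' * norm (X - Y) \<le> e"
      by (meson mult_right_mono norm_ge_zero order_trans)+
    have "cmod (\<phi> n X - \<phi> n Y) \<le> e" for n
      using bound(1)[of "X - Y" n] le(1) additive_diff[of "\<phi> n", OF add(1) approx(1) Y(1)] approx(1) Y(1) by auto
    moreover have "cmod (L X - L Y) \<le> e"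
      using bound(2)[of "X - Y"] le(2) additive_diff[of L, OF add(2) approx(1) Y(1)] approx(1) Y(1) by auto
    ultimately show "\<exists>b L'. b \<longlonglongrightarrow> L' \<and> (\<forall>n. cmod (\<phi> n X - b n) \<le> e) \<and> cmod (L X - L') \<le> e"
      using Y(2) by blast
  qed
qed (simp_all add: W add scale tendsto_add tendsto_mult)

text \<open>
  On \<open>weyl_alg\<close> the limit exists, and it is $\tau(Y^* X)$ for the canonical trace $\tau$ of the
  twisted group algebra; \<open>tr_inner X (W g)\<close> is the Fourier coefficient of $X$ at $g$.
\<close>

definition tr_inner :: "oper \<Rightarrow> oper \<Rightarrow> complex" where
  "tr_inner X Y = lim (\<lambda>n. cinner_L2R (X (chirp n)) (Y (chirp n)))"

lemma norm_chirp_le: "norm (chirp n) \<le> 1"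
proof (cases n)
  case 0
  have "chirp 0 = 0" by transfer (simp add: L2_eq_def square_integrable_zero)
  then show ?thesis using 0 by simp
qed (simp add: norm_chirp)

lemma norm_blinfun_chirp_le: "norm (X (chirp n)) \<le> norm X" for X :: oper
  using norm_blinfun[of X "chirp n"] mult_left_mono[OF norm_chirp_le, of "norm X" n] by simp

lemma cinner_chirp_le:
  "cmod (cinner_L2R (X (chirp n)) (Y (chirp n))) \<le> norm X * norm Y"
  for X Y :: oper
  by (rule order_trans[OF cinner_Cauchy_Schwarz]) (intro mult_mono norm_blinfun_chirp_le; simp)

lemma tendsto_W_W:
  "(\<lambda>n. cinner_L2R (W g (chirp n)) (W h (chirp n)))
     \<longlonglongrightarrow> (if g = h then 1 else 0)"
proof (cases "g = h")
  case True
  have "eventually (\<lambda>n. cinner_L2R (W g (chirp n)) (W h (chirp n)) = 1) sequentially"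
    using eventually_gt_at_top[of 0] by eventually_elim (simp add: True cinner_self norm_chirp)
  then show ?thesis using True by (simp add: tendsto_eventually)
next
  case False
  define k where "k = gmul (ginv h) g"
  have k: "k \<noteq> (0, 0, 0)"
    using False by (metis k_def gmul_assoc gmul_ginv(2) gmul_one)
  define c where "c = cnj (phase h (ginv h)) * phase (ginv h) g"
  have eq: "W_inv h o\<^sub>L W g = cscale_op c (W k)"
    by (simp add: W_inv_def cscale_op_compose_left W_compose cscale_op_cscale_op c_def k_def)
  have "cinner_L2R (W g f) (W h f) = c * cinner_L2R (W k f) f" for f
  proof -
    have "cinner_L2R (W g f) (W h f) = cinner_L2R ((W_inv h o\<^sub>L W g) f) f"
      using is_adjoint_W_inv[of h] by (simp add: is_adjoint_def)
    then show ?thesis by (simp add: eq cinner_cscale_left)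
  qed
  then show ?thesis
    using tendsto_mult_right_zero[OF cinner_W_chirp_tendsto[OF k], of c] False by simp
qed

lemma convergent_tr_inner:
  assumes X: "X \<in> weyl_alg" and Y: "Y \<in> weyl_alg"
  shows "convergent (\<lambda>n. cinner_L2R (X (chirp n)) (Y (chirp n)))"
proof (rule weyl_alg_convergent[OF _ _ _ _ X, where \<phi> = "\<lambda>n (X :: oper). cinner_L2R (X (chirp n)) (Y (chirp n))"
      and \<sigma> = "\<lambda>c. c" and K = "norm Y"])
  fix g
  show "convergent (\<lambda>n. cinner_L2R (W g (chirp n)) (Y (chirp n)))"
  proof (rule weyl_alg_convergent[OF _ _ _ _ Y, where \<phi> = "\<lambda>n (Y :: oper). cinner_L2R (W g (chirp n)) (Y (chirp n))"
        and \<sigma> = cnj and K = "norm (W g)"])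
    show "convergent (\<lambda>n. cinner_L2R (W g (chirp n)) (W h (chirp n)))" for h
      using tendsto_W_W by (rule convergentI)
  qed (auto simp: blinfun.add_left cinner_add_right cinner_cscale_right intro: cinner_chirp_le)
next
  show "cmod (cinner_L2R (X (chirp n)) (Y (chirp n))) \<le> norm Y * norm X" for n and X :: oper
    using cinner_chirp_le[of X n Y] by (simp add: mult.commute)
qed (auto simp: blinfun.add_left cinner_add_left cinner_cscale_left)

lemma tr_inner_LIMSEQ:
  "X \<in> weyl_alg \<Longrightarrow> Y \<in> weyl_alg \<Longrightarrow>
    (\<lambda>n. cinner_L2R (X (chirp n)) (Y (chirp n))) \<longlonglongrightarrow> tr_inner X Y"
  using convergent_tr_inner by (simp add: tr_inner_def convergent_LIMSEQ_iff)

lemma tr_inner_eqI: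
  "(\<lambda>n. cinner_L2R (X (chirp n)) (Y (chirp n))) \<longlonglongrightarrow> L \<Longrightarrow> tr_inner X Y = L"
  for X Y :: oper
  by (simp add: tr_inner_def limI)

lemma tr_inner_W_W: "tr_inner (W g) (W h) = (if g = h then 1 else 0)"
  by (rule tr_inner_eqI[OF tendsto_W_W])

lemma tr_inner_add_left:
  "X \<in> weyl_alg \<Longrightarrow> Y \<in> weyl_alg \<Longrightarrow> Z \<in> weyl_alg \<Longrightarrow> tr_inner (X + Y) Z = tr_inner X Z + tr_inner Y Z"
  by (intro tr_inner_eqI) (simp add: blinfun.add_left cinner_add_left tendsto_add tr_inner_LIMSEQ)

lemma tr_inner_add_right:
  "X \<in> weyl_alg \<Longrightarrow> Y \<in> weyl_alg \<Longrightarrow> Z \<in> weyl_alg \<Longrightarrow> tr_inner Z (X + Y) = tr_inner Z X + tr_inner Z Y"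
  by (intro tr_inner_eqI) (simp add: blinfun.add_left cinner_add_right tendsto_add tr_inner_LIMSEQ)

lemma tr_inner_diff_left:
  "X \<in> weyl_alg \<Longrightarrow> Y \<in> weyl_alg \<Longrightarrow> Z \<in> weyl_alg \<Longrightarrow> tr_inner (X - Y) Z = tr_inner X Z - tr_inner Y Z"
  by (intro tr_inner_eqI) (simp add: blinfun.diff_left cinner_diff_left tendsto_diff tr_inner_LIMSEQ)

lemma tr_inner_diff_right:
  "X \<in> weyl_alg \<Longrightarrow> Y \<in> weyl_alg \<Longrightarrow> Z \<in> weyl_alg \<Longrightarrow> tr_inner Z (X - Y) = tr_inner Z X - tr_inner Z Y"
  by (intro tr_inner_eqI) (simp add: blinfun.diff_left cinner_diff_right tendsto_diff tr_inner_LIMSEQ)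

lemma tr_inner_cscale_left:
  "X \<in> weyl_alg \<Longrightarrow> Z \<in> weyl_alg \<Longrightarrow> tr_inner (cscale_op c X) Z = c * tr_inner X Z"
  by (intro tr_inner_eqI) (simp add: cinner_cscale_left tendsto_mult tr_inner_LIMSEQ)

lemma tr_inner_cscale_right:
  "X \<in> weyl_alg \<Longrightarrow> Z \<in> weyl_alg \<Longrightarrow> tr_inner Z (cscale_op c X) = cnj c * tr_inner Z X"
  by (intro tr_inner_eqI) (simp add: cinner_cscale_right tendsto_mult tr_inner_LIMSEQ)

lemmas tr_inner_simps = tr_inner_add_left tr_inner_add_right tr_inner_diff_left tr_inner_diff_right
  tr_inner_cscale_left tr_inner_cscale_right

lemma tr_inner_commute:
  assumes "X \<in> weyl_alg" "Y \<in> weyl_alg" shows "tr_inner X Y = cnj (tr_inner Y X)"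
proof (rule tr_inner_eqI)
  have "cinner_L2R (X (chirp n)) (Y (chirp n)) =
     cnj (cinner_L2R (Y (chirp n)) (X (chirp n)))" for n
    by (rule cinner_commute)
  then show "(\<lambda>n. cinner_L2R (X (chirp n)) (Y (chirp n))) \<longlonglongrightarrow> cnj (tr_inner Y X)"
    using tendsto_cnj[OF tr_inner_LIMSEQ[OF assms(2,1)]] by simp
qed

lemma tr_inner_adjoint: "is_adjoint X X' \<Longrightarrow> tr_inner (X o\<^sub>L Y) Z = tr_inner Y (X' o\<^sub>L Z)"
  by (simp add: tr_inner_def is_adjoint_def)

lemma tr_inner_le:
  assumes "X \<in> weyl_alg" "Y \<in> weyl_alg" shows "cmod (tr_inner X Y) \<le> norm X * norm Y"
  by (rule Lim_bounded[OF tendsto_norm[OF tr_inner_LIMSEQ[OF assms]], of 0])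
    (simp add: cinner_chirp_le)

lemma tr_inner_self:
  assumes "X \<in> weyl_alg"
  shows "tr_inner X X = complex_of_real (Re (tr_inner X X))" "0 \<le> Re (tr_inner X X)"
proof -
  show "tr_inner X X = complex_of_real (Re (tr_inner X X))"
    using tr_inner_commute[OF assms assms] by (metis Reals_cnj_iff of_real_Re)
  show "0 \<le> Re (tr_inner X X)"
    by (rule Lim_bounded2[OF tendsto_Re[OF tr_inner_LIMSEQ[OF assms assms]], of 0]) (simp add: cinner_self)
qed

lemma tr_inner_Cauchy_Schwarz:
  assumes Z: "Z \<in> weyl_alg" and X: "X \<in> weyl_alg" and Y: "Y \<in> weyl_alg"
  shows "cmod (tr_inner (Z o\<^sub>L X) Y) \<le> norm Z * sqrt (Re (tr_inner X X)) * sqrt (Re (tr_inner Y Y))"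
proof (rule LIMSEQ_le)
  show "(\<lambda>n. cmod (cinner_L2R ((Z o\<^sub>L X) (chirp n)) (Y (chirp n)))) \<longlonglongrightarrow> cmod (tr_inner (Z o\<^sub>L X) Y)"
    using assms by (intro tendsto_norm tr_inner_LIMSEQ) auto
  show "(\<lambda>n. norm Z * sqrt (Re (cinner_L2R (X (chirp n)) (X (chirp n)))) *
      sqrt (Re (cinner_L2R (Y (chirp n)) (Y (chirp n)))))
     \<longlonglongrightarrow> norm Z * sqrt (Re (tr_inner X X)) * sqrt (Re (tr_inner Y Y))"
    using assms by (intro tendsto_intros tr_inner_LIMSEQ) auto
  have "cmod (cinner_L2R ((Z o\<^sub>L X) f) (Y f)) \<le>
    norm Z * sqrt (Re (cinner_L2R (X f) (X f))) *
      sqrt (Re (cinner_L2R (Y f) (Y f)))" for f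
    using cinner_Cauchy_Schwarz[of "(Z o\<^sub>L X) f" "Y f"]
      mult_right_mono[OF norm_blinfun[of Z "X f"], of "norm (Y f)"]
    by (simp add: cinner_self)
  then show "\<exists>N. \<forall>n\<ge>N. cmod (cinner_L2R ((Z o\<^sub>L X) (chirp n)) (Y (chirp n))) \<le>
    norm Z * sqrt (Re (cinner_L2R (X (chirp n)) (X (chirp n)))) *
      sqrt (Re (cinner_L2R (Y (chirp n)) (Y (chirp n))))"
    by blast
qed

text \<open>
  The trace property: on two unitaries both sides carry the same phase, and the general case follows
  by continuity.
\<close>

lemma tr_inner_right_W:
  assumes X: "X \<in> weyl_alg" and Y: "Y \<in> weyl_alg"
  shows "tr_inner (X o\<^sub>L W g) (Y o\<^sub>L W g) = tr_inner X Y"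
proof -
  have *: "tr_inner (W h o\<^sub>L W g) (Y o\<^sub>L W g) = tr_inner (W h) Y" for h
  proof -
    have "(\<lambda>n::nat. tr_inner (W h o\<^sub>L W g) (Y o\<^sub>L W g)) \<longlonglongrightarrow> tr_inner (W h) Y"
    proof (rule weyl_alg_tendsto[OF _ _ _ _ _ _ _ Y, where \<sigma> = cnj and \<phi> = "\<lambda>n Y. tr_inner (W h o\<^sub>L W g) (Y o\<^sub>L W g)"
          and K = "norm (W h)" and K' = "norm (W h)"])
      show "cmod (tr_inner (W h o\<^sub>L W g) (Y o\<^sub>L W g)) \<le> norm (W h) * norm Y" if "Y \<in> weyl_alg" for Y
        using tr_inner_le[of "W h o\<^sub>L W g" "Y o\<^sub>L W g"] that by simp
    qed (auto simp: compose_add_left cscale_op_compose_left tr_inner_simps W_compose tr_inner_W_W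
        cmod1_mult_cnj mult.commute[of "cnj _"] intro: tr_inner_le)
    then show ?thesis by (simp add: LIMSEQ_const_iff)
  qed
  have "(\<lambda>n::nat. tr_inner (X o\<^sub>L W g) (Y o\<^sub>L W g)) \<longlonglongrightarrow> tr_inner X Y"
  proof (rule weyl_alg_tendsto[OF _ _ _ _ _ _ _ X, where \<sigma> = "\<lambda>c. c" and \<phi> = "\<lambda>n X. tr_inner (X o\<^sub>L W g) (Y o\<^sub>L W g)"
        and L = "\<lambda>X. tr_inner X Y" and K = "norm Y" and K' = "norm Y"])
    show "cmod (tr_inner (X o\<^sub>L W g) (Y o\<^sub>L W g)) \<le> norm Y * norm X" "cmod (tr_inner X Y) \<le> norm Y * norm X"
      if "X \<in> weyl_alg" for X
      using tr_inner_le[of "X o\<^sub>L W g" "Y o\<^sub>L W g"] tr_inner_le[of X Y] that Y by (simp_all add: mult.commute)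
  qed (use Y in \<open>simp_all add: compose_add_left cscale_op_compose_left tr_inner_simps *\<close>)
  then show ?thesis by (simp add: LIMSEQ_const_iff)
qed

lemma compose_W_W_inv [simp]: "X o\<^sub>L W g o\<^sub>L W_inv g = X" "X o\<^sub>L W_inv g o\<^sub>L W g = X"
  for X :: oper
  by (rule blinfun_eqI, simp)+

lemma tr_inner_right_W_shift:
  assumes "X \<in> weyl_alg" "Y \<in> weyl_alg"
  shows "tr_inner (X o\<^sub>L W g) Y = tr_inner X (Y o\<^sub>L W_inv g)"
  using tr_inner_right_W[of X "Y o\<^sub>L W_inv g" g] assms by simp

lemma tr_inner_left_W_inv_shift: "tr_inner (W_inv g o\<^sub>L X) Y = tr_inner X (W g o\<^sub>L Y)"
  by (rule tr_inner_adjoint[OF is_adjoint_W_inv])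

section \<open>Elements acting isometrically by multiplication\<close>

lemma eq_zero_approx:
  fixes z :: "'a :: real_normed_vector"
  assumes "\<And>e. 0 < e \<Longrightarrow> e < 1 \<Longrightarrow> norm z \<le> K * e" shows "z = 0"
proof (rule ccontr)
  assume "z \<noteq> 0"
  define e where "e = min (1 / 2) (norm z / (2 * (\<bar>K\<bar> + 1)))"
  have e: "0 < e" "e < 1" using \<open>z \<noteq> 0\<close> by (simp_all add: e_def add_nonneg_pos)
  have "norm z \<le> K * e" using e by (rule assms)
  also have "\<dots> \<le> (\<bar>K\<bar> + 1) * (norm z / (2 * (\<bar>K\<bar> + 1)))"
    using e by (intro mult_mono) (auto simp: e_def)
  also have "\<dots> = norm z / 2"
    by (simp add: field_simps add_nonneg_pos)
  finally show False using \<open>z \<noteq> 0\<close> by simp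
qed

lemma quadratic_defect_bound:
  fixes x y :: real
  assumes "0 \<le> x" "x \<le> y" "y \<le> 1"
  shows "x - x * x \<le> y - y * y / 2"
proof (cases "y \<le> 1 / 2")
  case True
  have "0 \<le> (y - x) * (1 - 2 * y) + (y - x) * (y - x) + y * y / 2"
    using assms True by (intro add_nonneg_nonneg mult_nonneg_nonneg) auto
  then show ?thesis by (simp add: algebra_simps)
next
  case False
  have "0 \<le> (y - 1 / 2) * (1 - y)" using assms False by (intro mult_nonneg_nonneg) auto
  moreover have "(y - 1 / 2) * (1 - y) = 3 / 2 * y - 1 / 2 - y * y" by (simp add: field_simps)
  moreover have "0 \<le> (x - 1 / 2)\<^sup>2" by simp
  then have "x - x * x \<le> 1 / 4" by (simp add: power2_eq_square algebra_simps)
  ultimately show ?thesis using assms False by linarith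
qed

text \<open>
  If a contraction $S$ is not an isometry, then multiplication by $S$ shrinks the norm of its own
  defect $b = 1 - S^* S$ by a definite factor, because $b$ is largest on vectors that $S$ shortens.
  The bound replaces functional calculus for $S^* S$.
\<close>

lemma defect_bound:
  fixes S S' :: oper
  assumes adj: "is_adjoint S S'" and S: "norm S \<le> 1"
  defines "b \<equiv> id_blinfun - (S' o\<^sub>L S)"
  shows "(norm (S o\<^sub>L b))\<^sup>2 \<le> (norm b)\<^sup>2 * (1 - (norm b)\<^sup>2 / 2)"
proof -
  note ad = is_adjoint_inner[OF adj] is_adjoint_inner[OF is_adjoint_sym[OF adj]]
  have S': "norm S' \<le> 1" using is_adjoint_norm[OF adj] S by simp
  have b_apply: "b f = f - S' (S f)" for f
    by (simp add: b_def blinfun.diff_left)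
  have contr: "(norm (S' f))\<^sup>2 \<le> (norm f)\<^sup>2" for f
    using norm_blinfun[of S' f] mult_right_mono[OF S', of "norm f"] by (intro power_mono) auto
  have sq: "(norm (b h))\<^sup>2 \<le> inner (b h) h" for h
  proof -
    have "inner (b h) h - (norm (b h))\<^sup>2
        = inner (b h) (S' (S h))"
      by (simp add: power2_norm_eq_inner b_apply inner_diff_left inner_diff_right)
    also have "\<dots> = inner (S (b h)) (S h)"
      by (simp add: ad)
    also have "\<dots> = (norm (S h))\<^sup>2 - (norm (S' (S h)))\<^sup>2"
      by (simp add: power2_norm_eq_inner b_apply blinfun.diff_right inner_diff_left)
        (simp add: ad)
    also have "\<dots> \<ge> 0" using contr by simp
    finally show ?thesis by simp
  qed
  have b_le: "norm (b h) \<le> norm h" for h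
  proof -
    have "norm (b h) * norm (b h) \<le> norm (b h) * norm h"
      using sq[of h] norm_cauchy_schwarz[of "b h" h] by (simp add: power2_eq_square)
    then show ?thesis
      by (cases "norm (b h) = 0") (auto simp: mult_le_cancel_left)
  qed
  have b1: "norm b \<le> 1"
    by (rule norm_blinfun_bound) (use b_le in auto)
  have unit: "(norm ((S o\<^sub>L b) f))\<^sup>2 \<le> (norm b)\<^sup>2 * (1 - (norm b)\<^sup>2 / 2)"
    if f: "norm f = 1" for f
  proof -
    define g where "g = b f"
    define x where "x = (norm g)\<^sup>2"
    have "x = inner f (b g)"
      by (simp add: x_def g_def power2_norm_eq_inner b_apply[of f])
        (simp add: b_apply inner_diff_left inner_diff_right ad blinfun.diff_right)
    also have "\<dots> \<le> norm (b g)"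
      using norm_cauchy_schwarz[of f "b g"] f by simp
    finally have "x\<^sup>2 \<le> (norm (b g))\<^sup>2"
      by (intro power_mono) (auto simp: x_def)
    also have "\<dots> \<le> inner (b g) g" by (rule sq)
    finally have x: "x * x \<le> inner (b g) g" by (simp add: power2_eq_square)
    have "(norm (S g))\<^sup>2 = x - inner (b g) g"
      by (simp add: x_def power2_norm_eq_inner b_apply[of g] inner_diff_left)
        (simp add: ad)
    also have "\<dots> \<le> x - x * x" using x by simp
    also have "\<dots> \<le> (norm b)\<^sup>2 - (norm b)\<^sup>2 * (norm b)\<^sup>2 / 2"
    proof (rule quadratic_defect_bound)
      show "x \<le> (norm b)\<^sup>2"
        using norm_blinfun[of b f] f unfolding x_def g_def by (intro power_mono) auto
      show "(norm b)\<^sup>2 \<le> 1" using b1 by (simp add: power_le_one)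
    qed (simp add: x_def)
    finally show ?thesis by (simp add: g_def algebra_simps)
  qed
  define k where "k = sqrt ((norm b)\<^sup>2 * (1 - (norm b)\<^sup>2 / 2))"
  have nn: "0 \<le> (norm b)\<^sup>2 * (1 - (norm b)\<^sup>2 / 2)"
  proof -
    have "(norm b)\<^sup>2 \<le> 1" using b1 by (simp add: power_le_one)
    then show ?thesis by (intro mult_nonneg_nonneg) auto
  qed
  have "norm (S o\<^sub>L b) \<le> k"
  proof (rule norm_blinfun_bound)
    show "0 \<le> k" using nn by (simp add: k_def)
    show "norm ((S o\<^sub>L b) f) \<le> k * norm f" for f
    proof (cases "f = 0")
      case False
      define u where "u = (1 / norm f) *\<^sub>R f"
      have u: "norm u = 1" using False by (simp add: u_def)
      have f: "f = norm f *\<^sub>R u" using False by (simp add: u_def)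
      have "norm ((S o\<^sub>L b) u) \<le> k"
        unfolding k_def using unit[OF u] by (rule real_le_rsqrt)
      then have "norm f * norm ((S o\<^sub>L b) u) \<le> norm f * k" by (intro mult_left_mono) auto
      moreover have "norm ((S o\<^sub>L b) f) = norm f * norm ((S o\<^sub>L b) u)"
        by (subst f) (simp only: blinfun.scaleR_right norm_scaleR abs_norm_cancel)
      ultimately show ?thesis by (simp add: mult.commute)
    qed simp
  qed
  then have "(norm (S o\<^sub>L b))\<^sup>2 \<le> k\<^sup>2" by (intro power_mono) auto
  then show ?thesis using nn by (simp add: k_def)
qed

lemma compose_id [simp]: "X o\<^sub>L id_blinfun = X" "id_blinfun o\<^sub>L X = X" for X :: oper
  by (rule blinfun_eqI, simp)+

lemma compose_assoc: "X o\<^sub>L Y o\<^sub>L Z = X o\<^sub>L (Y o\<^sub>L Z)" for X Y Z :: oper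
  by (rule blinfun_eqI, simp)

lemma norm_id_le: "norm (id_blinfun :: oper) \<le> 1"
  by (rule norm_blinfun_bound) auto

lemma weyl_span_id: "id_blinfun \<in> weyl_span UNIV"
  using weyl_span.W[of "(0, 0, 0)" UNIV] by (simp add: W_one)

lemma weyl_span_diff: "X \<in> weyl_span Q \<Longrightarrow> Y \<in> weyl_span Q \<Longrightarrow> X - Y \<in> weyl_span Q"
  using weyl_span.add[OF _ weyl_span.cscale[of Y Q "-1"], of X] by (simp add: cscale_op_minus_one)

lemma weyl_span_adjoint:
  assumes "S \<in> weyl_span UNIV"
  shows "\<exists>S'\<in>weyl_span UNIV. is_adjoint S S' \<and>
     (\<forall>X\<in>weyl_alg. \<forall>Z\<in>weyl_alg. tr_inner (X o\<^sub>L S) Z = tr_inner X (Z o\<^sub>L S'))"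
  using assms
proof (induction)
  case (W g)
  show ?case
    by (rule bexI[of _ "W_inv g"]) (auto simp: is_adjoint_W tr_inner_right_W_shift W_inv_span)
next
  case (add X Y)
  then obtain X' Y' where *: "X' \<in> weyl_span UNIV" "is_adjoint X X'"
     "\<forall>A\<in>weyl_alg. \<forall>Z\<in>weyl_alg. tr_inner (A o\<^sub>L X) Z = tr_inner A (Z o\<^sub>L X')"
     "Y' \<in> weyl_span UNIV" "is_adjoint Y Y'"
     "\<forall>A\<in>weyl_alg. \<forall>Z\<in>weyl_alg. tr_inner (A o\<^sub>L Y) Z = tr_inner A (Z o\<^sub>L Y')"
    by blast
  have "X \<in> weyl_alg" "Y \<in> weyl_alg" "X' \<in> weyl_alg" "Y' \<in> weyl_alg"
    using add.hyps(1,2) *(1,4) weyl_span_subset[of UNIV] by auto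
  then show ?case using *
    by (intro bexI[of _ "X' + Y'"])
      (auto simp: is_adjoint_add weyl_span.intros compose_add_right tr_inner_simps)
next
  case (cscale X c)
  then obtain X' where *: "X' \<in> weyl_span UNIV" "is_adjoint X X'"
     "\<forall>A\<in>weyl_alg. \<forall>Z\<in>weyl_alg. tr_inner (A o\<^sub>L X) Z = tr_inner A (Z o\<^sub>L X')"
    by blast
  have "X \<in> weyl_alg" "X' \<in> weyl_alg"
    using cscale.hyps(1) *(1) weyl_span_subset[of UNIV] by auto
  then show ?case using *
    by (intro bexI[of _ "cscale_op (cnj c) X'"])
      (auto simp: is_adjoint_cscale weyl_span.intros cscale_op_compose_right weyl_alg_B tr_inner_simps)
qed

text \<open>
  Finite combinations have explicit adjoints, so the arguments on isometric multiplication pass from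
  $U$ to approximants, rescaled so as to remain contractions. A defect of size $d$ lowers norms by the
  order $d^2$, whence this order of approximation.
\<close>

lemma contractive_approx:
  assumes U: "U \<in> weyl_alg" "norm U \<le> 1" and d: "0 < d" "d < 1"
  shows "\<exists>S\<in>weyl_span UNIV. \<exists>S'\<in>weyl_span UNIV. is_adjoint S S' \<and>
    (\<forall>X\<in>weyl_alg. \<forall>Z\<in>weyl_alg. tr_inner (X o\<^sub>L S) Z = tr_inner X (Z o\<^sub>L S')) \<and>
    norm S \<le> 1 \<and> norm (U - S) \<le> d\<^sup>2 / 4 \<and> norm (U - S) \<le> d"
proof -
  define e where "e = d\<^sup>2 / 8"
  have e: "e > 0" using d by (simp add: e_def)
  obtain S0 where S0: "S0 \<in> weyl_span UNIV" "norm (U - S0) < e"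
    using weyl_alg_approx[OF U(1) e] by blast
  have n0: "norm S0 \<le> 1 + e"
    using norm_triangle_ineq2[of S0 U] S0(2) U(2) by (simp add: norm_minus_commute)
  define S where "S = (1 / (1 + e)) *\<^sub>R S0"
  have S: "S \<in> weyl_span UNIV"
    using S0(1) by (simp add: S_def weyl_span.intros flip: cscale_op_of_real del: of_real_divide)
  have "norm S \<le> 1"
    using n0 e by (simp add: S_def)
  moreover have US: "norm (U - S) \<le> d\<^sup>2 / 4"
  proof -
    have "S0 - S = (e / (1 + e)) *\<^sub>R S0"
    proof -
      have "S0 - S = (1 - 1 / (1 + e)) *\<^sub>R S0" by (simp add: S_def scaleR_left_diff_distrib)
      then show ?thesis using e by (simp add: field_simps)
    qed
    then have "norm (S0 - S) = e / (1 + e) * norm S0" using e by simp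
    also have "\<dots> \<le> e / (1 + e) * (1 + e)" using n0 e by (intro mult_left_mono) auto
    finally have "norm (S0 - S) \<le> e" using e by simp
    moreover have "norm (U - S) \<le> norm (U - S0) + norm (S0 - S)"
      using norm_triangle_ineq[of "U - S0" "S0 - S"] by simp
    ultimately show ?thesis using S0(2) by (simp add: e_def)
  qed
  moreover have "d\<^sup>2 \<le> d" using d by (simp add: power2_eq_square mult_le_cancel_left)
  then have "norm (U - S) \<le> d" using US d(1) by linarith
  ultimately show ?thesis
    using weyl_span_adjoint[OF S] S by blast
qed

lemma defect_small:
  fixes b d :: real
  assumes "0 \<le> b" "0 < d" "d < 1" "(1 - d\<^sup>2 / 4) * b \<le> s" "s\<^sup>2 \<le> b\<^sup>2 * (1 - b\<^sup>2 / 2)"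
  shows "b \<le> d"
proof (cases "b = 0")
  case False
  have "d\<^sup>2 \<le> 1" using assms by (simp add: power_le_one)
  then have "((1 - d\<^sup>2 / 4) * b)\<^sup>2 \<le> s\<^sup>2" using assms by (intro power_mono) auto
  then have "b\<^sup>2 * (1 - d\<^sup>2 / 4)\<^sup>2 \<le> b\<^sup>2 * (1 - b\<^sup>2 / 2)"
    using assms(5) by (simp add: power_mult_distrib mult.commute)
  then have "(1 - d\<^sup>2 / 4)\<^sup>2 \<le> 1 - b\<^sup>2 / 2"
    using False by (simp add: mult_le_cancel_left)
  moreover have "1 - d\<^sup>2 / 2 \<le> (1 - d\<^sup>2 / 4)\<^sup>2"
    by (simp add: power2_diff)
  ultimately have "b\<^sup>2 \<le> d\<^sup>2" by linarith
  then show ?thesis using assms by (simp add: power2_le_iff_abs_le)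
qed (use assms in simp)

text \<open>
  Applying the hypothesis to the defect of an approximant of $U$ shows, by \<open>defect_bound\<close>, that the
  defect is small.
\<close>

lemma tr_inner_left_isometric:
  assumes U: "U \<in> weyl_alg" and iso: "\<And>X. X \<in> weyl_span UNIV \<Longrightarrow> norm (U o\<^sub>L X) = norm X"
    and X: "X \<in> weyl_alg" and Y: "Y \<in> weyl_alg"
  shows "tr_inner (U o\<^sub>L X) (U o\<^sub>L Y) = tr_inner X Y"
proof -
  have U1: "norm U \<le> 1"
    using iso[OF weyl_span_id] norm_id_le by simp
  have "tr_inner (U o\<^sub>L X) (U o\<^sub>L Y) - tr_inner X Y = 0"
  proof (rule eq_zero_approx)
    fix d :: real assume d: "0 < d" "d < 1"
    obtain S S' where S: "S \<in> weyl_span UNIV" "S' \<in> weyl_span UNIV" "is_adjoint S S'"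
      "norm S \<le> 1" "norm (U - S) \<le> d\<^sup>2 / 4" and dd: "norm (U - S) \<le> d"
      using contractive_approx[OF U U1 d] by metis
    have SA: "S \<in> weyl_alg" "S' \<in> weyl_alg" using S weyl_span_subset by auto
    define b where "b = id_blinfun - (S' o\<^sub>L S)"
    have b: "b \<in> weyl_span UNIV"
      using S unfolding b_def by (intro weyl_span_diff weyl_span_id weyl_span_compose) auto
    then have bA: "b \<in> weyl_alg" using weyl_span_subset by auto
    have "norm b \<le> d"
    proof (rule defect_small)
      have "norm b = norm (U o\<^sub>L b)" using iso[OF b] by simp
      also have "\<dots> \<le> norm (S o\<^sub>L b) + norm ((U - S) o\<^sub>L b)"
        using norm_triangle_ineq[of "S o\<^sub>L b" "(U - S) o\<^sub>L b"] by (simp add: compose_diff_left)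
      also have "\<dots> \<le> norm (S o\<^sub>L b) + d\<^sup>2 / 4 * norm b"
        using norm_blinfun_compose[of "U - S" b] mult_right_mono[OF S(5), of "norm b"] by simp
      finally show "(1 - d\<^sup>2 / 4) * norm b \<le> norm (S o\<^sub>L b)" by (simp add: algebra_simps)
      show "(norm (S o\<^sub>L b))\<^sup>2 \<le> (norm b)\<^sup>2 * (1 - (norm b)\<^sup>2 / 2)"
        unfolding b_def by (rule defect_bound[OF S(3,4)])
    qed (use d in auto)
    have "tr_inner (S o\<^sub>L X) (S o\<^sub>L Y) = tr_inner X (Y - (b o\<^sub>L Y))"
      unfolding tr_inner_adjoint[OF S(3)] by (simp add: b_def compose_diff_left compose_assoc)
    then have "tr_inner (U o\<^sub>L X) (U o\<^sub>L Y) - tr_inner X Y =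
       tr_inner ((U - S) o\<^sub>L X) (U o\<^sub>L Y) + tr_inner (S o\<^sub>L X) ((U - S) o\<^sub>L Y) - tr_inner X (b o\<^sub>L Y)"
      using U X Y SA bA by (simp add: compose_diff_left tr_inner_simps)
    also have "cmod \<dots> \<le> norm ((U - S) o\<^sub>L X) * norm (U o\<^sub>L Y) + norm (S o\<^sub>L X) * norm ((U - S) o\<^sub>L Y) + norm X * norm (b o\<^sub>L Y)"
      using U X Y SA bA
      by (intro order_trans[OF norm_triangle_ineq4] order_trans[OF norm_triangle_ineq] add_mono tr_inner_le) auto
    also have "\<dots> \<le> (d * norm X) * (1 * norm Y) + (1 * norm X) * (d * norm Y) + norm X * (d * norm Y)"
      using dd U1 S(4) \<open>norm b \<le> d\<close> d
      by (intro add_mono mult_mono order_trans[OF norm_blinfun_compose] mult_right_mono mult_left_mono) auto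
    finally show "cmod (tr_inner (U o\<^sub>L X) (U o\<^sub>L Y) - tr_inner X Y) \<le> (3 * norm X * norm Y) * d"
      by (simp add: algebra_simps)
  qed
  then show ?thesis by simp
qed

text \<open>
  The same argument with the defect $1 - S S^*$; the trace property moves $S$ from the right of one
  factor to the right of the other.
\<close>

lemma tr_inner_right_isometric:
  assumes U: "U \<in> weyl_alg" and iso: "\<And>X. X \<in> weyl_span UNIV \<Longrightarrow> norm (X o\<^sub>L U) = norm X"
    and X: "X \<in> weyl_alg" and Y: "Y \<in> weyl_alg"
  shows "tr_inner (X o\<^sub>L U) (Y o\<^sub>L U) = tr_inner X Y"
proof -
  have U1: "norm U \<le> 1"
    using iso[OF weyl_span_id] norm_id_le by simp
  have "tr_inner (X o\<^sub>L U) (Y o\<^sub>L U) - tr_inner X Y = 0"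
  proof (rule eq_zero_approx)
    fix d :: real assume d: "0 < d" "d < 1"
    obtain S S' where S: "S \<in> weyl_span UNIV" "S' \<in> weyl_span UNIV" "is_adjoint S S'"
      "norm S \<le> 1" "norm (U - S) \<le> d\<^sup>2 / 4" and dd: "norm (U - S) \<le> d"
      and shift: "\<forall>X\<in>weyl_alg. \<forall>Z\<in>weyl_alg. tr_inner (X o\<^sub>L S) Z = tr_inner X (Z o\<^sub>L S')"
      using contractive_approx[OF U U1 d] by metis
    have SA: "S \<in> weyl_alg" "S' \<in> weyl_alg" using S weyl_span_subset by auto
    define b where "b = id_blinfun - (S o\<^sub>L S')"
    have b: "b \<in> weyl_span UNIV"
      using S unfolding b_def by (intro weyl_span_diff weyl_span_id weyl_span_compose) auto
    then have bA: "b \<in> weyl_alg" using weyl_span_subset by auto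
    have badj: "is_adjoint (b o\<^sub>L S) (S' o\<^sub>L b)"
    proof -
      have "is_adjoint (S o\<^sub>L S') (S o\<^sub>L S')"
        by (rule is_adjoint_compose[OF S(3) is_adjoint_sym[OF S(3)]])
      then have "is_adjoint b b"
        by (simp add: b_def is_adjoint_def blinfun.diff_left cinner_diff_left cinner_diff_right)
      then show ?thesis by (rule is_adjoint_compose[OF _ S(3)])
    qed
    have "norm b \<le> d"
    proof (rule defect_small)
      have "norm b = norm (b o\<^sub>L U)" using iso[OF b] by simp
      also have "\<dots> \<le> norm (b o\<^sub>L S) + norm (b o\<^sub>L (U - S))"
        using norm_triangle_ineq[of "b o\<^sub>L S" "b o\<^sub>L (U - S)"] by (simp add: compose_diff_right)
      also have "\<dots> \<le> norm (S' o\<^sub>L b) + d\<^sup>2 / 4 * norm b"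
        using norm_blinfun_compose[of b "U - S"] mult_left_mono[OF S(5), of "norm b"] is_adjoint_norm[OF badj]
        by (simp add: mult.commute)
      finally show "(1 - d\<^sup>2 / 4) * norm b \<le> norm (S' o\<^sub>L b)" by (simp add: algebra_simps)
      show "(norm (S' o\<^sub>L b))\<^sup>2 \<le> (norm b)\<^sup>2 * (1 - (norm b)\<^sup>2 / 2)"
        unfolding b_def using S(4) is_adjoint_norm[OF S(3)]
        by (intro defect_bound is_adjoint_sym[OF S(3)]) simp
    qed (use d in auto)
    have "tr_inner (X o\<^sub>L S) (Y o\<^sub>L S) = tr_inner X (Y - (Y o\<^sub>L b))"
      using X Y SA by (simp add: shift b_def compose_diff_right compose_assoc)
    then have "tr_inner (X o\<^sub>L U) (Y o\<^sub>L U) - tr_inner X Y =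
       tr_inner (X o\<^sub>L (U - S)) (Y o\<^sub>L U) + tr_inner (X o\<^sub>L S) (Y o\<^sub>L (U - S)) - tr_inner X (Y o\<^sub>L b)"
      using U X Y SA bA by (simp add: compose_diff_right tr_inner_simps)
    also have "cmod \<dots> \<le> norm (X o\<^sub>L (U - S)) * norm (Y o\<^sub>L U) + norm (X o\<^sub>L S) * norm (Y o\<^sub>L (U - S)) + norm X * norm (Y o\<^sub>L b)"
      using U X Y SA bA
      by (intro order_trans[OF norm_triangle_ineq4] order_trans[OF norm_triangle_ineq] add_mono tr_inner_le) auto
    also have "\<dots> \<le> (norm X * d) * (norm Y * 1) + (norm X * 1) * (norm Y * d) + norm X * (norm Y * d)"
      using dd U1 S(4) \<open>norm b \<le> d\<close> d
      by (intro add_mono mult_mono order_trans[OF norm_blinfun_compose] mult_right_mono mult_left_mono) auto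
    finally show "cmod (tr_inner (X o\<^sub>L U) (Y o\<^sub>L U) - tr_inner X Y) \<le> (3 * norm X * norm Y) * d"
      by (simp add: algebra_simps)
  qed
  then show ?thesis by simp
qed

section \<open>Uniqueness of Fourier coefficients\<close>

lemma exponential_beats_polynomial:
  fixes c :: real
  assumes "c > 1"
  shows "\<exists>n. real (Suc n) ^ k < c ^ n"
proof -
  have lc: "ln c > 0" using assms by simp
  have "((\<lambda>x. x ^ k / exp x) \<longlongrightarrow> 0) (at_top :: real filter)"
    by (rule tendsto_power_div_exp_0)
  then have "eventually (\<lambda>x::real. x ^ k / exp x < (ln c / 2) ^ k) at_top"
    by (rule order_tendstoD) (use lc in simp)
  moreover have "filterlim (\<lambda>n. real n * ln c) at_top sequentially"
    using filterlim_tendsto_pos_mult_at_top[OF tendsto_const lc filterlim_real_sequentially]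
    by (simp add: mult.commute)
  ultimately have "eventually (\<lambda>n. (real n * ln c) ^ k / exp (real n * ln c) < (ln c / 2) ^ k) sequentially"
    by (auto simp: filterlim_iff)
  with eventually_gt_at_top[of 0] have "eventually (\<lambda>n. real (Suc n) ^ k < c ^ n) sequentially"
  proof eventually_elim
    case (elim n)
    have e: "exp (real n * ln c) = c ^ n" using assms by (simp add: exp_of_nat_mult)
    have "(real n * ln c) ^ k < (ln c / 2) ^ k * c ^ n"
      using elim(2) assms unfolding e by (simp add: pos_divide_less_eq)
    moreover have "(2 * real n) ^ k * (ln c / 2) ^ k = (real n * ln c) ^ k"
      unfolding power_mult_distrib[symmetric] by simp
    ultimately have "(ln c / 2) ^ k * (2 * real n) ^ k < (ln c / 2) ^ k * c ^ n"
      by (simp only: mult.commute)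
    then have "(2 * real n) ^ k < c ^ n" by (rule mult_left_less_imp_less) (use lc in simp)
    moreover have "real (Suc n) ^ k \<le> (2 * real n) ^ k" using elim(1) by (intro power_mono) auto
    ultimately show ?case by linarith
  qed
  then show ?thesis by (auto simp: eventually_sequentially)
qed

text \<open>
  The sets of sums $\sum_s n_s s$ with $n_s < N$ have at most $N^{|S|}$ elements. Since this is less
  than exponential growth, some two consecutive ones have nearly the same size.
\<close>

lemma Foelner_real:
  fixes S :: "real set" and d :: real
  assumes S: "finite S" and d: "d > 0"
  shows "\<exists>F. finite F \<and> F \<noteq> {} \<and> (\<forall>s\<in>S. real (card {x\<in>F. s + x \<notin> F}) \<le> d * real (card F))"
proof -
  define F where "F N = (\<lambda>n. \<Sum>s\<in>S. real (n s) * s) ` (S \<rightarrow>\<^sub>E {..<N})" for N :: nat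
  have fin: "finite (F N)" for N
    unfolding F_def using S by (intro finite_imageI finite_PiE) auto
  have card_le: "card (F N) \<le> N ^ card S" for N
  proof -
    have "card (F N) \<le> card (S \<rightarrow>\<^sub>E {..<N})"
      unfolding F_def using S by (intro card_image_le finite_PiE) auto
    then show ?thesis using S by (simp add: card_PiE)
  qed
  have mono: "F N \<subseteq> F (Suc N)" for N
    unfolding F_def by (intro image_mono PiE_mono) auto
  have shift: "s + x \<in> F (Suc N)" if sx: "s \<in> S" "x \<in> F N" for s x N
  proof -
    obtain n where n: "n \<in> S \<rightarrow>\<^sub>E {..<N}" "x = (\<Sum>s\<in>S. real (n s) * s)"
      using sx(2) by (auto simp: F_def)
    have "(\<Sum>r\<in>S. real ((n(s := Suc (n s))) r) * r) = (\<Sum>r\<in>S. real (n r) * r + (if r = s then s else 0))"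
      by (intro sum.cong) (auto simp: algebra_simps)
    also have "\<dots> = s + x"
      using sx S by (simp add: sum.distrib n(2))
    finally have "s + x = (\<Sum>r\<in>S. real ((n(s := Suc (n s))) r) * r)" ..
    moreover have "n(s := Suc (n s)) \<in> S \<rightarrow>\<^sub>E {..<Suc N}"
      using n(1) sx(1) by (auto simp: PiE_iff extensional_def intro: less_SucI)
    ultimately show ?thesis unfolding F_def by blast
  qed
  have F1: "card (F (Suc 0)) \<ge> 1"
  proof -
    have "F (Suc 0) \<noteq> {}" by (auto simp: F_def PiE_eq_empty_iff lessThan_empty_iff)
    then show ?thesis using fin by (simp add: Suc_le_eq card_gt_0_iff)
  qed
  \<comment> \<open>The index starts at $1$ because $F\,0$ is empty when $S$ is not.\<close>
  have "\<exists>N. real (card (F (Suc (Suc N)))) \<le> (1 + d) * real (card (F (Suc N)))"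
  proof (rule ccontr)
    assume "\<not> ?thesis"
    then have grow: "(1 + d) * real (card (F (Suc N))) < real (card (F (Suc (Suc N))))" for N
      by (auto simp: not_le)
    have "(1 + d) ^ N \<le> real (card (F (Suc N)))" for N
    proof (induction N)
      case (Suc N)
      have "(1 + d) ^ Suc N \<le> (1 + d) * real (card (F (Suc N)))" using Suc d by simp
      then show ?case using grow[of N] by linarith
    qed (use F1 in simp)
    moreover have "real (card (F (Suc N))) \<le> real (Suc N) ^ card S" for N
      using card_le[of "Suc N"] by (metis of_nat_le_iff of_nat_power)
    moreover obtain n where "real (Suc n) ^ card S < (1 + d) ^ n"
      using exponential_beats_polynomial[of "1 + d" "card S"] d by auto
    ultimately show False by (meson not_le order_trans)
  qed
  then obtain N where N: "real (card (F (Suc (Suc N)))) \<le> (1 + d) * real (card (F (Suc N)))" ..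
  show ?thesis
  proof (intro exI conjI ballI)
    show "finite (F (Suc N))" by (rule fin)
    show "F (Suc N) \<noteq> {}" by (auto simp: F_def PiE_eq_empty_iff lessThan_empty_iff)
    fix s assume s: "s \<in> S"
    have "card {x\<in>F (Suc N). s + x \<notin> F (Suc N)} = card ((+) s ` {x\<in>F (Suc N). s + x \<notin> F (Suc N)})"
      by (simp add: card_image)
    also have "\<dots> \<le> card (F (Suc (Suc N)) - F (Suc N))"
      using shift[OF s] by (intro card_mono) (auto simp: fin)
    also have "\<dots> = card (F (Suc (Suc N))) - card (F (Suc N))"
      by (intro card_Diff_subset fin mono)
    finally have "real (card {x\<in>F (Suc N). s + x \<notin> F (Suc N)}) \<le> real (card (F (Suc (Suc N)))) - real (card (F (Suc N)))"
      using card_mono[OF fin mono, of "Suc N"] by linarith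
    then show "real (card {x\<in>F (Suc N). s + x \<notin> F (Suc N)}) \<le> d * real (card (F (Suc N)))"
      using N by (simp add: algebra_simps)
  qed
qed

text \<open>
  Left translation by each element of \<open>S\<close> moves at most the proportion \<open>d\<close> of \<open>F\<close> outside.
\<close>

definition Foelner :: "grp set \<Rightarrow> real \<Rightarrow> grp set \<Rightarrow> bool" where
  "Foelner S d F \<longleftrightarrow> finite F \<and> F \<noteq> {} \<and>
     (\<forall>g\<in>S. real (card {h\<in>F. gmul g h \<notin> F}) \<le> d * real (card F))"

text \<open>
  In the coordinates $(e^t a, e^{-t} b, t)$, left multiplication by $(l,m,r)$ translates $t$ by $r$,
  $a$ by $e^{-r-t} l$ and $b$ by $e^{r+t} m$. So a Foelner set is a product of three Foelner sets of
  reals, the last two being chosen for the finitely many translations that occur over the first.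
\<close>

lemma Foelner_exists:
  assumes S: "finite S" and d: "d > 0"
  shows "\<exists>F. Foelner S d F"
proof -
  obtain T where T: "finite T" "T \<noteq> {}"
    "\<And>g. g \<in> S \<Longrightarrow> real (card {t\<in>T. snd (snd g) + t \<notin> T}) \<le> d / 3 * real (card T)"
    using Foelner_real[of "(\<lambda>g. snd (snd g)) ` S" "d / 3"] S d by auto
  obtain L where L: "finite L" "L \<noteq> {}"
    "\<And>g t. g \<in> S \<Longrightarrow> t \<in> T \<Longrightarrow> real (card {a\<in>L. exp (- snd (snd g) - t) * fst g + a \<notin> L}) \<le> d / 3 * real (card L)"
    using Foelner_real[of "(\<lambda>(g, t). exp (- snd (snd g) - t) * fst g) ` (S \<times> T)" "d / 3"] S d T(1) by force
  obtain K where K: "finite K" "K \<noteq> {}"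
    "\<And>g t. g \<in> S \<Longrightarrow> t \<in> T \<Longrightarrow> real (card {b\<in>K. exp (snd (snd g) + t) * fst (snd g) + b \<notin> K}) \<le> d / 3 * real (card K)"
    using Foelner_real[of "(\<lambda>(g, t). exp (snd (snd g) + t) * fst (snd g)) ` (S \<times> T)" "d / 3"] S d T(1) by force
  define c :: "real \<times> real \<times> real \<Rightarrow> grp" where "c = (\<lambda>(t, a, b). (exp t * a, exp (- t) * b, t))"
  have inj: "inj c" by (rule injI) (auto simp: c_def)
  define F where "F = c ` (T \<times> L \<times> K)"
  have cardF: "card F = card T * card L * card K"
    using inj by (simp add: F_def card_image inj_on_subset card_cartesian_product mult.assoc)
  have "real (card {h\<in>F. gmul g h \<notin> F}) \<le> d * real (card F)" if g: "g \<in> S" for g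
  proof -
    obtain l m r where g': "g = (l, m, r)" by (cases g)
    let ?T = "{t\<in>T. r + t \<notin> T}"
    let ?L = "\<lambda>t. {a\<in>L. exp (- r - t) * l + a \<notin> L}"
    let ?K = "\<lambda>t. {b\<in>K. exp (r + t) * m + b \<notin> K}"
    have "{h\<in>F. gmul g h \<notin> F} \<subseteq> c ` (?T \<times> L \<times> K \<union> (SIGMA t:T. ?L t \<times> K) \<union> (SIGMA t:T. L \<times> ?K t))"
    proof
      fix h assume h: "h \<in> {h\<in>F. gmul g h \<notin> F}"
      then obtain t a b where tab: "h = c (t, a, b)" "t \<in> T" "a \<in> L" "b \<in> K" by (auto simp: F_def)
      have "gmul g h = c (r + t, exp (- r - t) * l + a, exp (r + t) * m + b)"
        by (simp add: tab(1) c_def g' exp_add exp_diff exp_minus field_simps)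
      then have "r + t \<notin> T \<or> exp (- r - t) * l + a \<notin> L \<or> exp (r + t) * m + b \<notin> K"
        using h by (auto simp: F_def)
      then show "h \<in> c ` (?T \<times> L \<times> K \<union> (SIGMA t:T. ?L t \<times> K) \<union> (SIGMA t:T. L \<times> ?K t))"
        using tab by auto
    qed
    then have "card {h\<in>F. gmul g h \<notin> F} \<le> card (c ` (?T \<times> L \<times> K \<union> (SIGMA t:T. ?L t \<times> K) \<union> (SIGMA t:T. L \<times> ?K t)))"
      by (intro card_mono finite_imageI finite_UnI finite_SigmaI) (auto simp: T(1) L(1) K(1))
    also have "\<dots> = card (?T \<times> L \<times> K \<union> (SIGMA t:T. ?L t \<times> K) \<union> (SIGMA t:T. L \<times> ?K t))"
      by (rule card_image) (use inj in \<open>auto intro: inj_on_subset\<close>)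
    also have "\<dots> \<le> card (?T \<times> L \<times> K) + card (SIGMA t:T. ?L t \<times> K) + card (SIGMA t:T. L \<times> ?K t)"
      by (intro order_trans[OF card_Un_le] add_mono card_Un_le order_refl)
    finally have "real (card {h\<in>F. gmul g h \<notin> F}) \<le>
        real (card ?T) * (real (card L) * real (card K)) + (\<Sum>t\<in>T. real (card (?L t)) * real (card K))
          + (\<Sum>t\<in>T. real (card L) * real (card (?K t)))"
      using T(1) L(1) K(1)
      by (simp add: card_cartesian_product card_SigmaI flip: of_nat_mult of_nat_add of_nat_sum)
    also have "\<dots> \<le> (d / 3 * real (card T)) * (real (card L) * real (card K))
        + (\<Sum>t\<in>T. (d / 3 * real (card L)) * real (card K)) + (\<Sum>t\<in>T. real (card L) * (d / 3 * real (card K)))"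
      using T(3)[OF g] L(3)[OF g] K(3)[OF g]
      by (intro add_mono mult_right_mono mult_left_mono sum_mono) (auto simp: g')
    also have "\<dots> = d * real (card F)" by (simp add: cardF algebra_simps)
    finally show ?thesis .
  qed
  then have "Foelner S d F"
    using T(1,2) L(1,2) K(1,2) by (auto simp: Foelner_def F_def)
  then show ?thesis ..
qed

lemma weyl_alg_0 [simp]: "0 \<in> weyl_alg"
  using closed_subalgebra_weyl_alg by (simp add: closed_subalgebra_def)

lemma weyl_alg_sum: "(\<And>i. i \<in> F \<Longrightarrow> X i \<in> weyl_alg) \<Longrightarrow> sum X F \<in> weyl_alg"
  by (induction F rule: infinite_finite_induct) auto

lemma tr_inner_0 [simp]: "tr_inner 0 Y = 0"
  by (rule tr_inner_eqI) (simp add: cinner_zero_left)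

lemma tr_inner_sum_left:
  "(\<And>i. i \<in> F \<Longrightarrow> X i \<in> weyl_alg) \<Longrightarrow> Y \<in> weyl_alg \<Longrightarrow> tr_inner (sum X F) Y = (\<Sum>i\<in>F. tr_inner (X i) Y)"
  by (induction F rule: infinite_finite_induct) (auto simp: tr_inner_simps weyl_alg_sum)

lemma tr_inner_sum_right:
  assumes "\<And>i. i \<in> F \<Longrightarrow> X i \<in> weyl_alg" "Y \<in> weyl_alg"
  shows "tr_inner Y (sum X F) = (\<Sum>i\<in>F. tr_inner Y (X i))"
  using assms tr_inner_sum_left[of F X Y]
  by (simp add: tr_inner_commute[of Y] weyl_alg_sum)

lemma compose_sum_right: "Z o\<^sub>L sum X F = (\<Sum>i\<in>F. Z o\<^sub>L (X i :: oper))" for Z :: oper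
  by (rule bounded_bilinear.sum_right[OF bounded_bilinear_blinfun_compose])

text \<open>
  The matrix $\langle Z W(h), W(w) \rangle$ is a compression of left multiplication by $Z$ on the
  inner product space of \<open>tr_inner\<close>, and so its norm is at most that of $Z$.
\<close>

lemma matrix_bound_scalar:
  fixes x y :: "grp \<Rightarrow> complex"
  assumes Z: "Z \<in> weyl_alg" and F: "finite F"
  shows "cmod (\<Sum>h\<in>F. \<Sum>w\<in>F. tr_inner (Z o\<^sub>L W h) (W w) * (x h * cnj (y w)))
     \<le> norm Z * (((\<Sum>h\<in>F. (cmod (x h))\<^sup>2) + (\<Sum>w\<in>F. (cmod (y w))\<^sup>2)) / 2)"
proof -
  define P where "P z = (\<Sum>h\<in>F. cscale_op (z h) (W h))" for z
  have PA: "P z \<in> weyl_alg" for z unfolding P_def by (intro weyl_alg_sum) simp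
  have self: "Re (tr_inner (P z) (P z)) = (\<Sum>h\<in>F. (cmod (z h))\<^sup>2)" for z
  proof -
    have coeff: "tr_inner (P z) (W w) = z w" if "w \<in> F" for w
    proof -
      have "tr_inner (P z) (W w) = (\<Sum>h\<in>F. if h = w then z h else 0)"
        unfolding P_def by (subst tr_inner_sum_left) (auto simp: tr_inner_simps tr_inner_W_W intro!: sum.cong)
      then show ?thesis using that F by simp
    qed
    have "tr_inner (P z) (P z) = (\<Sum>w\<in>F. tr_inner (P z) (cscale_op (z w) (W w)))"
      by (subst (2) P_def, subst tr_inner_sum_right) (simp_all add: PA)
    also have "\<dots> = (\<Sum>w\<in>F. z w * cnj (z w))"
      by (intro sum.cong) (simp_all add: tr_inner_simps PA coeff)
    finally show ?thesis
      by (simp flip: complex_norm_square of_real_power)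
  qed
  have "tr_inner (Z o\<^sub>L P x) (P y) = (\<Sum>h\<in>F. tr_inner (Z o\<^sub>L cscale_op (x h) (W h)) (P y))"
    unfolding P_def[of x] compose_sum_right using Z PA by (intro tr_inner_sum_left) auto
  also have "\<dots> = (\<Sum>h\<in>F. \<Sum>w\<in>F. tr_inner (Z o\<^sub>L W h) (W w) * (x h * cnj (y w)))"
  proof (intro sum.cong refl)
    fix h
    have "tr_inner (Z o\<^sub>L cscale_op (x h) (W h)) (P y) = (\<Sum>w\<in>F. tr_inner (Z o\<^sub>L cscale_op (x h) (W h)) (cscale_op (y w) (W w)))"
      unfolding P_def using Z by (intro tr_inner_sum_right) auto
    then show "tr_inner (Z o\<^sub>L cscale_op (x h) (W h)) (P y) = (\<Sum>w\<in>F. tr_inner (Z o\<^sub>L W h) (W w) * (x h * cnj (y w)))"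
      using Z by (simp add: cscale_op_compose_right[OF weyl_alg_B[OF Z]] tr_inner_simps mult_ac)
  qed
  finally have "(\<Sum>h\<in>F. \<Sum>w\<in>F. tr_inner (Z o\<^sub>L W h) (W w) * (x h * cnj (y w))) = tr_inner (Z o\<^sub>L P x) (P y)" ..
  also have "cmod \<dots> \<le> norm Z * sqrt (Re (tr_inner (P x) (P x))) * sqrt (Re (tr_inner (P y) (P y)))"
    by (rule tr_inner_Cauchy_Schwarz[OF Z PA PA])
  also have "\<dots> = norm Z * (sqrt (Re (tr_inner (P x) (P x)) * Re (tr_inner (P y) (P y))))"
    by (simp add: real_sqrt_mult)
  also have "\<dots> \<le> norm Z * ((Re (tr_inner (P x) (P x)) + Re (tr_inner (P y) (P y))) / 2)"
    using tr_inner_self(2)[OF PA] by (intro mult_left_mono arith_geo_mean_sqrt) auto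
  finally show ?thesis by (simp add: self)
qed

lemma L2R_representative:
  obtains r where "L2_eq r r" "f = abs_L2R r"
  using Quotient_abs_rep[OF Quotient_L2R] Quotient_rep_reflp[OF Quotient_L2R] by metis

text \<open>
  The scalar bound is applied pointwise to representing functions and then integrated.
\<close>

lemma matrix_bound_vector:
  fixes u v :: "grp \<Rightarrow> L2R"
  assumes Z: "Z \<in> weyl_alg" and F: "finite F"
  shows "cmod (\<Sum>h\<in>F. \<Sum>w\<in>F. tr_inner (Z o\<^sub>L W h) (W w) * cinner_L2R (u h) (v w))
     \<le> norm Z * (((\<Sum>h\<in>F. (norm (u h))\<^sup>2) + (\<Sum>w\<in>F. (norm (v w))\<^sup>2)) / 2)"
proof -
  have "\<exists>r. L2_eq r r \<and> f = abs_L2R r" for f by (metis L2R_representative)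
  then obtain R where R: "\<And>f. L2_eq (R f) (R f)" "\<And>f. f = abs_L2R (R f)" by metis
  define x where "x h = R (u h)" for h
  define y where "y h = R (v h)" for h
  have sq: "square_integrable (x h)" "square_integrable (y h)" for h
    using R(1) by (auto simp: x_def y_def L2_eq_def)
  have ci: "cinner_L2R (u h) (v w) = (LINT s|lborel. x h s * cnj (y w s))" for h w
    using cinner_L2R.abs_eq[OF R(1) R(1), of "u h" "v w"] R(2) by (simp add: x_def y_def)
  have nn: "(norm (u h))\<^sup>2 = (LINT s|lborel. (cmod (x h s))\<^sup>2)" "(norm (v h))\<^sup>2 = (LINT s|lborel. (cmod (y h s))\<^sup>2)" for h
    using norm_L2R.abs_eq[OF R(1), of "u h"] norm_L2R.abs_eq[OF R(1), of "v h"] R(2)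
    by (simp_all add: x_def y_def)
  have int1: "integrable lborel (\<lambda>s. x h s * cnj (y w s))" for h w
    using sq by (rule square_integrable_product)
  have int2: "integrable lborel (\<lambda>s. (cmod (x h s))\<^sup>2)" "integrable lborel (\<lambda>s. (cmod (y h s))\<^sup>2)" for h
    using sq by (auto simp: square_integrable_def)
  let ?I = "\<lambda>s. \<Sum>h\<in>F. \<Sum>w\<in>F. tr_inner (Z o\<^sub>L W h) (W w) * (x h s * cnj (y w s))"
  have "(\<Sum>h\<in>F. \<Sum>w\<in>F. tr_inner (Z o\<^sub>L W h) (W w) * cinner_L2R (u h) (v w)) = (LINT s|lborel. ?I s)"
    using int1 by (simp add: ci Bochner_Integration.integral_sum)
  also have "cmod \<dots> \<le> (LINT s|lborel. cmod (?I s))"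
    by (rule integral_norm_bound)
  also have "\<dots> \<le> (LINT s|lborel. norm Z * (((\<Sum>h\<in>F. (cmod (x h s))\<^sup>2) + (\<Sum>w\<in>F. (cmod (y w s))\<^sup>2)) / 2))"
    using int1 int2 matrix_bound_scalar[OF Z F] by (intro integral_mono) auto
  also have "\<dots> = norm Z * (((\<Sum>h\<in>F. (norm (u h))\<^sup>2) + (\<Sum>w\<in>F. (norm (v w))\<^sup>2)) / 2)"
    using int2 by (simp add: nn Bochner_Integration.integral_sum)
  finally show ?thesis .
qed

text \<open>
  For $Y = W(g)$ the phases in the two factors cancel, and the mean is $\langle W(g) f, f' \rangle$
  times the proportion of \<open>F\<close> that $g$ maps into \<open>F\<close>. For an almost invariant \<open>F\<close> it therefore
  recovers $\langle Y f, f' \rangle$ from the Fourier coefficients of $Y$.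
\<close>

definition Foelner_mean :: "grp set \<Rightarrow> oper \<Rightarrow> L2R \<Rightarrow> L2R \<Rightarrow> complex" where
  "Foelner_mean F Y f f' = (\<Sum>h\<in>F. \<Sum>w\<in>F. tr_inner (Y o\<^sub>L W h) (W w) *
      cinner_L2R (W_inv h f) (W_inv w f')) / of_nat (card F)"

lemma Foelner_mean_le:
  assumes Z: "Z \<in> weyl_alg" and F: "finite F" "F \<noteq> {}"
  shows "cmod (Foelner_mean F Z f f') \<le> norm Z * (((norm f)\<^sup>2 + (norm f')\<^sup>2) / 2)"
proof -
  have c: "card F > 0" using F by (simp add: card_gt_0_iff)
  have "cmod (Foelner_mean F Z f f') * card F \<le> norm Z * (((norm f)\<^sup>2 + (norm f')\<^sup>2) / 2) * card F"
    using matrix_bound_vector[OF Z F(1), of "\<lambda>h. (W_inv h) f" "\<lambda>h. (W_inv h) f'"] c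
    by (simp add: Foelner_mean_def norm_divide field_simps)
  then show ?thesis using c by simp
qed

lemma Foelner_mean_approx:
  assumes "Y \<in> weyl_span UNIV"
  shows "\<exists>S K. finite S \<and> (\<forall>d F. Foelner S d F \<longrightarrow>
    cmod (Foelner_mean F Y f f' - cinner_L2R (Y f) f') \<le> K * d)"
  using assms
proof induction
  case (W g)
  let ?c = "cinner_L2R (W g f) f'"
  have "cmod (Foelner_mean F (W g) f f' - ?c) \<le> cmod ?c * d" if F: "Foelner {g} d F" for d F
  proof -
    have fin: "finite F" and c: "real (card F) > 0" and bad: "real (card {h\<in>F. gmul g h \<notin> F}) \<le> d * card F"
      using F by (auto simp: Foelner_def card_gt_0_iff)
    have "(\<Sum>w\<in>F. tr_inner (W g o\<^sub>L W h) (W w) *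
      cinner_L2R (W_inv h f) (W_inv w f')) = (if gmul g h \<in> F then ?c else 0)" for h
    proof -
      have "(\<Sum>w\<in>F. tr_inner (W g o\<^sub>L W h) (W w) * cinner_L2R (W_inv h f) (W_inv w f'))
        = (\<Sum>w\<in>F. if gmul g h = w then phase g h * cinner_L2R (W_inv h f) ((W_inv (gmul g h)) f') else 0)"
        by (intro sum.cong) (auto simp: W_compose tr_inner_simps tr_inner_W_W)
      also have "\<dots> = (if gmul g h \<in> F then phase g h * cinner_L2R (W_inv h f) ((W_inv (gmul g h)) f') else 0)"
        using fin by simp
      also have "phase g h * cinner_L2R (W_inv h f) ((W_inv (gmul g h)) f')
         = cinner_L2R ((cscale_op (phase g h) (W (gmul g h))) (W_inv h f)) f'"
        using is_adjoint_W[of "gmul g h"] by (simp add: is_adjoint_def cinner_cscale_left)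
      also have "\<dots> = ?c"
        unfolding W_compose[symmetric] by simp
      finally show ?thesis .
    qed
    then have "Foelner_mean F (W g) f f' - ?c = (\<Sum>h\<in>F. if gmul g h \<in> F then ?c else 0) / of_nat (card F) - ?c"
      by (simp add: Foelner_mean_def)
    also have "\<dots> = ((\<Sum>h\<in>F. if gmul g h \<in> F then ?c else 0) - (\<Sum>h\<in>F. ?c)) / of_nat (card F)"
      using c by (simp add: field_simps)
    also have "(\<Sum>h\<in>F. if gmul g h \<in> F then ?c else 0) - (\<Sum>h\<in>F. ?c) = (\<Sum>h\<in>F. if gmul g h \<notin> F then - ?c else 0)"
      unfolding sum_subtractf[symmetric] by (intro sum.cong) auto
    also have "\<dots> = of_nat (card {h\<in>F. gmul g h \<notin> F}) * - ?c"
      using fin by (simp flip: sum.inter_filter)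
    finally have "cmod (Foelner_mean F (W g) f f' - ?c) = real (card {h\<in>F. gmul g h \<notin> F}) * cmod ?c / card F"
      by (simp add: norm_mult norm_divide)
    also have "\<dots> \<le> (d * card F) * cmod ?c / card F"
      using c bad by (intro divide_right_mono mult_right_mono) auto
    finally show ?thesis using c by (simp add: mult.commute)
  qed
  then show ?case by (intro exI[of _ "{g}"] exI[of _ "cmod ?c"]) auto
next
  case (add X Y)
  then obtain S K S' K' where *: "finite S" "finite S'"
    "\<And>d F. Foelner S d F \<Longrightarrow> cmod (Foelner_mean F X f f' - cinner_L2R (X f) f') \<le> K * d"
    "\<And>d F. Foelner S' d F \<Longrightarrow> cmod (Foelner_mean F Y f f' - cinner_L2R (Y f) f') \<le> K' * d"
    by blast
  have XY: "X \<in> weyl_alg" "Y \<in> weyl_alg" using add.hyps weyl_span_subset[of UNIV] by auto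
  have "cmod (Foelner_mean F (X + Y) f f' - cinner_L2R ((X + Y) f) f') \<le> (K + K') * d"
    if F: "Foelner (S \<union> S') d F" for d F
  proof -
    have 1: "Foelner S d F" "Foelner S' d F" using F by (auto simp: Foelner_def)
    have "Foelner_mean F (X + Y) f f' = Foelner_mean F X f f' + Foelner_mean F Y f f'"
      using XY by (simp add: Foelner_mean_def compose_add_left tr_inner_simps distrib_right sum.distrib add_divide_distrib)
    then have "Foelner_mean F (X + Y) f f' - cinner_L2R ((X + Y) f) f' =
       (Foelner_mean F X f f' - cinner_L2R (X f) f') + (Foelner_mean F Y f f' - cinner_L2R (Y f) f')"
      by (simp add: blinfun.add_left cinner_add_left)
    then have "cmod (Foelner_mean F (X + Y) f f' - cinner_L2R ((X + Y) f) f') \<le>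
       cmod (Foelner_mean F X f f' - cinner_L2R (X f) f') + cmod (Foelner_mean F Y f f' - cinner_L2R (Y f) f')"
      using norm_triangle_ineq by simp
    also have "\<dots> \<le> K * d + K' * d"
      using *(3)[OF 1(1)] *(4)[OF 1(2)] by (rule add_mono)
    finally show ?thesis by (simp add: distrib_right)
  qed
  then show ?case using * by (intro exI[of _ "S \<union> S'"] exI[of _ "K + K'"]) auto
next
  case (cscale X c)
  then obtain S K where *: "finite S"
    "\<And>d F. Foelner S d F \<Longrightarrow> cmod (Foelner_mean F X f f' - cinner_L2R (X f) f') \<le> K * d"
    by blast
  have X: "X \<in> weyl_alg" using cscale.hyps weyl_span_subset[of UNIV] by auto
  have "cmod (Foelner_mean F (cscale_op c X) f f' - cinner_L2R ((cscale_op c X) f) f') \<le> (cmod c * K) * d"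
    if F: "Foelner S d F" for d F
  proof -
    have "Foelner_mean F (cscale_op c X) f f' = c * Foelner_mean F X f f'"
      using X by (simp add: Foelner_mean_def cscale_op_compose_left tr_inner_simps sum_distrib_left mult.assoc)
    then have "cmod (Foelner_mean F (cscale_op c X) f f' - cinner_L2R ((cscale_op c X) f) f')
       = cmod c * cmod (Foelner_mean F X f f' - cinner_L2R (X f) f')"
      by (simp add: cinner_cscale_left flip: right_diff_distrib norm_mult)
    then show ?thesis using mult_left_mono[OF *(2)[OF F], of "cmod c"] by (simp add: mult.assoc)
  qed
  then show ?case using *(1) by blast
qed

text \<open>
  If all coefficients of $X$ vanish, then a finite combination $Y$ near $X$ has the same Foelner means
  as $Y - X$, and these are small. The means also approximate the matrix entries of $Y$, so that $Y$
  and hence $X$ are small.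
\<close>

theorem weyl_alg_uniqueness:
  assumes X: "X \<in> weyl_alg" and zero: "\<And>g. tr_inner X (W g) = 0"
  shows "X = 0"
proof (rule blinfun_eqI)
  fix f
  have coeff: "tr_inner (X o\<^sub>L W h) (W w) = 0" for h w
    using X by (simp add: tr_inner_right_W_shift W_inv_def cscale_op_compose_right W_compose tr_inner_simps zero)
  have "cinner_L2R (X f) f' = 0" for f'
  proof (rule eq_zero_approx)
    fix e :: real assume e: "e > 0"
    obtain Y where Y: "Y \<in> weyl_span UNIV" "norm (X - Y) < e" using weyl_alg_approx[OF X e] .
    have YA: "Y \<in> weyl_alg" using Y weyl_span_subset by auto
    obtain S K where SK: "finite S" "\<And>d F. Foelner S d F \<Longrightarrow>
      cmod (Foelner_mean F Y f f' - cinner_L2R (Y f) f') \<le> K * d"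
      using Foelner_mean_approx[OF Y(1)] by blast
    have "cmod (cinner_L2R (Y f) f') \<le> e * (((norm f)\<^sup>2 + (norm f')\<^sup>2) / 2)"
    proof (rule field_le_epsilon)
      fix r :: real assume r: "r > 0"
      define d where "d = r / (\<bar>K\<bar> + 1)"
      have d: "d > 0" using r by (simp add: d_def add_nonneg_pos)
      have Kd: "K * d \<le> r"
      proof -
        have "K * d \<le> (\<bar>K\<bar> + 1) * d" using d by (intro mult_right_mono) auto
        also have "\<dots> = r" by (simp add: d_def add_nonneg_pos)
        finally show ?thesis .
      qed
      obtain F where F: "Foelner S d F" using Foelner_exists[OF SK(1) d] by blast
      then have F': "finite F" "F \<noteq> {}" by (auto simp: Foelner_def)
      have "Foelner_mean F Y f f' = Foelner_mean F (Y - X) f f'"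
        using X YA by (simp add: Foelner_mean_def compose_diff_left tr_inner_simps coeff)
      then have "cmod (Foelner_mean F Y f f') \<le> norm (Y - X) * (((norm f)\<^sup>2 + (norm f')\<^sup>2) / 2)"
        using Foelner_mean_le[OF _ F', of "Y - X" f f'] X YA by simp
      also have "\<dots> \<le> e * (((norm f)\<^sup>2 + (norm f')\<^sup>2) / 2)"
        using Y(2) by (intro mult_right_mono) (auto simp: norm_minus_commute)
      finally show "cmod (cinner_L2R (Y f) f') \<le> e * (((norm f)\<^sup>2 + (norm f')\<^sup>2) / 2) + r"
        using SK(2)[OF F] Kd norm_triangle_ineq2[of "cinner_L2R (Y f) f'" "Foelner_mean F Y f f'"]
        by (simp add: norm_minus_commute)
    qed
    moreover have "cmod (cinner_L2R ((X - Y) f) f') \<le> e * (norm f * norm f')"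
    proof -
      have "cmod (cinner_L2R ((X - Y) f) f') \<le> (norm (X - Y) * norm f) * norm f'"
        by (intro order_trans[OF cinner_Cauchy_Schwarz] mult_right_mono norm_blinfun) simp
      also have "\<dots> \<le> (e * norm f) * norm f'"
        using Y(2) by (intro mult_right_mono) auto
      finally show ?thesis by (simp add: mult.assoc)
    qed
    moreover have "cinner_L2R (X f) f' =
        cinner_L2R (Y f) f' + cinner_L2R ((X - Y) f) f'"
      by (simp add: blinfun.diff_left cinner_diff_left)
    ultimately show "cmod (cinner_L2R (X f) f') \<le>
        (((norm f)\<^sup>2 + (norm f')\<^sup>2) / 2 + norm f * norm f') * e"
      using norm_triangle_ineq[of "cinner_L2R (Y f) f'" "cinner_L2R ((X - Y) f) f'"]
      unfolding distrib_right by (simp only: mult.commute[of e])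
  qed
  from this[of "X f"] show "X f = (0 :: oper) f"
    by (simp add: cinner_self)
qed

section \<open>The triple semigroup algebra and conjugation by dilations\<close>

definition Pos :: "grp set" where
  "Pos = {(l, m, t). 0 \<le> l \<and> 0 \<le> m \<and> 0 \<le> t}"

lemma Pos_iff [simp]: "(l, m, t) \<in> Pos \<longleftrightarrow> 0 \<le> l \<and> 0 \<le> m \<and> 0 \<le> t"
  by (simp add: Pos_def)

lemma Pos_gmul: "g \<in> Pos \<Longrightarrow> h \<in> Pos \<Longrightarrow> gmul g h \<in> Pos"
  by (cases g; cases h) simp

lemma closed_subalgebra_A_ph: "closed_subalgebra A_ph"
proof -
  let ?G = "mult_op ` {0..} \<union> transl_op ` {0..} \<union> dil_op ` {0..}"
  have "B_L2R \<in> {S. closed_subalgebra S \<and> ?G \<subseteq> S}"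
    using closed_subalgebra_B_L2R generators_in_B_L2R by auto
  then have "A_ph \<subseteq> B_L2R" "closed A_ph"
    unfolding A_ph_def generated_algebra_def closed_subalgebra_def
    by (blast, intro closed_Inter, blast)
  then show ?thesis
    unfolding closed_subalgebra_def A_ph_def generated_algebra_def by blast
qed

lemma A_ph_generators:
  "l \<ge> 0 \<Longrightarrow> mult_op l \<in> A_ph" "m \<ge> 0 \<Longrightarrow> transl_op m \<in> A_ph" "t \<ge> 0 \<Longrightarrow> dil_op t \<in> A_ph"
  unfolding A_ph_def generated_algebra_def by auto

lemma A_ph_add [simp]: "X \<in> A_ph \<Longrightarrow> Y \<in> A_ph \<Longrightarrow> X + Y \<in> A_ph"
  and A_ph_cscale [simp]: "X \<in> A_ph \<Longrightarrow> cscale_op c X \<in> A_ph"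
  and A_ph_compose [simp]: "X \<in> A_ph \<Longrightarrow> Y \<in> A_ph \<Longrightarrow> X o\<^sub>L Y \<in> A_ph"
  using closed_subalgebra_A_ph by (auto simp: closed_subalgebra_def)

lemma A_ph_W: "g \<in> Pos \<Longrightarrow> W g \<in> A_ph"
  by (cases g) (simp add: W_def A_ph_generators)

lemma weyl_span_A_ph: "X \<in> weyl_span Pos \<Longrightarrow> X \<in> A_ph"
  by (induction rule: weyl_span.induct) (auto intro: A_ph_W)

lemma A_ph_minimal:
  assumes "closed_subalgebra S" and "\<And>l. l \<ge> 0 \<Longrightarrow> W (l, 0, 0) \<in> S"
    and "\<And>m. m \<ge> 0 \<Longrightarrow> W (0, m, 0) \<in> S" and "\<And>t. t \<ge> 0 \<Longrightarrow> W (0, 0, t) \<in> S"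
  shows "A_ph \<subseteq> S"
  unfolding A_ph_def generated_algebra_def using assms
  by (intro Inter_lower) (auto simp: mult_op_W transl_op_W dil_op_W)

lemma A_ph_subset: "A_ph \<subseteq> closure (weyl_span Pos)"
proof (rule A_ph_minimal)
  have "(0, 0, 0) \<in> Pos" by simp
  then show "closed_subalgebra (closure (weyl_span Pos))"
    by (intro closed_subalgebra_closure_weyl_span) (auto intro: Pos_gmul simp del: Pos_iff)
qed (auto intro!: subsetD[OF closure_subset] weyl_span.intros)

lemma A_ph_weyl_alg [simp]: "X \<in> A_ph \<Longrightarrow> X \<in> weyl_alg"
  using A_ph_subset closure_mono[OF weyl_span_mono[of Pos UNIV]] by (auto simp: weyl_alg_def)

lemma A_ph_coeff_zero:
  assumes X: "X \<in> A_ph" and g: "g \<notin> Pos"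
  shows "tr_inner X (W g) = 0"
proof (rule eq_zero_approx)
  fix e :: real assume "e > 0"
  moreover have "X \<in> closure (weyl_span Pos)" using X A_ph_subset by blast
  ultimately obtain Y where Y: "Y \<in> weyl_span Pos" "norm (X - Y) < e"
    unfolding closure_approachable dist_norm by (metis norm_minus_commute)
  have YA: "Y \<in> weyl_alg" using Y weyl_span_subset by auto
  have "tr_inner Y (W g) = 0" using Y(1)
  proof induction
    case (W h)
    then show ?case using g by (auto simp: tr_inner_W_W)
  next
    case (add X Y)
    then show ?case using weyl_span_subset[of Pos] by (auto simp: tr_inner_simps subset_iff)
  next
    case (cscale X c)
    then show ?case using weyl_span_subset[of Pos] by (auto simp: tr_inner_simps subset_iff)
  qed
  then have "cmod (tr_inner X (W g)) = cmod (tr_inner (X - Y) (W g))"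
    using X YA by (simp add: tr_inner_simps)
  also have "\<dots> \<le> norm (X - Y) * norm (W g)" using X YA by (intro tr_inner_le) auto
  also have "\<dots> \<le> norm (W g) * e"
    using Y(2) mult_left_mono[of "norm (X - Y)" e "norm (W g)"] by (simp add: mult.commute)
  finally show "cmod (tr_inner X (W g)) \<le> norm (W g) * e" .
qed

text \<open>
  The octant is an Ore semigroup: a finite set of group elements is moved into it by multiplication
  with one of its elements. Hence isometry of multiplication on polynomials in $A$ extends to all
  finite combinations of the $W(g)$.
\<close>

lemma weyl_span_shift_right:
  assumes "X \<in> weyl_span UNIV"
  shows "\<exists>p\<in>Pos. X o\<^sub>L W p \<in> weyl_span Pos"
proof -
  have "\<exists>r\<ge>0. \<forall>a\<ge>r. X o\<^sub>L W (a, a, a) \<in> weyl_span Pos"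
    using assms
  proof induction
    case (W g)
    obtain l m t where g: "g = (l, m, t)" by (cases g)
    define r where "r = max (exp (- t) * \<bar>l\<bar>) (max (exp t * \<bar>m\<bar>) \<bar>t\<bar>)"
    have "W g o\<^sub>L W (a, a, a) \<in> weyl_span Pos" if a: "a \<ge> r" for a
    proof -
      have "exp t * (exp (- t) * \<bar>l\<bar>) \<le> exp t * a" "exp (- t) * (exp t * \<bar>m\<bar>) \<le> exp (- t) * a"
        using a by (auto simp: r_def intro!: mult_left_mono)
      then have "\<bar>l\<bar> \<le> exp t * a" "\<bar>m\<bar> \<le> exp (- t) * a"
        by (simp_all flip: mult.assoc exp_add)
      then have "gmul g (a, a, a) \<in> Pos" using a by (auto simp: g r_def)
      then show ?thesis by (simp add: W_compose weyl_span.intros)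
    qed
    then show ?case by (intro exI[of _ r]) (auto simp: r_def)
  next
    case (add X Y)
    then obtain r s where "r \<ge> 0" "s \<ge> 0" "\<forall>a\<ge>r. X o\<^sub>L W (a, a, a) \<in> weyl_span Pos"
      "\<forall>a\<ge>s. Y o\<^sub>L W (a, a, a) \<in> weyl_span Pos" by blast
    then show ?case
      by (intro exI[of _ "max r s"]) (auto simp: compose_add_left intro!: weyl_span.intros)
  next
    case (cscale X c)
    then show ?case by (auto simp: cscale_op_compose_left intro!: weyl_span.intros)
  qed
  then obtain r where "r \<ge> 0" "\<forall>a\<ge>r. X o\<^sub>L W (a, a, a) \<in> weyl_span Pos" by blast
  then show ?thesis by (intro bexI[of _ "(r, r, r)"]) auto
qed

text \<open>
  Multiplying $(l,m,t)$ from the left by $(a,a,b)$ gives $(a + e^b l, a + e^{-b} m, b + t)$, so that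
  $b$ has to be fixed before $a$ is chosen large.
\<close>

lemma weyl_span_shift_left:
  assumes "X \<in> weyl_span UNIV"
  shows "\<exists>p\<in>Pos. W p o\<^sub>L X \<in> weyl_span Pos"
proof -
  have "\<exists>r\<ge>0. \<forall>b\<ge>r. \<exists>s\<ge>0. \<forall>a\<ge>s. W (a, a, b) o\<^sub>L X \<in> weyl_span Pos"
    using assms
  proof induction
    case (W g)
    obtain l m t where g: "g = (l, m, t)" by (cases g)
    have "W (a, a, b) o\<^sub>L W g \<in> weyl_span Pos" if b: "b \<ge> \<bar>t\<bar>" and a: "a \<ge> max (exp b * \<bar>l\<bar>) (exp (- b) * \<bar>m\<bar>)" for a b
    proof -
      have "\<bar>exp b * l\<bar> \<le> a" "\<bar>exp (- b) * m\<bar> \<le> a" using a by (simp_all add: abs_mult)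
      then have "gmul (a, a, b) g \<in> Pos" using b by (auto simp: g)
      then show ?thesis by (simp add: W_compose weyl_span.intros)
    qed
    then show ?case
      by (intro exI[of _ "\<bar>t\<bar>"] conjI allI impI exI[of _ "max (exp _ * \<bar>l\<bar>) (exp (- _) * \<bar>m\<bar>)"])
        (auto simp: le_max_iff_disj)
  next
    case (add X Y)
    then obtain r s where rs: "r \<ge> 0" "s \<ge> 0" "\<forall>b\<ge>r. \<exists>s\<ge>0. \<forall>a\<ge>s. W (a, a, b) o\<^sub>L X \<in> weyl_span Pos"
      "\<forall>b\<ge>s. \<exists>s\<ge>0. \<forall>a\<ge>s. W (a, a, b) o\<^sub>L Y \<in> weyl_span Pos" by blast
    have "\<exists>s\<ge>0. \<forall>a\<ge>s. W (a, a, b) o\<^sub>L (X + Y) \<in> weyl_span Pos" if "b \<ge> max r s" for b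
    proof -
      have "b \<ge> r" "b \<ge> s" using that by auto
      then obtain u v where "u \<ge> 0" "v \<ge> 0" "\<forall>a\<ge>u. W (a, a, b) o\<^sub>L X \<in> weyl_span Pos"
        "\<forall>a\<ge>v. W (a, a, b) o\<^sub>L Y \<in> weyl_span Pos" using rs by meson
      then show ?thesis
        by (intro exI[of _ "max u v"]) (auto simp: compose_add_right intro!: weyl_span.intros)
    qed
    then show ?case using rs by (intro exI[of _ "max r s"]) auto
  next
    case (cscale X c)
    then obtain r where r: "r \<ge> 0" "\<forall>b\<ge>r. \<exists>s\<ge>0. \<forall>a\<ge>s. W (a, a, b) o\<^sub>L X \<in> weyl_span Pos" by blast
    then show ?case
      by (intro exI[of _ r]) (auto simp: cscale_op_compose_right intro!: weyl_span.intros; meson weyl_span.intros)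
  qed
  then obtain r s where "r \<ge> 0" "s \<ge> 0" "\<forall>a\<ge>s. W (a, a, r) o\<^sub>L X \<in> weyl_span Pos" by blast
  then show ?thesis by (intro bexI[of _ "(s, s, r)"]) auto
qed

lemma left_isometric_extend:
  fixes U :: oper
  assumes "\<And>X. X \<in> weyl_span Pos \<Longrightarrow> norm (U o\<^sub>L X) = norm X" and X: "X \<in> weyl_span UNIV"
  shows "norm (U o\<^sub>L X) = norm X"
proof -
  obtain p where p: "X o\<^sub>L W p \<in> weyl_span Pos" using weyl_span_shift_right[OF X] by blast
  have "norm (U o\<^sub>L X) = norm (U o\<^sub>L X o\<^sub>L W p)" by simp
  also have "\<dots> = norm (U o\<^sub>L (X o\<^sub>L W p))" by (simp only: compose_assoc)
  also have "\<dots> = norm X" using assms(1)[OF p] by simp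
  finally show ?thesis .
qed

lemma right_isometric_extend:
  fixes U :: oper
  assumes "\<And>X. X \<in> weyl_span Pos \<Longrightarrow> norm (X o\<^sub>L U) = norm X" and X: "X \<in> weyl_span UNIV"
  shows "norm (X o\<^sub>L U) = norm X"
proof -
  obtain p where p: "W p o\<^sub>L X \<in> weyl_span Pos" using weyl_span_shift_left[OF X] by blast
  have "norm (X o\<^sub>L U) = norm (W p o\<^sub>L X o\<^sub>L U)" by (simp only: compose_assoc norm_compose_W)
  also have "\<dots> = norm X" using assms(1)[OF p] by simp
  finally show ?thesis .
qed

lemma weyl_span_0: "g \<in> Q \<Longrightarrow> 0 \<in> weyl_span Q"
  using weyl_span.cscale[OF weyl_span.W, of g Q 0] cscale_op_of_real[of 0 "W g"] by simp

lemma weyl_span_split: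
  assumes "Y \<in> weyl_span UNIV" and "g0 \<in> Q" and "h0 \<notin> Q"
  shows "\<exists>A\<in>weyl_span Q. \<exists>R\<in>weyl_span (- Q). Y = A + R"
  using assms(1)
proof induction
  case (W g)
  show ?case
  proof (cases "g \<in> Q")
    case True
    then show ?thesis using weyl_span_0[of h0 "- Q"] assms
      by (intro bexI[of _ "W g"] bexI[of _ 0]) (auto intro: weyl_span.intros)
  next
    case False
    then show ?thesis using weyl_span_0[of g0 Q] assms
      by (intro bexI[of _ 0] bexI[of _ "W g"]) (auto intro: weyl_span.intros)
  qed
next
  case (add X Y)
  then obtain A R A' R' where "A \<in> weyl_span Q" "R \<in> weyl_span (- Q)" "X = A + R"
    "A' \<in> weyl_span Q" "R' \<in> weyl_span (- Q)" "Y = A' + R'" by blast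
  then show ?case
    by (intro bexI[of _ "A + A'"] bexI[of _ "R + R'"]) (auto intro: weyl_span.intros)
next
  case (cscale X c)
  then obtain A R where "A \<in> weyl_span Q" "R \<in> weyl_span (- Q)" "X = A + R" by blast
  then show ?case
    by (intro bexI[of _ "cscale_op c A"] bexI[of _ "cscale_op c R"])
      (auto intro: weyl_span.intros simp: cscale_op_add)
qed

lemma tr_inner_disjoint:
  assumes "A \<in> weyl_span Q" "R \<in> weyl_span (- Q)"
  shows "tr_inner A R = 0"
  using assms(1)
proof induction
  case (W g)
  show ?case using assms(2)
  proof induction
    case (W h)
    then show ?case using \<open>g \<in> Q\<close> by (auto simp: tr_inner_W_W)
  next
    case (add X Y)
    then show ?case using weyl_span_subset[of "- Q"] by (auto simp: tr_inner_simps subset_iff)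
  next
    case (cscale X c)
    then show ?case using weyl_span_subset[of "- Q"] by (auto simp: tr_inner_simps subset_iff)
  qed
next
  case (add X Y)
  moreover have "R \<in> weyl_alg" using assms(2) weyl_span_subset by auto
  ultimately show ?case using weyl_span_subset[of Q] by (auto simp: tr_inner_simps subset_iff)
next
  case (cscale X c)
  moreover have "R \<in> weyl_alg" using assms(2) weyl_span_subset by auto
  ultimately show ?case using weyl_span_subset[of Q] by (auto simp: tr_inner_simps subset_iff)
qed

abbreviation conj_W :: "grp \<Rightarrow> oper \<Rightarrow> oper" where
  "conj_W q X \<equiv> W q o\<^sub>L X o\<^sub>L W_inv q"

lemma norm_conj_W: "norm (conj_W q X) = norm X"
  by (simp only: norm_compose_W(1,4))

lemma conj_W_add: "conj_W q (X + Y) = conj_W q X + conj_W q Y"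
  by (simp add: compose_add_left compose_add_right)

lemma conj_W_diff: "conj_W q (X - Y) = conj_W q X - conj_W q Y"
  by (simp add: compose_diff_left compose_diff_right)

lemma conj_W_cscale: "conj_W q (cscale_op c X) = cscale_op c (conj_W q X)"
  by (simp add: cscale_op_compose_left cscale_op_compose_right)

lemma conj_dilation: "conj_W (0, 0, s) (W (l, m, t)) = W (exp s * l, exp (- s) * m, t)"
  by (simp add: W_compose W_inv_def cscale_op_compose_left cscale_op_compose_right cscale_op_cscale_op)

definition dilations :: "grp set" where "dilations = {(0, 0, t) | t. True}"

lemma conj_dilation_fixed: "A \<in> weyl_span dilations \<Longrightarrow> conj_W (0, 0, s) A = A"
proof (induction rule: weyl_span.induct)
  case (W g)
  then show ?case by (auto simp: dilations_def conj_dilation)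
next
  case (add X Y)
  then show ?case by (simp only: conj_W_add)
next
  case (cscale X c)
  then show ?case by (simp only: conj_W_cscale)
qed

lemma exp_nat_times_eventually_neq:
  fixes c l h :: real
  assumes "l \<noteq> 0" "c \<noteq> 0"
  shows "eventually (\<lambda>n. exp (c * real n) * l \<noteq> h) sequentially"
proof (cases "\<exists>n0. exp (c * real n0) * l = h")
  case True
  then obtain n0 where n0: "exp (c * real n0) * l = h" ..
  show ?thesis
    using eventually_gt_at_top[of n0]
    by eventually_elim (use assms in \<open>auto simp flip: n0\<close>)
qed simp

text \<open>
  Conjugation with $V_n$ sends $W(l,m,t)$ to $W(e^n l, e^{-n} m, t)$. If $(l,m) \ne (0,0)$ this leaves
  every finite set, whereas the $V_t$ are fixed.
\<close>

lemma conj_dilation_tendsto_0: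
  assumes R: "R \<in> weyl_span (- dilations)" and Y: "Y \<in> weyl_alg"
  shows "(\<lambda>n. tr_inner Y (conj_W (0, 0, real n) R)) \<longlonglongrightarrow> 0"
  using R
proof induction
  case (W g)
  obtain l m t where g: "g = (l, m, t)" by (cases g)
  have lm: "l \<noteq> 0 \<or> m \<noteq> 0" using W by (auto simp: g dilations_def)
  show ?case
  proof (rule weyl_alg_tendsto[OF _ _ _ _ _ _ _ Y, where L = "\<lambda>Y. 0" and \<sigma> = "\<lambda>c. c" and K = "norm (W g)" and K' = 0
        and \<phi> = "\<lambda>n Y. tr_inner Y (conj_W (0, 0, real n) (W g))"])
    fix h :: grp
    have "eventually (\<lambda>n. h \<noteq> (exp (real n) * l, exp (- real n) * m, t)) sequentially"
    proof (cases "l = 0")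
      case False
      from exp_nat_times_eventually_neq[OF False one_neq_zero, of "fst h"] show ?thesis
        by eventually_elim auto
    next
      case True
      then have "m \<noteq> 0" using lm by simp
      then have "eventually (\<lambda>n. exp (- 1 * real n) * m \<noteq> fst (snd h)) sequentially"
        by (intro exp_nat_times_eventually_neq) auto
      then show ?thesis
        by eventually_elim auto
    qed
    then have "eventually (\<lambda>n. tr_inner (W h) (conj_W (0, 0, real n) (W g)) = 0) sequentially"
      by eventually_elim (simp only: g conj_dilation tr_inner_W_W if_False)
    then show "(\<lambda>n. tr_inner (W h) (conj_W (0, 0, real n) (W g))) \<longlonglongrightarrow> 0" by (rule tendsto_eventually)
  next
    show "cmod (tr_inner Y (conj_W (0, 0, real n) (W g))) \<le> norm (W g) * norm Y" if "Y \<in> weyl_alg" for n Y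
      using tr_inner_le[OF that, of "conj_W (0, 0, real n) (W g)"] unfolding norm_conj_W by (simp add: mult.commute)
  qed (simp_all add: tr_inner_simps)
next
  case (add X1 X2)
  have A: "X1 \<in> weyl_alg" "X2 \<in> weyl_alg" using add.hyps weyl_span_subset[of "- dilations"] by auto
  have "tr_inner Y (conj_W (0, 0, real n) (X1 + X2)) = tr_inner Y (conj_W (0, 0, real n) X1) + tr_inner Y (conj_W (0, 0, real n) X2)" for n
    unfolding conj_W_add using A Y by (simp add: tr_inner_simps)
  then show ?case using tendsto_add[OF add.IH] by simp
next
  case (cscale X c)
  have A: "X \<in> weyl_alg" using cscale.hyps weyl_span_subset[of "- dilations"] by auto
  have "tr_inner Y (conj_W (0, 0, real n) (cscale_op c X)) = cnj c * tr_inner Y (conj_W (0, 0, real n) X)" for n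
    unfolding conj_W_cscale using A Y by (simp add: tr_inner_simps)
  then show ?case using tendsto_mult_right_zero[OF cscale.IH] by simp
qed

lemma tr_inner_id_id: "tr_inner id_blinfun id_blinfun = 1"
  using tr_inner_W_W[of "(0,0,0)" "(0,0,0)"] by (simp add: W_one)

text \<open>
  In the limit the inner product of $X$ with $V_n X V_n^*$ is $\sum_t |\hat X(0,0,t)|^2$, which
  dominates $|\hat X(0,0,0)|^2$.
\<close>

lemma coefficient_zero_by_dilation:
  assumes X: "X \<in> weyl_alg"
    and orth: "\<And>n. n > 0 \<Longrightarrow> tr_inner X (conj_W (0, 0, real n) X) = 0"
  shows "tr_inner X id_blinfun = 0"
proof -
  have "(cmod (tr_inner X id_blinfun))\<^sup>2 = 0"
  proof (rule eq_zero_approx)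
    fix e :: real assume e: "0 < e" "e < 1"
    obtain Y where Y: "Y \<in> weyl_span UNIV" "norm (X - Y) < e" using weyl_alg_approx[OF X e(1)] .
    have YA: "Y \<in> weyl_alg" using Y weyl_span_subset by auto
    have "(0, 0, 0) \<in> dilations" "(1, 0, 0) \<notin> dilations" by (auto simp: dilations_def)
    from weyl_span_split[OF Y(1) this]
    obtain A R where AR: "A \<in> weyl_span dilations" "R \<in> weyl_span (- dilations)" "Y = A + R" by blast
    have A: "A \<in> weyl_alg" and R: "R \<in> weyl_alg" using AR weyl_span_subset by auto
    have id: "id_blinfun \<in> weyl_span dilations"
      using weyl_span.W[OF \<open>(0, 0, 0) \<in> dilations\<close>] by (simp add: W_one)
    have RA: "tr_inner R A = 0" "tr_inner R id_blinfun = 0"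
      using tr_inner_disjoint[OF AR(1,2)] tr_inner_disjoint[OF id AR(2)] A R
      by (simp_all add: tr_inner_commute[of R])
    have nY: "norm Y \<le> norm X + 1"
      using norm_triangle_ineq2[of Y X] Y(2) e by (simp add: norm_minus_commute)
    have "tr_inner Y (conj_W (0, 0, real n) Y) = tr_inner A A + tr_inner Y (conj_W (0, 0, real n) R)" for n
    proof -
      have "conj_W (0, 0, real n) Y = A + conj_W (0, 0, real n) R"
        by (simp only: AR(3) conj_W_add conj_dilation_fixed[OF AR(1)])
      moreover have "tr_inner Y A = tr_inner A A" using RA A R by (simp add: AR(3) tr_inner_simps)
      ultimately show ?thesis using A R YA by (simp add: tr_inner_simps)
    qed
    then have "(\<lambda>n. tr_inner Y (conj_W (0, 0, real n) Y)) \<longlonglongrightarrow> tr_inner A A + 0"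
      using tendsto_add[OF tendsto_const conj_dilation_tendsto_0[OF AR(2) YA], of "tr_inner A A"] by (simp only:)
    then have lim: "(\<lambda>n. cmod (tr_inner Y (conj_W (0, 0, real n) Y))) \<longlonglongrightarrow> cmod (tr_inner A A)"
      by (simp add: tendsto_norm)
    have bound: "cmod (tr_inner Y (conj_W (0, 0, real n) Y)) \<le> e * (2 * norm X + 1)" if n: "n > 0" for n
    proof -
      have "tr_inner Y (conj_W (0, 0, real n) Y) =
         - (tr_inner (X - Y) (conj_W (0, 0, real n) X) + tr_inner Y (conj_W (0, 0, real n) (X - Y)))"
        unfolding conj_W_diff using X YA orth[OF n] by (simp add: tr_inner_simps)
      also have "cmod \<dots> \<le> norm (X - Y) * norm (conj_W (0, 0, real n) X) + norm Y * norm (conj_W (0, 0, real n) (X - Y))"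
        unfolding norm_minus_cancel using X YA
        by (intro order_trans[OF norm_triangle_ineq] add_mono tr_inner_le) auto
      also have "\<dots> \<le> e * norm X + (norm X + 1) * e"
        unfolding norm_conj_W using Y(2) nY e by (intro add_mono mult_mono) auto
      finally show ?thesis by (simp add: algebra_simps)
    qed
    have AA: "cmod (tr_inner A A) \<le> e * (2 * norm X + 1)"
      by (rule Lim_bounded[OF lim, of 1]) (use bound in simp)
    have "cmod (tr_inner (id_blinfun o\<^sub>L A) id_blinfun) \<le> norm (id_blinfun :: oper) * sqrt (Re (tr_inner A A)) * sqrt (Re (tr_inner id_blinfun id_blinfun))"
      using A by (intro tr_inner_Cauchy_Schwarz) auto
    also have "\<dots> \<le> 1 * sqrt (Re (tr_inner A A))"
      using mult_right_mono[OF norm_id_le, of "sqrt (Re (tr_inner A A))"] tr_inner_self(2)[OF A]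
      by (simp add: tr_inner_id_id)
    finally have "(cmod (tr_inner A id_blinfun))\<^sup>2 \<le> (sqrt (Re (tr_inner A A)))\<^sup>2"
      by (intro power_mono) auto
    also have "\<dots> \<le> e * (2 * norm X + 1)"
      using tr_inner_self(2)[OF A] AA abs_Re_le_cmod[of "tr_inner A A"] by simp
    finally have Aid: "(cmod (tr_inner A id_blinfun))\<^sup>2 \<le> e * (2 * norm X + 1)" .
    have "tr_inner X id_blinfun = tr_inner A id_blinfun + tr_inner (X - Y) id_blinfun"
      using X A R YA RA by (simp add: AR(3) tr_inner_simps)
    moreover have XY: "cmod (tr_inner (X - Y) id_blinfun) \<le> e"
    proof -
      have "cmod (tr_inner (X - Y) id_blinfun) \<le> norm (X - Y) * norm (id_blinfun :: oper)"
        using X YA by (intro tr_inner_le) auto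
      also have "\<dots> \<le> norm (X - Y) * 1" using norm_id_le by (intro mult_left_mono) auto
      finally show ?thesis using Y(2) by simp
    qed
    ultimately have "(cmod (tr_inner X id_blinfun))\<^sup>2 \<le> (cmod (tr_inner A id_blinfun) + e)\<^sup>2"
      using norm_triangle_ineq[of "tr_inner A id_blinfun" "tr_inner (X - Y) id_blinfun"]
      by (intro power_mono) auto
    also have "\<dots> \<le> 2 * (cmod (tr_inner A id_blinfun))\<^sup>2 + 2 * e\<^sup>2"
      using sum_squares_bound[of "cmod (tr_inner A id_blinfun)" e] by (simp add: power2_sum)
    also have "\<dots> \<le> 2 * (e * (2 * norm X + 1)) + 2 * e"
      using Aid e by (intro add_mono mult_left_mono) (auto simp: power2_eq_square mult_le_cancel_left)
    finally show "norm ((cmod (tr_inner X id_blinfun))\<^sup>2) \<le> (4 * norm X + 4) * e"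
      by (simp add: algebra_simps)
  qed
  then show ?thesis by simp
qed

section \<open>Normal elements\<close>

lemma norm_cis_minus_1_sequence:
  assumes "x \<noteq> 0"
  shows "eventually (\<lambda>n. \<bar>x\<bar> / (2 * real n) \<le> cmod (cis (x / real n) - 1)) sequentially"
proof -
  have d: "((\<lambda>z. exp (\<i> * z)) has_field_derivative \<i>) (at 0)"
    by (auto intro!: derivative_eq_intros)
  then have lim: "((\<lambda>h. (exp (\<i> * h) - 1) / h) \<longlongrightarrow> \<i>) (at 0)"
    by (simp add: has_field_derivative_iff)
  have "filterlim (\<lambda>n. complex_of_real (x / real n)) (at 0) sequentially"
  proof (rule filterlim_atI)
    have "(\<lambda>n. complex_of_real (x * (1 / real n))) \<longlonglongrightarrow> complex_of_real (x * 0)"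
      by (intro tendsto_of_real tendsto_mult tendsto_const lim_1_over_n)
    then show "(\<lambda>n. complex_of_real (x / real n)) \<longlonglongrightarrow> 0" by simp
    show "eventually (\<lambda>n. complex_of_real (x / real n) \<noteq> 0) sequentially"
      using eventually_gt_at_top[of 0] by eventually_elim (use assms in auto)
  qed
  from filterlim_compose[OF lim this]
  have "(\<lambda>n. cmod ((exp (\<i> * complex_of_real (x / real n)) - 1) / complex_of_real (x / real n))) \<longlonglongrightarrow> 1"
    using tendsto_norm by fastforce
  then have "eventually (\<lambda>n. 1 / 2 < cmod ((exp (\<i> * complex_of_real (x / real n)) - 1) / complex_of_real (x / real n))) sequentially"
    by (rule order_tendstoD) simp
  then show ?thesis
    using eventually_gt_at_top[of 0]
  proof eventually_elim
    case (elim n)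
    have "1 / 2 < cmod (cis (x / real n) - 1) / \<bar>x / real n\<bar>"
      using elim(1) by (simp add: cis_conv_exp norm_divide norm_mult)
    then have "1 / 2 * \<bar>x / real n\<bar> < cmod (cis (x / real n) - 1)"
      using elim(2) assms by (simp add: pos_less_divide_eq del: abs_divide)
    then show ?case by simp
  qed
qed

lemma geometric_mean_cis_tendsto_0:
  assumes "x \<noteq> 0"
  shows "(\<lambda>n. (\<Sum>j<n\<^sup>2. cis (x / real n) ^ j) / of_nat (n\<^sup>2)) \<longlonglongrightarrow> 0"
proof (rule Lim_null_comparison)
  show "(\<lambda>n. 4 / \<bar>x\<bar> * (1 / real n)) \<longlonglongrightarrow> 0"
    using tendsto_mult_right_zero[OF lim_1_over_n, of "4 / \<bar>x\<bar>"] by simp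
  show "eventually (\<lambda>n. cmod ((\<Sum>j<n\<^sup>2. cis (x / real n) ^ j) / of_nat (n\<^sup>2)) \<le> 4 / \<bar>x\<bar> * (1 / real n)) sequentially"
    using norm_cis_minus_1_sequence[OF assms] eventually_gt_at_top[of 0]
  proof eventually_elim
    case (elim n)
    define z where "z = cis (x / real n)"
    have p: "0 < \<bar>x\<bar> / (2 * real n)" using assms elim(2) by simp
    have z: "z \<noteq> 1" using elim p by (auto simp: z_def)
    have "cmod (\<Sum>j<n\<^sup>2. z ^ j) = cmod (z ^ n\<^sup>2 - 1) / cmod (z - 1)"
      using z by (simp add: geometric_sum norm_divide)
    also have "\<dots> \<le> 2 / (\<bar>x\<bar> / (2 * real n))"
    proof (rule frac_le)
      have "cmod (z ^ n\<^sup>2 - 1) \<le> cmod (z ^ n\<^sup>2) + cmod 1" by (rule norm_triangle_ineq4)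
      then show "cmod (z ^ n\<^sup>2 - 1) \<le> 2" by (simp add: z_def norm_power)
    qed (use elim(1) p in \<open>auto simp: z_def\<close>)
    finally have "cmod (\<Sum>j<n\<^sup>2. z ^ j) / real (n\<^sup>2) \<le> 2 / (\<bar>x\<bar> / (2 * real n)) / real (n\<^sup>2)"
      by (intro divide_right_mono) auto
    also have "\<dots> = 4 / \<bar>x\<bar> * (1 / real n)"
      using elim(2) by (simp add: power2_eq_square field_simps)
    finally show ?case by (simp add: z_def norm_divide norm_power)
  qed
qed

lemma conj_W_plane:
  "conj_W (a, b, 0) (W (l, m, 0)) = cscale_op (cis (a * m - b * l)) (W (l, m, 0))"
  by (simp add: W_compose W_inv_def cscale_op_compose_left cscale_op_compose_right cscale_op_cscale_op cis_mult cis_cnj)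
    (simp add: algebra_simps)

lemma conj_W_general:
  "\<exists>c. cmod c = 1 \<and> conj_W (a, b, 0) (W (l, m, t)) =
     cscale_op c (W (l + a * (1 - exp t), m + b * (1 - exp (- t)), t))"
proof -
  define c where "c = cnj (phase (a, b, 0) (ginv (a, b, 0))) * (phase (a, b, 0) (l, m, t) *
     phase (gmul (a, b, 0) (l, m, t)) (ginv (a, b, 0)))"
  have "conj_W (a, b, 0) (W (l, m, t)) = cscale_op c (W (gmul (gmul (a, b, 0) (l, m, t)) (ginv (a, b, 0))))"
    by (simp only: W_compose W_inv_def cscale_op_compose_left cscale_op_compose_right[OF W_in_B] cscale_op_cscale_op c_def
        cscale_op_compose_right[OF weyl_alg_B[OF weyl_alg_cscale[OF weyl_alg_W]]] mult_ac)
  also have "gmul (gmul (a, b, 0) (l, m, t)) (ginv (a, b, 0)) = (l + a * (1 - exp t), m + b * (1 - exp (- t)), t)"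
    by (simp add: algebra_simps)
  finally show ?thesis
    by (intro exI[of _ c] conjI) (simp only: c_def norm_mult cmod_phase complex_mod_cnj)
qed

text \<open>
  The mean of $\langle X, w Y w^* \rangle$ over the $n^2$ equally spaced points $w = W(as, bs, 0)$,
  $s = j/n$. Both the spacing tends to $0$ and the range of $s$ to infinity, so that the mean of each
  nontrivial character of $s$ tends to $0$ and a single sequence serves all frequencies.
\<close>

definition plane_mean :: "real \<Rightarrow> real \<Rightarrow> oper \<Rightarrow> oper \<Rightarrow> nat \<Rightarrow> complex" where
  "plane_mean a b X Y n = (\<Sum>j<n\<^sup>2. tr_inner X (conj_W (a * (real j / real n), b * (real j / real n), 0) Y)) / of_nat (n\<^sup>2)"

lemma plane_mean_add_left: "X \<in> weyl_alg \<Longrightarrow> X' \<in> weyl_alg \<Longrightarrow> Y \<in> weyl_alg \<Longrightarrow>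
    plane_mean a b (X + X') Y n = plane_mean a b X Y n + plane_mean a b X' Y n"
  by (simp add: plane_mean_def tr_inner_simps sum.distrib add_divide_distrib)

lemma plane_mean_cscale_left: "X \<in> weyl_alg \<Longrightarrow> Y \<in> weyl_alg \<Longrightarrow>
    plane_mean a b (cscale_op c X) Y n = c * plane_mean a b X Y n"
  by (simp add: plane_mean_def tr_inner_simps sum_distrib_left)

lemma plane_mean_add_right: "X \<in> weyl_alg \<Longrightarrow> Y \<in> weyl_alg \<Longrightarrow> Y' \<in> weyl_alg \<Longrightarrow>
    plane_mean a b X (Y + Y') n = plane_mean a b X Y n + plane_mean a b X Y' n"
  unfolding plane_mean_def conj_W_add by (simp add: tr_inner_simps sum.distrib add_divide_distrib)

lemma plane_mean_cscale_right: "X \<in> weyl_alg \<Longrightarrow> Y \<in> weyl_alg \<Longrightarrow>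
    plane_mean a b X (cscale_op c Y) n = cnj c * plane_mean a b X Y n"
  unfolding plane_mean_def conj_W_cscale by (simp add: tr_inner_simps sum_distrib_left)

lemma plane_mean_le:
  assumes "X \<in> weyl_alg" "Y \<in> weyl_alg"
  shows "cmod (plane_mean a b X Y n) \<le> norm X * norm Y"
proof (cases "n = 0")
  case False
  have t: "cmod (tr_inner X (conj_W g Y)) \<le> norm X * norm Y" for g
    using tr_inner_le[of X "conj_W g Y"] assms unfolding norm_conj_W by simp
  have "cmod (\<Sum>j<n\<^sup>2. tr_inner X (conj_W (a * (real j / real n), b * (real j / real n), 0) Y))
    \<le> (\<Sum>j<n\<^sup>2. norm X * norm Y)"
    by (intro order_trans[OF norm_sum] sum_mono t)
  also have "\<dots> = real (n\<^sup>2) * (norm X * norm Y)" by simp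
  finally show ?thesis
    using False by (simp add: plane_mean_def norm_divide norm_power divide_le_eq mult.commute)
qed (simp add: plane_mean_def)

text \<open>
  For $t \ne 0$ the conjugates of $W(l,m,t)$ belong to pairwise different group elements, of which at
  most one can be correlated with a given $W(k)$.
\<close>

lemma plane_mean_dilated_tendsto_0:
  assumes t: "t \<noteq> 0" and ab: "(a, b) \<noteq> (0, 0)" and X: "X \<in> weyl_alg"
  shows "plane_mean a b X (W (l, m, t)) \<longlonglongrightarrow> 0"
proof (rule weyl_alg_tendsto[OF _ _ _ _ _ _ _ X, where \<phi> = "\<lambda>n X. plane_mean a b X (W (l, m, t)) n" and L = "\<lambda>X. 0"
      and \<sigma> = "\<lambda>c. c" and K = "norm (W (l, m, t))" and K' = 0])
  fix k :: grp
  have et: "1 - exp t \<noteq> 0" "1 - exp (- t) \<noteq> 0" using t by auto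
  have "cmod (plane_mean a b (W k) (W (l, m, t)) n) \<le> 1 / real n" if n: "n > 0" for n
  proof -
    define h where "h j = (l + a * (real j / real n) * (1 - exp t), m + b * (real j / real n) * (1 - exp (- t)), t)" for j
    have "\<exists>c. cmod c = 1 \<and> conj_W (a * (real j / real n), b * (real j / real n), 0) (W (l, m, t)) = cscale_op c (W (h j))" for j
      using conj_W_general unfolding h_def by blast
    then obtain c where c: "\<And>j. cmod (c j) = 1"
      "\<And>j. conj_W (a * (real j / real n), b * (real j / real n), 0) (W (l, m, t)) = cscale_op (c j) (W (h j))" by metis
    have inj: "h i = h j \<Longrightarrow> i = j" for i j
      using ab et n by (auto simp: h_def)
    have "cmod (\<Sum>j<n\<^sup>2. tr_inner (W k) (conj_W (a * (real j / real n), b * (real j / real n), 0) (W (l, m, t))))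
      \<le> (\<Sum>j<n\<^sup>2. if h j = k then 1 else 0)"
      unfolding c(2) by (intro order_trans[OF norm_sum] sum_mono) (simp add: tr_inner_simps tr_inner_W_W norm_mult c(1))
    also have "\<dots> = real (card {j\<in>{..<n\<^sup>2}. h j = k})"
      by (simp flip: sum.inter_filter)
    also have "\<dots> \<le> 1"
    proof -
      have "card {j\<in>{..<n\<^sup>2}. h j = k} \<le> Suc 0"
        by (subst card_le_Suc0_iff_eq) (auto intro!: inj)
      then show ?thesis by simp
    qed
    finally have "cmod (plane_mean a b (W k) (W (l, m, t)) n) \<le> 1 / real (n\<^sup>2)"
      unfolding plane_mean_def norm_divide by (simp add: divide_right_mono norm_power)
    also have "\<dots> \<le> 1 / real n"
      using n by (intro divide_left_mono) (auto simp: power2_eq_square)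
    finally show ?thesis .
  qed
  then have "eventually (\<lambda>n. norm (plane_mean a b (W k) (W (l, m, t)) n) \<le> 1 / real n) sequentially"
    by (rule eventually_mono[OF eventually_gt_at_top])
  then show "plane_mean a b (W k) (W (l, m, t)) \<longlonglongrightarrow> 0"
    by (rule Lim_null_comparison) (rule lim_1_over_n)
next
  show "cmod (plane_mean a b X (W (l, m, t)) n) \<le> norm (W (l, m, t)) * norm X" if "X \<in> weyl_alg" for n X
    using plane_mean_le[OF that weyl_alg_W] by (simp add: mult.commute)
qed (simp_all add: plane_mean_add_left plane_mean_cscale_left)

text \<open>
  Conjugation multiplies $W(l,m,0)$ by the character $e^{is(am - bl)}$ of $s$. It is constant only on
  the line $am = bl$, where by hypothesis $X$ has no coefficient besides that of the identity.
\<close>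

lemma plane_mean_tendsto:
  assumes ab: "(a, b) \<noteq> (0, 0)" and X: "X \<in> weyl_alg"
    and orth: "\<And>l m. (l, m) \<noteq> (0, 0) \<Longrightarrow> a * m = b * l \<Longrightarrow> tr_inner X (W (l, m, 0)) = 0"
    and Y: "Y \<in> weyl_alg"
  shows "plane_mean a b X Y \<longlonglongrightarrow> tr_inner X id_blinfun * cnj (tr_inner Y id_blinfun)"
proof (rule weyl_alg_tendsto[OF _ _ _ _ _ _ _ Y, where \<phi> = "\<lambda>n Y. plane_mean a b X Y n" and \<sigma> = cnj and K = "norm X"
      and L = "\<lambda>Y. tr_inner X id_blinfun * cnj (tr_inner Y id_blinfun)" and K' = "cmod (tr_inner X id_blinfun)"])
  fix g :: grp
  obtain l m t where g: "g = (l, m, t)" by (cases g)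
  have tr: "tr_inner (W g) id_blinfun = (if g = (0, 0, 0) then 1 else 0)"
    using tr_inner_W_W[of g "(0, 0, 0)"] by (simp add: W_one)
  show "plane_mean a b X (W g) \<longlonglongrightarrow> tr_inner X id_blinfun * cnj (tr_inner (W g) id_blinfun)"
  proof (cases "t = 0")
    case False
    then show ?thesis
      using plane_mean_dilated_tendsto_0[OF False ab X, of l m] tr by (simp add: g)
  next
    case True
    define x where "x = b * l - a * m"
    have eq: "plane_mean a b X (W g) n = tr_inner X (W g) * ((\<Sum>j<n\<^sup>2. cis (x / real n) ^ j) / of_nat (n\<^sup>2))" for n
    proof -
      have "tr_inner X (conj_W (a * (real j / real n), b * (real j / real n), 0) (W g)) = tr_inner X (W g) * cis (x / real n) ^ j" for j
      proof -
        have "tr_inner X (conj_W (a * (real j / real n), b * (real j / real n), 0) (W g)) =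
            cnj (cis (a * (real j / real n) * m - b * (real j / real n) * l)) * tr_inner X (W g)"
          unfolding g True conj_W_plane using X by (simp add: tr_inner_simps)
        also have "cnj (cis (a * (real j / real n) * m - b * (real j / real n) * l)) = cis (x / real n) ^ j"
          unfolding Complex.DeMoivre cis_cnj by (rule arg_cong[of _ _ cis]) (simp add: x_def divide_inverse algebra_simps)
        finally show ?thesis by simp
      qed
      then show ?thesis by (simp add: plane_mean_def sum_distrib_left)
    qed
    show ?thesis
    proof (cases "x = 0")
      case False
      then have "g \<noteq> (0, 0, 0)" by (auto simp: g x_def)
      then show ?thesis
        using tendsto_mult_right_zero[OF geometric_mean_cis_tendsto_0[OF False], of "tr_inner X (W g)"]
        by (simp add: eq[abs_def] tr)
    next
      case x: True
      have "eventually (\<lambda>n. plane_mean a b X (W g) n = tr_inner X (W g)) sequentially"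
        using eventually_gt_at_top[of 0] by eventually_elim (simp add: eq x)
      moreover have "tr_inner X (W g) = tr_inner X id_blinfun * cnj (tr_inner (W g) id_blinfun)"
      proof (cases "g = (0, 0, 0)")
        case True
        then show ?thesis by (simp add: W_one tr_inner_id_id)
      next
        case False
        then have "tr_inner X (W (l, m, 0)) = 0" using True x by (intro orth) (auto simp: g x_def)
        then show ?thesis using False True by (simp add: tr) (simp add: g)
      qed
      ultimately show ?thesis by (simp add: tendsto_eventually)
    qed
  qed
next
  show "cmod (tr_inner X id_blinfun * cnj (tr_inner Y id_blinfun)) \<le> cmod (tr_inner X id_blinfun) * norm Y" if "Y \<in> weyl_alg" for Y
    using tr_inner_le[OF that weyl_alg_id] mult_left_mono[OF norm_id_le, of "norm Y"]
    by (simp add: norm_mult mult_left_mono)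
  show "cmod (plane_mean a b X Y n) \<le> norm X * norm Y" if "Y \<in> weyl_alg" for n Y
    using X that by (rule plane_mean_le)
qed (use X in \<open>simp_all add: plane_mean_add_right plane_mean_cscale_right tr_inner_simps distrib_left mult_ac\<close>)

lemma coefficient_zero_by_averaging:
  assumes "(a, b) \<noteq> (0, 0)" and "X \<in> weyl_alg" "Y \<in> weyl_alg"
    and "\<And>l m. (l, m) \<noteq> (0, 0) \<Longrightarrow> a * m = b * l \<Longrightarrow> tr_inner X (W (l, m, 0)) = 0"
    and orth: "\<And>s. s \<ge> 0 \<Longrightarrow> tr_inner X (conj_W (a * s, b * s, 0) Y) = 0"
  shows "tr_inner X id_blinfun = 0 \<or> tr_inner Y id_blinfun = 0"
proof -
  have "tr_inner X (conj_W (a * (real j / real n), b * (real j / real n), 0) Y) = 0" for j n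
    by (rule orth) simp
  then have "plane_mean a b X Y = (\<lambda>n. 0)"
    by (intro ext) (simp only: plane_mean_def sum.neutral_const div_0)
  then have "(\<lambda>n. 0) \<longlonglongrightarrow> tr_inner X id_blinfun * cnj (tr_inner Y id_blinfun)"
    using plane_mean_tendsto[OF assms(1,2,4,3)] by simp
  then have "tr_inner X id_blinfun * cnj (tr_inner Y id_blinfun) = 0"
    using LIMSEQ_unique tendsto_const by metis
  then show ?thesis by simp
qed

lemma W_W_W_inv: "\<exists>c. W g o\<^sub>L W h o\<^sub>L W_inv k = cscale_op c (W (gmul (gmul g h) (ginv k)))"
  by (auto simp: W_inv_def W_compose cscale_op_compose_left cscale_op_compose_right cscale_op_cscale_op)

lemma W_inv_W_W: "\<exists>c. W_inv k o\<^sub>L W g o\<^sub>L W h = cscale_op c (W (gmul (gmul (ginv k) g) h))"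
  by (auto simp: W_inv_def W_compose cscale_op_compose_left cscale_op_compose_right cscale_op_cscale_op)

lemma W_neq_0: "W g \<noteq> 0"
proof
  assume "W g = 0"
  then have "norm (W g (chirp 1)) = 0" by simp
  then show False by (simp add: norm_chirp)
qed

lemma single_coefficient:
  assumes U: "U \<in> A_ph" and iso: "\<And>X. X \<in> weyl_span UNIV \<Longrightarrow> norm (U o\<^sub>L X) = norm X"
    and single: "\<And>p q. tr_inner U (W p) \<noteq> 0 \<Longrightarrow> tr_inner U (W q) \<noteq> 0 \<Longrightarrow> p = q"
  shows "\<exists>c p. cmod c = 1 \<and> tr_inner U (W p) \<noteq> 0 \<and> U = cscale_op c (W p)"
proof -
  have nU: "norm U = norm (id_blinfun :: oper)" using iso[OF weyl_span_id] by simp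
  have nid: "norm (id_blinfun :: oper) > 0" using W_neq_0[of "(0,0,0)"] by (simp add: W_one)
  have "\<exists>p. tr_inner U (W p) \<noteq> 0"
  proof (rule ccontr)
    assume "\<not> ?thesis"
    then have "U = 0" using U by (intro weyl_alg_uniqueness) auto
    then show False using nU nid by simp
  qed
  then obtain p where p: "tr_inner U (W p) \<noteq> 0" ..
  define c where "c = tr_inner U (W p)"
  have "U - cscale_op c (W p) = 0"
  proof (rule weyl_alg_uniqueness)
    show "U - cscale_op c (W p) \<in> weyl_alg" using U by simp
    show "tr_inner (U - cscale_op c (W p)) (W g) = 0" for g
      using U single[OF p, of g] by (auto simp: tr_inner_simps tr_inner_W_W c_def)
  qed
  then have eq: "U = cscale_op c (W p)" by simp
  have "norm (W p) = norm (id_blinfun :: oper)"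
    using norm_compose_W(1)[of p id_blinfun] by (simp del: norm_compose_W)
  then have "cmod c * norm (id_blinfun :: oper) = norm (id_blinfun :: oper)"
    using nU eq by (simp add: norm_cscale_op)
  then have "cmod c = 1" using nid by simp
  then show ?thesis using eq p by blast
qed

text \<open>
  The support of $U$ is first moved into $l = 0$ by means of $q = V_n$. Two points $(0, m_i, t_i)$ of
  the support are compared in the lexicographic order of $(t, m)$: for the smaller one as $p_1$,
  $p_1 q p_2^{-1} \notin P$ for all $q = M_s$, and averaging over $s$ gives a contradiction.
\<close>

theorem right_normal_classification:
  assumes U: "U \<in> A_ph"
    and isoL: "\<And>X. X \<in> weyl_span Pos \<Longrightarrow> norm (U o\<^sub>L X) = norm X"
    and isoR: "\<And>X. X \<in> weyl_span Pos \<Longrightarrow> norm (X o\<^sub>L U) = norm X"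
    and normal: "\<And>q. q \<in> Pos \<Longrightarrow> \<exists>X\<in>A_ph. U o\<^sub>L W q = X o\<^sub>L U"
  shows "\<exists>c m t. cmod c = 1 \<and> m \<ge> 0 \<and> t \<ge> 0 \<and> U = cscale_op c (W (0, m, t))"
proof -
  note isoL' = left_isometric_extend[OF isoL] and isoR' = right_isometric_extend[OF isoR]
  have UA: "U \<in> weyl_alg" using U by simp
  have key: "tr_inner (W_inv p1 o\<^sub>L U) (conj_W q (W_inv p2 o\<^sub>L U)) = 0"
    if q: "q \<in> Pos" and g: "gmul (gmul p1 q) (ginv p2) \<notin> Pos" for p1 p2 q
  proof -
    obtain X where X: "X \<in> A_ph" "U o\<^sub>L W q = X o\<^sub>L U" using normal[OF q] by blast
    obtain c where c: "W p1 o\<^sub>L W q o\<^sub>L W_inv p2 = cscale_op c (W (gmul (gmul p1 q) (ginv p2)))"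
      using W_W_W_inv by blast
    have "tr_inner (W_inv p1 o\<^sub>L U) (conj_W q (W_inv p2 o\<^sub>L U)) = tr_inner (W_inv p1 o\<^sub>L U o\<^sub>L W q) (W q o\<^sub>L (W_inv p2 o\<^sub>L U))"
      using UA by (intro tr_inner_right_W_shift[symmetric]) auto
    also have "\<dots> = tr_inner (U o\<^sub>L W q) (W p1 o\<^sub>L (W q o\<^sub>L (W_inv p2 o\<^sub>L U)))"
      unfolding compose_assoc[of "W_inv p1"] by (rule tr_inner_left_W_inv_shift)
    also have "W p1 o\<^sub>L (W q o\<^sub>L (W_inv p2 o\<^sub>L U)) = cscale_op c (W (gmul (gmul p1 q) (ginv p2))) o\<^sub>L U"
      unfolding c[symmetric] by (simp only: compose_assoc)
    also have "tr_inner (U o\<^sub>L W q) (cscale_op c (W (gmul (gmul p1 q) (ginv p2))) o\<^sub>L U)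
        = tr_inner X (cscale_op c (W (gmul (gmul p1 q) (ginv p2))))"
      unfolding X(2) using X(1) by (intro tr_inner_right_isometric[OF UA isoR']) auto
    also have "\<dots> = 0"
      using X(1) A_ph_coeff_zero[OF X(1) g] by (simp add: tr_inner_simps)
    finally show ?thesis .
  qed
  have coeff: "tr_inner (W_inv p o\<^sub>L U) id_blinfun = tr_inner U (W p)" for p
    unfolding tr_inner_left_W_inv_shift by simp
  have l0: "l = 0" if nz: "tr_inner U (W (l, m, t)) \<noteq> 0" for l m t
  proof (rule ccontr)
    assume "l \<noteq> 0"
    moreover have "(l, m, t) \<in> Pos" using nz A_ph_coeff_zero[OF U] by blast
    ultimately have l: "l > 0" by simp
    have "tr_inner (W_inv (l, m, t) o\<^sub>L U) id_blinfun = 0"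
    proof (rule coefficient_zero_by_dilation)
      show "W_inv (l, m, t) o\<^sub>L U \<in> weyl_alg" using UA by simp
      show "tr_inner (W_inv (l, m, t) o\<^sub>L U) (conj_W (0, 0, real n) (W_inv (l, m, t) o\<^sub>L U)) = 0" if "n > 0" for n
      proof (rule key)
        show "(0, 0, real n) \<in> Pos" by simp
        \<comment> \<open>The first coordinate of $p V_n p^{-1}$ is $l (1 - e^n)$.\<close>
        have "l * 1 < l * exp (real n)" using l that by (intro mult_strict_left_mono) auto
        then have "l - exp (t + real n) * (exp (- t) * l) < 0"
          by (simp add: exp_add exp_minus field_simps)
        then show "gmul (gmul (l, m, t) (0, 0, real n)) (ginv (l, m, t)) \<notin> Pos" by simp
      qed
    qed
    then show False using nz coeff by simp
  qed
  have ordered: "\<not> (t1 < t2 \<or> t1 = t2 \<and> m1 < m2)"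
    if nz: "tr_inner U (W (0, m1, t1)) \<noteq> 0" "tr_inner U (W (0, m2, t2)) \<noteq> 0" for m1 t1 m2 t2
  proof
    assume less: "t1 < t2 \<or> t1 = t2 \<and> m1 < m2"
    have "tr_inner (W_inv (0, m1, t1) o\<^sub>L U) id_blinfun = 0 \<or> tr_inner (W_inv (0, m2, t2) o\<^sub>L U) id_blinfun = 0"
    proof (rule coefficient_zero_by_averaging[where a = 1 and b = 0])
      show "tr_inner (W_inv (0, m1, t1) o\<^sub>L U) (W (l, m, 0)) = 0" if "(l, m) \<noteq> (0, 0)" "1 * m = 0 * l" for l m :: real
      proof -
        have "tr_inner U (W (exp t1 * l, m1, t1)) = 0" using l0[of "exp t1 * l" m1 t1] that by auto
        then show ?thesis
          unfolding tr_inner_left_W_inv_shift W_compose using UA that by (simp add: tr_inner_simps)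
      qed
      show "tr_inner (W_inv (0, m1, t1) o\<^sub>L U) (conj_W (1 * s, 0 * s, 0) (W_inv (0, m2, t2) o\<^sub>L U)) = 0" if s: "s \<ge> 0" for s
      proof (rule key)
        show "(1 * s, 0 * s, 0) \<in> Pos" using s by simp
        show "gmul (gmul (0, m1, t1) (1 * s, 0 * s, 0)) (ginv (0, m2, t2)) \<notin> Pos"
          using less by (auto simp flip: mult.assoc exp_add)
      qed
    qed (use UA in auto)
    then show False using nz coeff by simp
  qed
  have "\<exists>c p. cmod c = 1 \<and> tr_inner U (W p) \<noteq> 0 \<and> U = cscale_op c (W p)"
  proof (rule single_coefficient[OF U isoL'])
    fix p q assume nz: "tr_inner U (W p) \<noteq> 0" "tr_inner U (W q) \<noteq> 0"
    obtain l1 m1 t1 l2 m2 t2 where pq: "p = (l1, m1, t1)" "q = (l2, m2, t2)" by (cases p; cases q)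
    have "l1 = 0" "l2 = 0" using nz l0 by (auto simp: pq)
    then show "p = q"
      using nz ordered[of m1 t1 m2 t2] ordered[of m2 t2 m1 t1] by (auto simp: pq)
  qed
  then obtain c p where c: "cmod c = 1" "tr_inner U (W p) \<noteq> 0" "U = cscale_op c (W p)" by blast
  obtain l m t where p: "p = (l, m, t)" by (cases p)
  have "l = 0" using l0 c(2) by (simp add: p)
  moreover have "p \<in> Pos" using A_ph_coeff_zero[OF U] c(2) by blast
  ultimately have "l = 0" "(l, m, t) \<in> Pos" by (simp_all add: p)
  then show ?thesis using c by (intro exI[of _ c] exI[of _ m] exI[of _ t]) (simp add: p)
qed

text \<open>
  Here the roles of left and right and of $M$ and $D$ are exchanged: the support is moved into $m = 0$,
  and the averages run over $q = D_s$.
\<close>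

theorem left_normal_classification:
  assumes U: "U \<in> A_ph"
    and isoL: "\<And>X. X \<in> weyl_span Pos \<Longrightarrow> norm (U o\<^sub>L X) = norm X"
    and normal: "\<And>q. q \<in> Pos \<Longrightarrow> \<exists>X\<in>A_ph. W q o\<^sub>L U = U o\<^sub>L X"
  shows "\<exists>c l t. cmod c = 1 \<and> l \<ge> 0 \<and> t \<ge> 0 \<and> U = cscale_op c (W (l, 0, t))"
proof -
  note isoL' = left_isometric_extend[OF isoL]
  have UA: "U \<in> weyl_alg" using U by simp
  have key: "tr_inner (U o\<^sub>L W_inv p2) (conj_W q (U o\<^sub>L W_inv p1)) = 0"
    if q: "q \<in> Pos" and g: "gmul (gmul (ginv p2) q) p1 \<notin> Pos" for p1 p2 q
  proof -
    obtain X where X: "X \<in> A_ph" "W q o\<^sub>L U = U o\<^sub>L X" using normal[OF q] by blast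
    obtain c where c: "W_inv p2 o\<^sub>L W q o\<^sub>L W p1 = cscale_op c (W (gmul (gmul (ginv p2) q) p1))"
      using W_inv_W_W by blast
    have "tr_inner (U o\<^sub>L W_inv p2) (conj_W q (U o\<^sub>L W_inv p1)) = tr_inner (U o\<^sub>L W_inv p2 o\<^sub>L W q) (W q o\<^sub>L U o\<^sub>L W_inv p1)"
      using UA by (subst tr_inner_right_W_shift) (auto simp: compose_assoc)
    also have "\<dots> = tr_inner (U o\<^sub>L W_inv p2 o\<^sub>L W q o\<^sub>L W p1) (W q o\<^sub>L U)"
      using UA by (intro tr_inner_right_W_shift[symmetric]) auto
    also have "U o\<^sub>L W_inv p2 o\<^sub>L W q o\<^sub>L W p1 = U o\<^sub>L cscale_op c (W (gmul (gmul (ginv p2) q) p1))"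
      unfolding c[symmetric] by (simp only: compose_assoc)
    also have "tr_inner (U o\<^sub>L cscale_op c (W (gmul (gmul (ginv p2) q) p1))) (W q o\<^sub>L U)
        = tr_inner (cscale_op c (W (gmul (gmul (ginv p2) q) p1))) X"
      unfolding X(2) using X(1) by (intro tr_inner_left_isometric[OF UA isoL']) auto
    also have "\<dots> = cnj (tr_inner X (cscale_op c (W (gmul (gmul (ginv p2) q) p1))))"
      using X(1) by (intro tr_inner_commute) auto
    also have "\<dots> = 0"
      using X(1) A_ph_coeff_zero[OF X(1) g] by (simp add: tr_inner_simps)
    finally show ?thesis .
  qed
  have right: "tr_inner (U o\<^sub>L W_inv p) Z = tr_inner U (Z o\<^sub>L W p)" if "Z \<in> weyl_alg" for p Z
    using tr_inner_right_W[of "U o\<^sub>L W_inv p" Z p] UA that by simp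
  have coeff: "tr_inner (U o\<^sub>L W_inv p) id_blinfun = tr_inner U (W p)" for p
    by (simp add: right)
  have m0: "m = 0" if nz: "tr_inner U (W (l, m, t)) \<noteq> 0" for l m t
  proof (rule ccontr)
    assume "m \<noteq> 0"
    moreover have "(l, m, t) \<in> Pos" using nz A_ph_coeff_zero[OF U] by blast
    ultimately have m: "m > 0" by simp
    have "tr_inner (U o\<^sub>L W_inv (l, m, t)) id_blinfun = 0"
    proof (rule coefficient_zero_by_dilation)
      show "U o\<^sub>L W_inv (l, m, t) \<in> weyl_alg" using UA by simp
      show "tr_inner (U o\<^sub>L W_inv (l, m, t)) (conj_W (0, 0, real n) (U o\<^sub>L W_inv (l, m, t))) = 0" if "n > 0" for n
      proof (rule key)
        show "(0, 0, real n) \<in> Pos" by simp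
        \<comment> \<open>The second coordinate of $p^{-1} V_n p$ is $e^t m (e^{-n} - 1)$.\<close>
        have "exp (t - real n) * m < exp t * m" using m that by (intro mult_strict_right_mono) auto
        then have "\<not> exp t * m \<le> exp (t - real n) * m" by simp
        then show "gmul (gmul (ginv (l, m, t)) (0, 0, real n)) (l, m, t) \<notin> Pos" by simp
      qed
    qed
    then show False using nz coeff by simp
  qed
  have ordered: "\<not> (t1 < t2 \<or> t1 = t2 \<and> l1 < l2)"
    if nz: "tr_inner U (W (l1, 0, t1)) \<noteq> 0" "tr_inner U (W (l2, 0, t2)) \<noteq> 0" for l1 t1 l2 t2
  proof
    assume less: "t1 < t2 \<or> t1 = t2 \<and> l1 < l2"
    have "tr_inner (U o\<^sub>L W_inv (l2, 0, t2)) id_blinfun = 0 \<or> tr_inner (U o\<^sub>L W_inv (l1, 0, t1)) id_blinfun = 0"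
    proof (rule coefficient_zero_by_averaging[where a = 0 and b = 1])
      show "tr_inner (U o\<^sub>L W_inv (l2, 0, t2)) (W (l, m, 0)) = 0" if "(l, m) \<noteq> (0, 0)" "0 * m = 1 * l" for l m :: real
      proof -
        have "tr_inner U (W (l2, m, t2)) = 0" using m0[of l2 m t2] that by auto
        then show ?thesis
          unfolding right[OF weyl_alg_W] W_compose using UA that by (simp add: tr_inner_simps)
      qed
      show "tr_inner (U o\<^sub>L W_inv (l2, 0, t2)) (conj_W (0 * s, 1 * s, 0) (U o\<^sub>L W_inv (l1, 0, t1))) = 0" if s: "s \<ge> 0" for s
      proof (rule key)
        show "(0 * s, 1 * s, 0) \<in> Pos" using s by simp
        show "gmul (gmul (ginv (l2, 0, t2)) (0 * s, 1 * s, 0)) (l1, 0, t1) \<notin> Pos"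
          using less by (auto simp flip: mult.assoc exp_add)
      qed
    qed (use UA in auto)
    then show False using nz coeff by simp
  qed
  have "\<exists>c p. cmod c = 1 \<and> tr_inner U (W p) \<noteq> 0 \<and> U = cscale_op c (W p)"
  proof (rule single_coefficient[OF U isoL'])
    fix p q assume nz: "tr_inner U (W p) \<noteq> 0" "tr_inner U (W q) \<noteq> 0"
    obtain l1 m1 t1 l2 m2 t2 where pq: "p = (l1, m1, t1)" "q = (l2, m2, t2)" by (cases p; cases q)
    have "m1 = 0" "m2 = 0" using nz m0 by (auto simp: pq)
    then show "p = q"
      using nz ordered[of l1 t1 l2 t2] ordered[of l2 t2 l1 t1] by (auto simp: pq)
  qed
  then obtain c p where c: "cmod c = 1" "tr_inner U (W p) \<noteq> 0" "U = cscale_op c (W p)" by blast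
  obtain l m t where p: "p = (l, m, t)" by (cases p)
  have "m = 0" using m0 c(2) by (simp add: p)
  moreover have "p \<in> Pos" using A_ph_coeff_zero[OF U] c(2) by blast
  ultimately have "m = 0" "(l, m, t) \<in> Pos" by (simp_all add: p)
  then show ?thesis using c by (intro exI[of _ c] exI[of _ l] exI[of _ t]) (simp add: p)
qed

section \<open>Automorphisms and chirality\<close>

text \<open>
  The operators that are carried into $A$ by $X \mapsto P X Q$ form a closed subalgebra, because
  $QP = 1$ makes this map multiplicative.
\<close>

lemma conjugation_into_A_ph:
  assumes QP: "Q o\<^sub>L P = id_blinfun" and B: "P \<in> B_L2R" "Q \<in> B_L2R"
    and gen: "\<And>l. l \<ge> 0 \<Longrightarrow> P o\<^sub>L W (l, 0, 0) o\<^sub>L Q \<in> A_ph" "\<And>m. m \<ge> 0 \<Longrightarrow> P o\<^sub>L W (0, m, 0) o\<^sub>L Q \<in> A_ph"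
      "\<And>t. t \<ge> 0 \<Longrightarrow> P o\<^sub>L W (0, 0, t) o\<^sub>L Q \<in> A_ph"
    and X: "X \<in> A_ph"
  shows "P o\<^sub>L X o\<^sub>L Q \<in> A_ph"
proof -
  define S where "S = {X \<in> B_L2R. P o\<^sub>L X o\<^sub>L Q \<in> A_ph}"
  have "closed_subalgebra S"
    unfolding closed_subalgebra_def
  proof (intro conjI ballI allI)
    have "closed ((\<lambda>X. P o\<^sub>L X o\<^sub>L Q) -` A_ph)"
      using closed_subalgebra_A_ph
      by (intro continuous_closed_vimage continuous_intros) (auto simp: closed_subalgebra_def)
    then show "closed S"
      using closed_subalgebra_B_L2R unfolding S_def Collect_conj_eq
      by (intro closed_Int) (auto simp: closed_subalgebra_def vimage_def)
    show "0 \<in> S" using closed_subalgebra_B_L2R closed_subalgebra_A_ph by (simp add: S_def closed_subalgebra_def)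
    show "X + Y \<in> S" if "X \<in> S" "Y \<in> S" for X Y
      using that closed_subalgebra_B_L2R
      by (auto simp: S_def closed_subalgebra_def compose_add_left compose_add_right)
    show "cscale_op c X \<in> S" if "X \<in> S" for c X
      using that closed_subalgebra_B_L2R B
      by (auto simp: S_def closed_subalgebra_def cscale_op_compose_left cscale_op_compose_right)
    show "X o\<^sub>L Y \<in> S" if "X \<in> S" "Y \<in> S" for X Y
    proof -
      have "P o\<^sub>L (X o\<^sub>L Y) o\<^sub>L Q = P o\<^sub>L X o\<^sub>L (Q o\<^sub>L P) o\<^sub>L (Y o\<^sub>L Q)"
        unfolding QP by (simp add: compose_assoc)
      also have "\<dots> = (P o\<^sub>L X o\<^sub>L Q) o\<^sub>L (P o\<^sub>L Y o\<^sub>L Q)" by (simp only: compose_assoc)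
      finally show ?thesis
        using that closed_subalgebra_B_L2R by (simp add: S_def closed_subalgebra_def)
    qed
  qed (auto simp: S_def)
  then have "A_ph \<subseteq> S" by (rule A_ph_minimal) (use gen in \<open>auto simp: S_def\<close>)
  then show ?thesis using X by (auto simp: S_def)
qed

lemma conj_W_A_ph:
  assumes q: "(\<exists>m\<ge>0. q = (0, m, 0)) \<or> (\<exists>s\<ge>0. q = (0, 0, s))" and X: "X \<in> A_ph"
  shows "W q o\<^sub>L X o\<^sub>L W_inv q \<in> A_ph"
proof -
  have mono: "W q o\<^sub>L W g o\<^sub>L W_inv q \<in> A_ph" if "gmul (gmul q g) (ginv q) \<in> Pos" for g
    using W_W_W_inv[of q g q] A_ph_W[OF that] by auto
  have *: "exp (- t) * m \<le> m" if "0 \<le> t" "0 \<le> m" for t m :: real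
    using that by (simp add: mult_left_le_one_le)
  show ?thesis
    by (rule conjugation_into_A_ph[OF _ _ _ _ _ _ X]; (rule mono)?) (use q * in auto)
qed

lemma conj_W_inv_A_ph:
  assumes q: "(\<exists>l\<ge>0. q = (l, 0, 0)) \<or> (\<exists>s\<ge>0. q = (0, 0, s))" and X: "X \<in> A_ph"
  shows "W_inv q o\<^sub>L X o\<^sub>L W q \<in> A_ph"
proof -
  have mono: "W_inv q o\<^sub>L W g o\<^sub>L W q \<in> A_ph" if "gmul (gmul (ginv q) g) q \<in> Pos" for g
    using W_inv_W_W[of q g q] A_ph_W[OF that] by auto
  have *: "l \<le> exp t * l" if "0 \<le> t" "0 \<le> l" for t l :: real
    using that mult_right_mono[of 1 "exp t" l] by simp
  show ?thesis
    by (rule conjugation_into_A_ph[OF _ _ _ _ _ _ X]; (rule mono)?) (use q * in auto)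
qed

lemma A_ph_right_normal:
  assumes "(\<exists>m\<ge>0. q = (0, m, 0)) \<or> (\<exists>s\<ge>0. q = (0, 0, s))" "X \<in> A_ph"
  shows "\<exists>X'\<in>A_ph. W q o\<^sub>L X = X' o\<^sub>L W q"
  using conj_W_A_ph[OF assms] by (intro bexI[of _ "W q o\<^sub>L X o\<^sub>L W_inv q"]) simp_all

lemma A_ph_left_normal:
  assumes "(\<exists>l\<ge>0. q = (l, 0, 0)) \<or> (\<exists>s\<ge>0. q = (0, 0, s))" "X \<in> A_ph"
  shows "\<exists>X'\<in>A_ph. X o\<^sub>L W q = W q o\<^sub>L X'"
  using conj_W_inv_A_ph[OF assms]
  by (intro bexI[of _ "W_inv q o\<^sub>L X o\<^sub>L W q"]) (simp_all add: compose_assoc[symmetric])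

lemma cscale_W_eq:
  assumes "cscale_op c (W p) = cscale_op d (W q)" "c \<noteq> 0"
  shows "p = q \<and> c = d"
proof -
  have "tr_inner (cscale_op c (W p)) (W p) = tr_inner (cscale_op d (W q)) (W p)" using assms(1) by simp
  then show ?thesis using assms(2) by (auto simp: tr_inner_simps tr_inner_W_W split: if_splits)
qed

lemma additive_nonneg_linear:
  fixes k :: "real \<Rightarrow> real"
  assumes add: "\<And>x y. x \<ge> 0 \<Longrightarrow> y \<ge> 0 \<Longrightarrow> k (x + y) = k x + k y"
    and nn: "\<And>x. x \<ge> 0 \<Longrightarrow> k x \<ge> 0" and x: "x \<ge> 0"
  shows "k x = k 1 * x"
proof -
  have k0: "k 0 = 0" using add[of 0 0] by simp
  have mult: "k (real n * y) = real n * k y" if "y \<ge> 0" for n y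
    by (induction n) (use that add in \<open>auto simp: k0 distrib_right\<close>)
  have mono: "k y \<le> k z" if "0 \<le> y" "y \<le> z" for y z
    using add[of y "z - y"] nn[of "z - y"] that by simp
  have "\<bar>k x - k 1 * x\<bar> \<le> k 1 * e" if e: "e > 0" for e
  proof -
    obtain n :: nat where n: "n > 0" "inverse (real n) < e" using reals_Archimedean[OF e] by (metis zero_less_Suc)
    define m where "m = nat \<lfloor>real n * x\<rfloor>"
    have "0 \<le> \<lfloor>real n * x\<rfloor>" using x by simp
    then have m: "real m \<le> real n * x" "real n * x \<le> real (Suc m)"
      unfolding m_def by linarith+
    have "real m * k 1 \<le> real n * k x" "real n * k x \<le> real (Suc m) * k 1"
      using mono[of "real m" "real n * x"] mono[of "real n * x" "real (Suc m)"] m x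
        mult[of 1 m] mult[of 1 "Suc m"] mult[of x n] by simp_all
    moreover have "real m * k 1 \<le> real n * x * k 1" "real n * x * k 1 \<le> real (Suc m) * k 1"
      using m nn[of 1] by (intro mult_right_mono; simp)+
    ultimately have "\<bar>real n * k x - real n * x * k 1\<bar> \<le> k 1"
      unfolding abs_le_iff by (simp add: distrib_right)
    also have "real n * k x - real n * x * k 1 = real n * (k x - k 1 * x)" by (simp add: algebra_simps)
    finally have "real n * \<bar>k x - k 1 * x\<bar> \<le> k 1" by (simp add: abs_mult)
    then have "\<bar>k x - k 1 * x\<bar> \<le> k 1 * inverse (real n)"
      using n(1) by (simp add: field_simps)
    also have "\<dots> \<le> k 1 * e" using n nn[of 1] by (intro mult_left_mono) auto
    finally show ?thesis .
  qed
  then have "k x - k 1 * x = 0" by (intro eq_zero_approx) simp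
  then show ?thesis by simp
qed

text \<open>
  The two hypotheses on doubling come from a dilation by $2$. Together with additivity they give
  $2 r = r$ and $a^2 = a$, after which $k$ is additive.
\<close>

lemma one_parameter_rigidity:
  fixes k r :: "real \<Rightarrow> real" and a :: "real \<Rightarrow> complex"
  assumes k: "\<And>x y. x \<ge> 0 \<Longrightarrow> y \<ge> 0 \<Longrightarrow> k (x + y) = k x + exp (e * r x) * k y" "\<And>x. x \<ge> 0 \<Longrightarrow> k x \<ge> 0"
    and r: "\<And>x y. x \<ge> 0 \<Longrightarrow> y \<ge> 0 \<Longrightarrow> r (x + y) = r x + r y" "\<And>x. x \<ge> 0 \<Longrightarrow> r (2 * x) = r x"
    and a: "\<And>x y. x \<ge> 0 \<Longrightarrow> y \<ge> 0 \<Longrightarrow> a (x + y) = a x * a y" "\<And>x. x \<ge> 0 \<Longrightarrow> a (2 * x) = a x"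
      "\<And>x. x \<ge> 0 \<Longrightarrow> cmod (a x) = 1"
  shows "\<exists>K\<ge>0. \<forall>x\<ge>0. k x = K * x \<and> r x = 0 \<and> a x = 1"
proof -
  have r0: "r x = 0" if "x \<ge> 0" for x
    using r(1)[of x x] r(2)[of x] that by (simp flip: mult_2)
  have a1: "a x = 1" if x: "x \<ge> 0" for x
  proof -
    have "a x * a x = a x" using a(1)[of x x] a(2)[of x] x by (simp flip: mult_2)
    moreover have "a x \<noteq> 0" using a(3)[OF x] by auto
    ultimately show ?thesis by simp
  qed
  have add: "k (x + y) = k x + k y" if "x \<ge> 0" "y \<ge> 0" for x y
    using k(1)[OF that] r0[OF that(1)] by simp
  show ?thesis
  proof (intro exI conjI allI impI)
    show "0 \<le> k 1" by (rule k(2)) simp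
    show "k x = k 1 * x" if "x \<ge> 0" for x
      using add k(2) that by (rule additive_nonneg_linear)
  qed (simp_all add: r0 a1)
qed

lemma cis_linear_unique:
  assumes "\<And>x. x \<ge> 0 \<Longrightarrow> cis (p * x) = cis (q * x)" shows "p = q"
proof (rule ccontr)
  assume "p \<noteq> q"
  define d where "d = p - q"
  have d: "d \<noteq> 0" using \<open>p \<noteq> q\<close> by (simp add: d_def)
  define x where "x = pi / \<bar>d\<bar>"
  have x: "x \<ge> 0" by (simp add: x_def)
  have "cis (d * x) = cis (p * x) / cis (q * x)"
    by (simp add: d_def left_diff_distrib cis_divide)
  also have "\<dots> = 1" using assms[OF x] by simp
  finally have "cis (d * x) = 1" .
  moreover have "cis (d * x) = - 1"
  proof (cases "d > 0")
    case True
    then show ?thesis by (simp add: x_def)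
  next
    case False
    then have "d * x = - pi" using d by (simp add: x_def field_simps)
    then show ?thesis by (simp flip: cis_cnj)
  qed
  ultimately show False by simp
qed

lemma dilation_relation:
  "W (0, 0, t) o\<^sub>L W (l, 0, 0) = W (exp t * l, 0, 0) o\<^sub>L W (0, 0, t)"
  "W (0, 0, t) o\<^sub>L W (0, m, 0) = W (0, exp (- t) * m, 0) o\<^sub>L W (0, 0, t)"
  by (simp_all add: W_compose)

lemma semigroup_relation:
  "W (l, 0, 0) o\<^sub>L W (l', 0, 0) = W (l + l', 0, 0)"
  "W (0, m, 0) o\<^sub>L W (0, m', 0) = W (0, m + m', 0)"
  "W (0, 0, t) o\<^sub>L W (0, 0, t') = W (0, 0, t + t')"
  by (simp_all add: W_compose)

lemma commutation_relation:
  "W (0, m, 0) o\<^sub>L W (l, 0, 0) = cscale_op (cis (- (m * l))) (W (l, 0, 0) o\<^sub>L W (0, m, 0))"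
  by (simp add: W_compose)

lemma cscale_W_compose:
  "cscale_op c (W g) o\<^sub>L cscale_op d (W h) = cscale_op (c * d * phase g h) (W (gmul g h))"
  by (simp add: cscale_op_compose_left cscale_op_compose_right W_compose cscale_op_cscale_op mult_ac)

definition right_form :: "oper \<Rightarrow> bool" where
  "right_form U \<longleftrightarrow> (\<exists>c m t. cmod c = 1 \<and> m \<ge> 0 \<and> t \<ge> 0 \<and> U = cscale_op c (W (0, m, t)))"

definition left_form :: "oper \<Rightarrow> bool" where
  "left_form U \<longleftrightarrow> (\<exists>c l t. cmod c = 1 \<and> l \<ge> 0 \<and> t \<ge> 0 \<and> U = cscale_op c (W (l, 0, t)))"

text \<open>
  The flag \<open>pres\<close> distinguishes multiplicative from anti-multiplicative maps. The hypotheses of the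
  classification only involve products, and an anti-multiplicative map exchanges the two versions.
\<close>

lemma generator_image_form:
  assumes Th: "\<And>X. X \<in> A_ph \<Longrightarrow> \<Theta> X \<in> A_ph" "\<And>X. X \<in> A_ph \<Longrightarrow> norm (\<Theta> X) = norm X"
      "\<And>X Y. X \<in> A_ph \<Longrightarrow> Y \<in> A_ph \<Longrightarrow> \<Theta> (X o\<^sub>L Y) = (if pres then \<Theta> X o\<^sub>L \<Theta> Y else \<Theta> Y o\<^sub>L \<Theta> X)"
      "\<And>Y. Y \<in> weyl_span Pos \<Longrightarrow> \<exists>X\<in>A_ph. \<Theta> X = Y"
    and q: "q \<in> Pos"
  shows "(\<exists>m\<ge>0. q = (0, m, 0)) \<or> (\<exists>s\<ge>0. q = (0, 0, s)) \<Longrightarrow>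
      if pres then right_form (\<Theta> (W q)) else left_form (\<Theta> (W q))"
    and "(\<exists>l\<ge>0. q = (l, 0, 0)) \<or> (\<exists>s\<ge>0. q = (0, 0, s)) \<Longrightarrow>
      if pres then left_form (\<Theta> (W q)) else right_form (\<Theta> (W q))"
proof -
  note Wq = A_ph_W[OF q]
  have UA: "\<Theta> (W q) \<in> A_ph" by (rule Th(1)[OF Wq])
  have iso: "norm (\<Theta> (W q) o\<^sub>L X) = norm X \<and> norm (X o\<^sub>L \<Theta> (W q)) = norm X" if X: "X \<in> weyl_span Pos" for X
  proof -
    obtain Y where Y: "Y \<in> A_ph" "\<Theta> Y = X" using Th(4)[OF X] by blast
    have n: "norm (\<Theta> (W q o\<^sub>L Y)) = norm X" "norm (\<Theta> (Y o\<^sub>L W q)) = norm X"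
      using Th(2)[of "W q o\<^sub>L Y"] Th(2)[of "Y o\<^sub>L W q"] Th(2)[OF Y(1)] Wq Y by simp_all
    show ?thesis
      using n unfolding Th(3)[OF Wq Y(1)] Th(3)[OF Y(1) Wq] Y(2) by (cases pres) simp_all
  qed
  have normal: "\<exists>X\<in>A_ph. if pres = right then \<Theta> (W q) o\<^sub>L W p = X o\<^sub>L \<Theta> (W q) else W p o\<^sub>L \<Theta> (W q) = \<Theta> (W q) o\<^sub>L X"
    if p: "p \<in> Pos" and ex: "\<And>Y. Y \<in> A_ph \<Longrightarrow> \<exists>Y'\<in>A_ph. if right then W q o\<^sub>L Y = Y' o\<^sub>L W q else Y o\<^sub>L W q = W q o\<^sub>L Y'" for p right
  proof -
    obtain Y where Y: "Y \<in> A_ph" "\<Theta> Y = W p" using Th(4) p by (blast intro: weyl_span.intros)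
    obtain Y' where Y': "Y' \<in> A_ph" "if right then W q o\<^sub>L Y = Y' o\<^sub>L W q else Y o\<^sub>L W q = W q o\<^sub>L Y'"
      using ex[OF Y(1)] by blast
    have "if pres = right then \<Theta> (W q) o\<^sub>L W p = \<Theta> Y' o\<^sub>L \<Theta> (W q) else W p o\<^sub>L \<Theta> (W q) = \<Theta> (W q) o\<^sub>L \<Theta> Y'"
      using Th(3)[OF Wq Y(1)] Th(3)[OF Y(1) Wq] Th(3)[OF Wq Y'(1)] Th(3)[OF Y'(1) Wq] Y(2) Y'(2)
      by (cases pres; cases right) simp_all
    then show ?thesis using Th(1)[OF Y'(1)] by blast
  qed
  note R = right_normal_classification[OF UA, folded right_form_def]
    and L = left_normal_classification[OF UA, folded left_form_def]
  show "if pres then right_form (\<Theta> (W q)) else left_form (\<Theta> (W q))"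
    if form: "(\<exists>m\<ge>0. q = (0, m, 0)) \<or> (\<exists>s\<ge>0. q = (0, 0, s))"
    using R L iso normal[where right = True] A_ph_right_normal[OF form] by (cases pres) simp_all
  show "if pres then left_form (\<Theta> (W q)) else right_form (\<Theta> (W q))"
    if form: "(\<exists>l\<ge>0. q = (l, 0, 0)) \<or> (\<exists>s\<ge>0. q = (0, 0, s))"
    using R L iso normal[where right = False] A_ph_left_normal[OF form] by (cases pres) simp_all
qed

text \<open>
  The families stand for the images of $M$, $D$, $V$ under an automorphism, and for those of $D$, $M$,
  $V$, in this order, under an antiautomorphism. Both kinds of images satisfy these relations; it is
  the commutation relation of the first two families that tells them apart.
\<close>

lemma generators_normal_form:
  fixes M D V :: "real \<Rightarrow> oper"
  assumes form: "\<And>x. x \<ge> 0 \<Longrightarrow> left_form (M x)" "\<And>x. x \<ge> 0 \<Longrightarrow> right_form (D x)"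
      "\<And>x. x \<ge> 0 \<Longrightarrow> left_form (V x)" "\<And>x. x \<ge> 0 \<Longrightarrow> right_form (V x)"
    and add: "\<And>x y. x \<ge> 0 \<Longrightarrow> y \<ge> 0 \<Longrightarrow> M x o\<^sub>L M y = M (x + y)"
      "\<And>x y. x \<ge> 0 \<Longrightarrow> y \<ge> 0 \<Longrightarrow> D x o\<^sub>L D y = D (x + y)"
    and dil: "\<And>t x. t \<ge> 0 \<Longrightarrow> x \<ge> 0 \<Longrightarrow> V t o\<^sub>L M x = M (exp t * x) o\<^sub>L V t"
      "\<And>t x. t \<ge> 0 \<Longrightarrow> x \<ge> 0 \<Longrightarrow> D x o\<^sub>L V t = V t o\<^sub>L D (exp t * x)"
  shows "\<exists>k1 k2 c s. k1 \<ge> 0 \<and> k2 \<ge> 0 \<and> (\<forall>x\<ge>0. M x = W (k1 * x, 0, 0)) \<and> (\<forall>x\<ge>0. D x = W (0, k2 * x, 0)) \<and>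
    (\<forall>t\<ge>0. cmod (c t) = 1 \<and> V t = cscale_op (c t) (W (0, 0, s t)) \<and> k1 * exp t = k1 * exp (s t))"
proof -
  have "\<forall>x. \<exists>a k r. x \<ge> 0 \<longrightarrow> cmod a = 1 \<and> k \<ge> 0 \<and> M x = cscale_op a (W (k, 0, r))"
    using form(1) unfolding left_form_def by blast
  then obtain a k r where M: "\<And>x. x \<ge> 0 \<Longrightarrow> cmod (a x) = 1" "\<And>x. x \<ge> 0 \<Longrightarrow> k x \<ge> 0"
    "\<And>x. x \<ge> 0 \<Longrightarrow> M x = cscale_op (a x) (W (k x, 0, r x))" by metis
  have "\<forall>x. \<exists>b h u. x \<ge> 0 \<longrightarrow> cmod b = 1 \<and> h \<ge> 0 \<and> D x = cscale_op b (W (0, h, u))"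
    using form(2) unfolding right_form_def by blast
  then obtain b h u where D: "\<And>x. x \<ge> 0 \<Longrightarrow> cmod (b x) = 1" "\<And>x. x \<ge> 0 \<Longrightarrow> h x \<ge> 0"
    "\<And>x. x \<ge> 0 \<Longrightarrow> D x = cscale_op (b x) (W (0, h x, u x))" by metis
  have "\<exists>c s. t \<ge> 0 \<longrightarrow> cmod c = 1 \<and> V t = cscale_op c (W (0, 0, s))" for t
  proof (cases "t \<ge> 0")
    case True
    obtain c l s where 1: "cmod c = 1" "V t = cscale_op c (W (l, 0, s))"
      using form(3)[OF True] unfolding left_form_def by blast
    obtain c' m s' where 2: "V t = cscale_op c' (W (0, m, s'))"
      using form(4)[OF True] unfolding right_form_def by blast
    have "cscale_op c (W (l, 0, s)) = cscale_op c' (W (0, m, s'))" "c \<noteq> 0" using 1 2 by auto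
    then have "l = 0" using cscale_W_eq by blast
    then show ?thesis using 1 by blast
  qed simp
  then obtain c s where V: "\<And>t. t \<ge> 0 \<Longrightarrow> cmod (c t) = 1" "\<And>t. t \<ge> 0 \<Longrightarrow> V t = cscale_op (c t) (W (0, 0, s t))"
    by metis
  have Madd: "k (x + y) = k x + exp (r x) * k y \<and> r (x + y) = r x + r y \<and> a (x + y) = a x * a y"
    if xy: "x \<ge> 0" "y \<ge> 0" for x y
  proof -
    have "cscale_op (a (x + y)) (W (k (x + y), 0, r (x + y))) =
        cscale_op (a x * a y) (W (k x + exp (r x) * k y, 0, r x + r y))"
      using xy add(1)[OF xy] by (simp add: M(3) cscale_W_compose)
    from cscale_W_eq[OF this] show ?thesis using M(1)[of "x + y"] xy by fastforce
  qed
  have Dadd: "h (x + y) = h x + exp (- u x) * h y \<and> u (x + y) = u x + u y \<and> b (x + y) = b x * b y"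
    if xy: "x \<ge> 0" "y \<ge> 0" for x y
  proof -
    have "cscale_op (b (x + y)) (W (0, h (x + y), u (x + y))) =
        cscale_op (b x * b y) (W (0, h x + exp (- u x) * h y, u x + u y))"
      using xy add(2)[OF xy] by (simp add: D(3) cscale_W_compose)
    from cscale_W_eq[OF this] show ?thesis using D(1)[of "x + y"] xy by fastforce
  qed
  have Mdil: "k (exp t * x) = exp (s t) * k x \<and> r (exp t * x) = r x \<and> a (exp t * x) = a x"
    if tx: "t \<ge> 0" "x \<ge> 0" for t x
  proof -
    have "cscale_op (c t * a x) (W (exp (s t) * k x, 0, s t + r x)) =
       cscale_op (a (exp t * x) * c t) (W (k (exp t * x), 0, r (exp t * x) + s t))"
      using tx dil(1)[OF tx] by (simp add: M(3) V(2) cscale_W_compose)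
    moreover have "c t * a x \<noteq> 0" using M(1)[OF tx(2)] V(1)[OF tx(1)] by auto
    ultimately show ?thesis using cscale_W_eq V(1)[OF tx(1)] by fastforce
  qed
  have Ddil: "u (exp t * x) = u x \<and> b (exp t * x) = b x" if tx: "t \<ge> 0" "x \<ge> 0" for t x
  proof -
    have "cscale_op (b x * c t) (W (0, h x, u x + s t)) =
       cscale_op (c t * b (exp t * x)) (W (0, exp (- s t) * h (exp t * x), s t + u (exp t * x)))"
      using tx dil(2)[OF tx] by (simp add: D(3) V(2) cscale_W_compose)
    moreover have "b x * c t \<noteq> 0" using D(1)[OF tx(2)] V(1)[OF tx(1)] by auto
    ultimately show ?thesis using cscale_W_eq V(1)[OF tx(1)] by fastforce
  qed
  have "\<exists>K\<ge>0. \<forall>x\<ge>0. k x = K * x \<and> r x = 0 \<and> a x = 1"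
    by (rule one_parameter_rigidity[where e = 1]) (use Madd Mdil[of "ln 2"] M in auto)
  then obtain k1 where k1: "k1 \<ge> 0" "\<And>x. x \<ge> 0 \<Longrightarrow> k x = k1 * x \<and> r x = 0 \<and> a x = 1" by blast
  have "\<exists>K\<ge>0. \<forall>x\<ge>0. h x = K * x \<and> u x = 0 \<and> b x = 1"
    by (rule one_parameter_rigidity[where e = "-1"]) (use Dadd Ddil[of "ln 2"] D in auto)
  then obtain k2 where k2: "k2 \<ge> 0" "\<And>x. x \<ge> 0 \<Longrightarrow> h x = k2 * x \<and> u x = 0 \<and> b x = 1" by blast
  show ?thesis
  proof (intro exI conjI allI impI)
    show "0 \<le> k1" "0 \<le> k2" by (rule k1(1), rule k2(1))
    show "M x = W (k1 * x, 0, 0)" if "x \<ge> 0" for x using M(3)[OF that] k1(2)[OF that] by simp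
    show "D x = W (0, k2 * x, 0)" if "x \<ge> 0" for x using D(3)[OF that] k2(2)[OF that] by simp
    fix t :: real assume t: "t \<ge> 0"
    show "cmod (c t) = 1" "V t = cscale_op (c t) (W (0, 0, s t))" using V t by auto
    show "k1 * exp t = k1 * exp (s t)" using Mdil[OF t, of 1] k1(2)[of "exp t"] k1(2)[of 1] by simp
  qed
qed

lemma automorphism_form:
  assumes Th: "\<And>X. X \<in> A_ph \<Longrightarrow> \<Theta> X \<in> A_ph" "\<And>X. X \<in> A_ph \<Longrightarrow> norm (\<Theta> X) = norm X"
      "\<And>X Y. X \<in> A_ph \<Longrightarrow> Y \<in> A_ph \<Longrightarrow> \<Theta> (X o\<^sub>L Y) = \<Theta> X o\<^sub>L \<Theta> Y"
      "\<And>Y. Y \<in> weyl_span Pos \<Longrightarrow> \<exists>X\<in>A_ph. \<Theta> X = Y"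
    and lin: "\<And>c X. X \<in> A_ph \<Longrightarrow> \<Theta> (cscale_op c X) = cscale_op c (\<Theta> X)"
  shows "\<exists>k1 k2 c. 0 < k1 \<and> 0 < k2 \<and> k1 * k2 = 1 \<and> (\<forall>s\<ge>0. \<forall>t\<ge>0. c (s + t) = c s * c t) \<and>
     (\<forall>l\<ge>0. \<Theta> (W (l, 0, 0)) = W (k1 * l, 0, 0)) \<and> (\<forall>m\<ge>0. \<Theta> (W (0, m, 0)) = W (0, k2 * m, 0)) \<and>
     (\<forall>t\<ge>0. \<Theta> (W (0, 0, t)) = cscale_op (c t) (W (0, 0, t)))"
proof -
  define M D V where "M x = \<Theta> (W (x, 0, 0))" and "D x = \<Theta> (W (0, x, 0))" and "V x = \<Theta> (W (0, 0, x))" for x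
  note R = generator_image_form(1)[of \<Theta> True, simplified, OF Th] and L = generator_image_form(2)[of \<Theta> True, simplified, OF Th]
  have comp: "\<Theta> (W p o\<^sub>L W q) = \<Theta> (W p) o\<^sub>L \<Theta> (W q)" if "p \<in> Pos" "q \<in> Pos" for p q
    using that by (intro Th(3) A_ph_W)
  have "\<exists>k1 k2 c s. k1 \<ge> 0 \<and> k2 \<ge> 0 \<and> (\<forall>x\<ge>0. M x = W (k1 * x, 0, 0)) \<and> (\<forall>x\<ge>0. D x = W (0, k2 * x, 0)) \<and>
    (\<forall>t\<ge>0. cmod (c t) = 1 \<and> V t = cscale_op (c t) (W (0, 0, s t)) \<and> k1 * exp t = k1 * exp (s t))"
  proof (rule generators_normal_form)
    fix t x :: real assume tx: "t \<ge> 0" "x \<ge> 0"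
    show "V t o\<^sub>L M x = M (exp t * x) o\<^sub>L V t"
      unfolding M_def V_def using tx by (simp add: dilation_relation flip: comp)
    show "D x o\<^sub>L V t = V t o\<^sub>L D (exp t * x)"
      unfolding D_def V_def using tx by (simp add: dilation_relation flip: comp) (simp flip: mult.assoc exp_add)
  qed (simp_all add: M_def D_def V_def R L semigroup_relation flip: comp)
  then obtain k1 k2 c s where k: "k1 \<ge> 0" "k2 \<ge> 0" "\<And>x. x \<ge> 0 \<Longrightarrow> M x = W (k1 * x, 0, 0)" "\<And>x. x \<ge> 0 \<Longrightarrow> D x = W (0, k2 * x, 0)"
    and V: "\<And>t. t \<ge> 0 \<Longrightarrow> cmod (c t) = 1" "\<And>t. t \<ge> 0 \<Longrightarrow> V t = cscale_op (c t) (W (0, 0, s t))"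
      "\<And>t. t \<ge> 0 \<Longrightarrow> k1 * exp t = k1 * exp (s t)" by blast
  have "cis (- (k1 * k2) * x) = cis (- 1 * x)" if x: "x \<ge> 0" for x
  proof -
    have "D 1 o\<^sub>L M x = cscale_op (cis (- x)) (M x o\<^sub>L D 1)"
      unfolding M_def D_def using x lin[of "W (x, 0, 0) o\<^sub>L W (0, 1, 0)" "cis (- x)"]
      by (simp add: commutation_relation A_ph_W flip: comp)
    then have "cscale_op (cis (- (k1 * k2 * x))) (W (k1 * x, k2, 0)) = cscale_op (cis (- x)) (W (k1 * x, k2, 0))"
      using x by (simp add: k W_compose mult_ac)
    from cscale_W_eq[OF this] show ?thesis by simp
  qed
  then have "- (k1 * k2) = - 1" by (rule cis_linear_unique)
  then have k12: "k1 * k2 = 1" by simp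
  have pos: "k1 > 0" "k2 > 0" using k12 k(1,2) by (auto simp: less_le)
  have VW: "V t = cscale_op (c t) (W (0, 0, t))" if "t \<ge> 0" for t
    using V(2,3)[OF that] pos by simp
  have "c (x + y) = c x * c y" if xy: "x \<ge> 0" "y \<ge> 0" for x y
  proof -
    have "V x o\<^sub>L V y = V (x + y)"
      unfolding V_def using xy by (simp add: semigroup_relation flip: comp)
    then have "cscale_op (c x * c y) (W (0, 0, x + y)) = cscale_op (c (x + y)) (W (0, 0, x + y))"
      using xy by (simp add: VW cscale_W_compose)
    then show ?thesis using cscale_W_eq[of "c x * c y"] V(1)[OF xy(1)] V(1)[OF xy(2)] by fastforce
  qed
  then show ?thesis using pos k12 k(3,4) VW unfolding M_def D_def V_def by blast
qed

text \<open>
  In the commutation relation the exchange of $M$ and $D$ compensates the reversal of products, but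
  the conjugation of scalars changes the sign of the phase, and nonnegative parameters of the images
  cannot undo this.
\<close>

lemma no_antiautomorphism:
  assumes Th: "\<And>X. X \<in> A_ph \<Longrightarrow> \<Theta> X \<in> A_ph" "\<And>X. X \<in> A_ph \<Longrightarrow> norm (\<Theta> X) = norm X"
      "\<And>X Y. X \<in> A_ph \<Longrightarrow> Y \<in> A_ph \<Longrightarrow> \<Theta> (X o\<^sub>L Y) = \<Theta> Y o\<^sub>L \<Theta> X"
      "\<And>Y. Y \<in> weyl_span Pos \<Longrightarrow> \<exists>X\<in>A_ph. \<Theta> X = Y"
    and lin: "\<And>c X. X \<in> A_ph \<Longrightarrow> \<Theta> (cscale_op c X) = cscale_op (cnj c) (\<Theta> X)"
  shows False
proof -
  define M D V where "M x = \<Theta> (W (0, x, 0))" and "D x = \<Theta> (W (x, 0, 0))" and "V x = \<Theta> (W (0, 0, x))" for x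
  note L = generator_image_form(1)[of \<Theta> False, simplified, OF Th] and R = generator_image_form(2)[of \<Theta> False, simplified, OF Th]
  have comp: "\<Theta> (W q o\<^sub>L W p) = \<Theta> (W p) o\<^sub>L \<Theta> (W q)" if "p \<in> Pos" "q \<in> Pos" for p q
    using that by (intro Th(3) A_ph_W)
  have "\<exists>k1 k2 c s. k1 \<ge> 0 \<and> k2 \<ge> 0 \<and> (\<forall>x\<ge>0. M x = W (k1 * x, 0, 0)) \<and> (\<forall>x\<ge>0. D x = W (0, k2 * x, 0)) \<and>
    (\<forall>t\<ge>0. cmod (c t) = 1 \<and> V t = cscale_op (c t) (W (0, 0, s t)) \<and> k1 * exp t = k1 * exp (s t))"
  proof (rule generators_normal_form)
    fix t x :: real assume tx: "t \<ge> 0" "x \<ge> 0"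
    show "V t o\<^sub>L M x = M (exp t * x) o\<^sub>L V t"
      unfolding M_def V_def using tx by (simp add: dilation_relation flip: comp) (simp flip: mult.assoc exp_add)
    show "D x o\<^sub>L V t = V t o\<^sub>L D (exp t * x)"
      unfolding D_def V_def using tx by (simp add: dilation_relation flip: comp)
  qed (simp_all add: M_def D_def V_def R L semigroup_relation add.commute flip: comp)
  then obtain k1 k2 where k: "k1 \<ge> 0" "k2 \<ge> 0" "\<And>x. x \<ge> 0 \<Longrightarrow> M x = W (k1 * x, 0, 0)" "\<And>x. x \<ge> 0 \<Longrightarrow> D x = W (0, k2 * x, 0)"
    by blast
  have "cis (- (k1 * k2) * x) = cis (1 * x)" if x: "x \<ge> 0" for x
  proof -
    have "D x o\<^sub>L M 1 = cscale_op (cis x) (M 1 o\<^sub>L D x)"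
      unfolding M_def D_def using x lin[of "W (x, 0, 0) o\<^sub>L W (0, 1, 0)" "cis (- x)"]
      by (simp add: commutation_relation A_ph_W cis_cnj flip: comp)
    then have "cscale_op (cis (- (k1 * k2 * x))) (W (k1, k2 * x, 0)) = cscale_op (cis x) (W (k1, k2 * x, 0))"
      using x by (simp add: k W_compose mult_ac)
    from cscale_W_eq[OF this] show ?thesis by simp
  qed
  then have "- (k1 * k2) = 1" by (rule cis_linear_unique)
  moreover have "k1 * k2 \<ge> 0" using k(1,2) by simp
  ultimately show False by simp
qed

text \<open>
  The map sending $X$ to the adjoint of $\Psi(X)$ would be an antiautomorphism of the kind that
  \<open>no_antiautomorphism\<close> excludes. Its range contains the finite combinations, as their adjoints are
  explicit.
\<close>

lemma chiral_A_ph: "chiral A_ph"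
  unfolding chiral_def
proof
  assume "\<exists>\<Psi>. isometric_isomorphism A_ph (adjoint_algebra A_ph) \<Psi>"
  then obtain \<Psi> where bij: "bij_betw \<Psi> A_ph (adjoint_algebra A_ph)"
    and scale: "\<And>c X. X \<in> A_ph \<Longrightarrow> \<Psi> (cscale_op c X) = cscale_op c (\<Psi> X)"
    and mult: "\<And>X Y. X \<in> A_ph \<Longrightarrow> Y \<in> A_ph \<Longrightarrow> \<Psi> (X o\<^sub>L Y) = \<Psi> X o\<^sub>L \<Psi> Y"
    and iso: "\<And>X. X \<in> A_ph \<Longrightarrow> norm (\<Psi> X) = norm X"
    unfolding isometric_isomorphism_def by blast
  have "\<exists>Y\<in>A_ph. is_adjoint Y (\<Psi> X)" if "X \<in> A_ph" for X
    using bij_betwE[OF bij] that by (auto simp: adjoint_algebra_def)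
  then obtain \<Theta> where Th: "\<And>X. X \<in> A_ph \<Longrightarrow> \<Theta> X \<in> A_ph" "\<And>X. X \<in> A_ph \<Longrightarrow> is_adjoint (\<Theta> X) (\<Psi> X)"
    by metis
  show False
  proof (rule no_antiautomorphism[of \<Theta>])
    show "norm (\<Theta> X) = norm X" if "X \<in> A_ph" for X
      using is_adjoint_norm[OF Th(2)[OF that]] iso[OF that] by simp
    show "\<Theta> (X o\<^sub>L Y) = \<Theta> Y o\<^sub>L \<Theta> X" if "X \<in> A_ph" "Y \<in> A_ph" for X Y
    proof (rule is_adjoint_unique)
      show "is_adjoint (\<Theta> (X o\<^sub>L Y)) (\<Psi> X o\<^sub>L \<Psi> Y)" using Th(2)[of "X o\<^sub>L Y"] mult that by simp
      show "is_adjoint (\<Theta> Y o\<^sub>L \<Theta> X) (\<Psi> X o\<^sub>L \<Psi> Y)" using Th(2) that by (intro is_adjoint_compose) auto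
    qed
    show "\<Theta> (cscale_op c X) = cscale_op (cnj c) (\<Theta> X)" if "X \<in> A_ph" for c X
    proof (rule is_adjoint_unique)
      show "is_adjoint (\<Theta> (cscale_op c X)) (cscale_op c (\<Psi> X))" using Th(2)[of "cscale_op c X"] scale that by simp
      show "is_adjoint (cscale_op (cnj c) (\<Theta> X)) (cscale_op c (\<Psi> X))"
        using is_adjoint_cscale[OF Th(2)[OF that], of "cnj c"] by simp
    qed
    show "\<exists>X\<in>A_ph. \<Theta> X = Y" if Y: "Y \<in> weyl_span Pos" for Y
    proof -
      have "Y \<in> weyl_span UNIV" using Y weyl_span_mono[of Pos UNIV] by auto
      then obtain Y' where Y': "Y' \<in> weyl_span UNIV" "is_adjoint Y Y'" using weyl_span_adjoint by blast
      then have "Y' \<in> adjoint_algebra A_ph"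
        using weyl_span_B weyl_span_A_ph[OF Y] by (auto simp: adjoint_algebra_def)
      then have "Y' \<in> \<Psi> ` A_ph" using bij_betw_imp_surj_on[OF bij] by simp
      then obtain X where X: "X \<in> A_ph" "\<Psi> X = Y'" by blast
      then have "\<Theta> X = Y" using is_adjoint_unique[OF Th(2)[OF X(1)]] Y'(2) by simp
      then show ?thesis using X(1) by blast
    qed
  qed (use Th in auto)
qed

theorem theorem4p11:
  shows "(\<forall>\<Phi>. isometric_automorphism A_ph \<Phi> \<longrightarrow>
           (\<exists>(k1::real) (k2::real) (c :: real \<Rightarrow> complex).
              k1 > 0 \<and> k2 > 0 \<and> k1 * k2 = 1 \<and>
              (\<forall>s\<ge>0. \<forall>t\<ge>0. c (s + t) = c s * c t) \<and>
              (\<forall>l\<ge>0. \<Phi> (mult_op l) = mult_op (k1 * l)) \<and>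
              (\<forall>\<mu>\<ge>0. \<Phi> (transl_op \<mu>) = transl_op (k2 * \<mu>)) \<and>
              (\<forall>t\<ge>0. \<Phi> (dil_op t) = cscale_op (c t) (dil_op t))))
       \<and> chiral A_ph"
proof (intro conjI allI impI chiral_A_ph)
  fix \<Phi> assume "isometric_automorphism A_ph \<Phi>"
  then have bij: "bij_betw \<Phi> A_ph A_ph"
    and scale: "\<And>c X. X \<in> A_ph \<Longrightarrow> \<Phi> (cscale_op c X) = cscale_op c (\<Phi> X)"
    and mult: "\<And>X Y. X \<in> A_ph \<Longrightarrow> Y \<in> A_ph \<Longrightarrow> \<Phi> (X o\<^sub>L Y) = \<Phi> X o\<^sub>L \<Phi> Y"
    and iso: "\<And>X. X \<in> A_ph \<Longrightarrow> norm (\<Phi> X) = norm X"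
    unfolding isometric_isomorphism_def by blast+
  show "\<exists>(k1::real) (k2::real) (c :: real \<Rightarrow> complex).
              k1 > 0 \<and> k2 > 0 \<and> k1 * k2 = 1 \<and>
              (\<forall>s\<ge>0. \<forall>t\<ge>0. c (s + t) = c s * c t) \<and>
              (\<forall>l\<ge>0. \<Phi> (mult_op l) = mult_op (k1 * l)) \<and>
              (\<forall>\<mu>\<ge>0. \<Phi> (transl_op \<mu>) = transl_op (k2 * \<mu>)) \<and>
              (\<forall>t\<ge>0. \<Phi> (dil_op t) = cscale_op (c t) (dil_op t))"
    unfolding mult_op_W transl_op_W dil_op_W
  proof (rule automorphism_form)
    show "\<Phi> X \<in> A_ph" if "X \<in> A_ph" for X using bij_betwE[OF bij] that by blast
    show "\<exists>X\<in>A_ph. \<Phi> X = Y" if "Y \<in> weyl_span Pos" for Y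
    proof -
      have "Y \<in> \<Phi> ` A_ph" using bij_betw_imp_surj_on[OF bij] weyl_span_A_ph[OF that] by simp
      then show ?thesis by blast
    qed
  qed (use scale mult iso in auto)
qed

end
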